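(* Let $\mathcal F$ be a stable family of finite-dimensional operator algebras and let $\mathcal A$ be a separable Banach subalgebra of a $C^*$-algebra. Then the following are equivalent. (1) There exists a chain $\mathcal A_1\subseteq\mathcal A_2\subseteq\cdots$ of subalgebras of $\mathcal A$ such that $\mathcal A$ is the norm closure of $\bigcup_i\mathcal A_i$ and each $\mathcal A_i$ is star extendibly isomorphic to an algebra in $\mathcal F$. (2) For each $\epsilon>0$ and each finite subset $\mathcal S\subseteq\mathcal A$ there exist $\mathcal B\in\mathcal F$ and a star extendible injection $\phi:\mathcal B\to\mathcal A$ with $\mathrm{dist}(\mathcal S,\phi(\mathcal B))<\epsilon$.
   Context: For an operator algebra $\mathcal B$ (a subalgebra of a $C^*$-algebra), $C^*(\mathcal B)$ is the $C^*$-algebra it generates; members of $\mathcal F$ are subalgebras of full matrix algebras $M_n$ over $\mathbb C$. A star extendible embedding (or injection) of $\mathcal B$ into an operator algebra $\mathcal A$ is an algebra homomorphism that is the restriction of an injective $*$-homomorphism $C^*(\mathcal B)\to C^*(\mathcal A)$ (not required to be unital); a star extendible isomorphism is the restriction of a $*$-isomorphism between the generated $C^*$-algebras which carries one algebra onto the other. For subalgebras $X,Y$ of a common $C^*$-algebra, $X\subseteq_\delta Y$ means that for every $x\in X$ with $\|x\|\le1$ there is $y\in Y$ with $\|y\|\le1$ and $\|x-y\|\le\delta$. The family $\mathcal F$ is stable if for every $\epsilon>0$ and every $\mathcal A_1\in\mathcal F$ there exists $\delta>0$ such that whenever $\mathcal A_2\in\mathcal F$ and $\phi_1:\mathcal A_1\to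 M_n$, $\phi_2:\mathcal A_2\to M_n$ are star extendible embeddings with $\phi_1(\mathcal A_1)\subseteq_\delta\phi_2(\mathcal A_2)$, there exists a star extendible algebra injection $\psi:\mathcal A_1\to M_n$ with $\|\phi_1-\psi\|<\epsilon$ and $\psi(\mathcal A_1)\subseteq\phi_2(\mathcal A_2)$. $\mathrm{dist}(\mathcal S,X)<\epsilon$ means that every $s\in\mathcal S$ is at distance less than $\epsilon$ from $X$. *)

theory Defs
  imports "HOL-Analysis.Analysis" "Jordan_Normal_Form.Schur_Decomposition"
begin

section \<open>C*-algebras\<close>

class complex_scale =
  fixes scaleC :: "complex \<Rightarrow> 'a \<Rightarrow> 'a" (infixr "*\<^sub>C" 75)

class involution =
  fixes star :: "'a \<Rightarrow> 'a"

text \<open>Not necessarily unital: \<open>real_normed_algebra\<close> does not provide a unit.\<close>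

class cstar_algebra = real_normed_algebra + banach + complex_scale + involution +
  assumes scaleC_of_real: "complex_of_real r *\<^sub>C x = r *\<^sub>R x"
    and scaleC_add_right: "c *\<^sub>C (x + y) = c *\<^sub>C x + c *\<^sub>C y"
    and scaleC_add_left: "(c + d) *\<^sub>C x = c *\<^sub>C x + d *\<^sub>C x"
    and scaleC_scaleC: "c *\<^sub>C d *\<^sub>C x = (c * d) *\<^sub>C x"
    and mult_scaleC_left: "(c *\<^sub>C x) * y = c *\<^sub>C (x * y)"
    and mult_scaleC_right: "x * (c *\<^sub>C y) = c *\<^sub>C (x * y)"
    and norm_scaleC: "norm (c *\<^sub>C x) = cmod c * norm x"
    and star_star: "star (star x) = x"
    and star_add: "star (x + y) = star x + star y"
    and star_scaleC: "star (c *\<^sub>C x) = cnj c *\<^sub>C star x"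
    and star_mult: "star (x * y) = star y * star x"
    and cstar_identity: "norm (star x * x) = (norm x)\<^sup>2"

text \<open>
  The family of all \<open>M\<^sub>n\<close> (with \<open>n\<close> quantified inside formulas) cannot be a family of types.
  The operations are therefore collected in a record with an explicit carrier, so that the notions
  below apply both to \<open>M\<^sub>n\<close> and to a type of class \<open>cstar_algebra\<close>.
\<close>

record 'a normed_star_algebra =
  Carrier :: "'a set"
  Zero :: 'a
  Plus :: "'a \<Rightarrow> 'a \<Rightarrow> 'a"
  Times :: "'a \<Rightarrow> 'a \<Rightarrow> 'a"
  Scale :: "complex \<Rightarrow> 'a \<Rightarrow> 'a"
  Star :: "'a \<Rightarrow> 'a"
  Norm :: "'a \<Rightarrow> real"

definition type_algebra :: "'a::cstar_algebra normed_star_algebra" where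
  "type_algebra = \<lparr>Carrier = UNIV, Zero = 0, Plus = (+), Times = (*), Scale = scaleC,
     Star = star, Norm = norm\<rparr>"

definition l2_norm :: "complex vec \<Rightarrow> real" where
  "l2_norm v = L2_set (\<lambda>i. cmod (vec_index v i)) {..<dim_vec v}"

definition operator_norm :: "nat \<Rightarrow> complex mat \<Rightarrow> real" where
  "operator_norm n A = (SUP v \<in> {v \<in> carrier_vec n. l2_norm v \<le> 1}. l2_norm (A *\<^sub>v v))"

definition matrix_algebra :: "nat \<Rightarrow> complex mat normed_star_algebra" where
  "matrix_algebra n = \<lparr>Carrier = carrier_mat n n, Zero = 0\<^sub>m n n, Plus = (+), Times = (*),
     Scale = (\<cdot>\<^sub>m), Star = mat_adjoint, Norm = operator_norm n\<rparr>"

definition Dist :: "'a normed_star_algebra \<Rightarrow> 'a \<Rightarrow> 'a \<Rightarrow> real" where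
  "Dist D x y = Norm D (Plus D x (Scale D (- 1) y))"


section \<open>Subalgebras and generated C*-algebras\<close>

definition subalgebra_of :: "'a normed_star_algebra \<Rightarrow> 'a set \<Rightarrow> bool" where
  "subalgebra_of D X \<longleftrightarrow> X \<subseteq> Carrier D \<and> Zero D \<in> X \<and>
     (\<forall>x\<in>X. \<forall>y\<in>X. Plus D x y \<in> X) \<and>
     (\<forall>x\<in>X. \<forall>y\<in>X. Times D x y \<in> X) \<and>
     (\<forall>c. \<forall>x\<in>X. Scale D c x \<in> X)"

definition norm_closed :: "'a normed_star_algebra \<Rightarrow> 'a set \<Rightarrow> bool" where
  "norm_closed D X \<longleftrightarrow>
     (\<forall>x\<in>Carrier D. (\<forall>\<epsilon>>0. \<exists>y\<in>X. Dist D x y < \<epsilon>) \<longrightarrow> x \<in> X)"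

definition cstar_subalgebra :: "'a normed_star_algebra \<Rightarrow> 'a set \<Rightarrow> bool" where
  "cstar_subalgebra D X \<longleftrightarrow>
     subalgebra_of D X \<and> (\<forall>x\<in>X. Star D x \<in> X) \<and> norm_closed D X"

definition generated_cstar :: "'a normed_star_algebra \<Rightarrow> 'a set \<Rightarrow> 'a set" where
  "generated_cstar D B = \<Inter> {C. cstar_subalgebra D C \<and> B \<subseteq> C}"


section \<open>Star extendible maps\<close>

text \<open>Maps between subalgebras are total functions of which only the values on the domain matter.\<close>

definition algebra_hom ::
  "'a normed_star_algebra \<Rightarrow> 'a set \<Rightarrow> 'b normed_star_algebra \<Rightarrow> 'b set \<Rightarrow> ('a \<Rightarrow> 'b) \<Rightarrow> bool" where
  "algebra_hom D X E Y f \<longleftrightarrow> f ` X \<subseteq> Y \<and>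
     (\<forall>x\<in>X. \<forall>y\<in>X. f (Plus D x y) = Plus E (f x) (f y)) \<and>
     (\<forall>x\<in>X. \<forall>y\<in>X. f (Times D x y) = Times E (f x) (f y)) \<and>
     (\<forall>c. \<forall>x\<in>X. f (Scale D c x) = Scale E c (f x))"

definition star_hom ::
  "'a normed_star_algebra \<Rightarrow> 'a set \<Rightarrow> 'b normed_star_algebra \<Rightarrow> 'b set \<Rightarrow> ('a \<Rightarrow> 'b) \<Rightarrow> bool" where
  "star_hom D X E Y f \<longleftrightarrow>
     algebra_hom D X E Y f \<and> (\<forall>x\<in>X. f (Star D x) = Star E (f x))"

definition star_extendible_embedding ::
  "'a normed_star_algebra \<Rightarrow> 'a set \<Rightarrow> 'b normed_star_algebra \<Rightarrow> 'b set \<Rightarrow> ('a \<Rightarrow> 'b) \<Rightarrow> bool" where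
  "star_extendible_embedding D B E A \<phi> \<longleftrightarrow>
     algebra_hom D B E A \<phi> \<and>
     (\<exists>\<Phi>. star_hom D (generated_cstar D B) E (generated_cstar E A) \<Phi> \<and>
          inj_on \<Phi> (generated_cstar D B) \<and> (\<forall>b\<in>B. \<phi> b = \<Phi> b))"

definition star_extendibly_isomorphic ::
  "'a normed_star_algebra \<Rightarrow> 'a set \<Rightarrow> 'b normed_star_algebra \<Rightarrow> 'b set \<Rightarrow> bool" where
  "star_extendibly_isomorphic D B E A \<longleftrightarrow>
     (\<exists>\<Phi>. star_hom D (generated_cstar D B) E (generated_cstar E A) \<Phi> \<and>
          bij_betw \<Phi> (generated_cstar D B) (generated_cstar E A) \<and> \<Phi> ` B = A)"


section \<open>Stable families\<close>

definition approx_contained ::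
  "'a normed_star_algebra \<Rightarrow> real \<Rightarrow> 'a set \<Rightarrow> 'a set \<Rightarrow> bool" where
  "approx_contained D \<delta> X Y \<longleftrightarrow>
     (\<forall>x\<in>X. Norm D x \<le> 1 \<longrightarrow> (\<exists>y\<in>Y. Norm D y \<le> 1 \<and> Dist D x y \<le> \<delta>))"

definition map_dist ::
  "'a normed_star_algebra \<Rightarrow> 'a set \<Rightarrow> 'b normed_star_algebra \<Rightarrow> ('a \<Rightarrow> 'b) \<Rightarrow> ('a \<Rightarrow> 'b) \<Rightarrow> real" where
  "map_dist D B E f g = (SUP b \<in> {b \<in> B. Norm D b \<le> 1}. Dist E (f b) (g b))"

text \<open>A pair \<open>(n, B)\<close> stands for the algebra \<open>B\<close> of \<open>n\<close>-by-\<open>n\<close> matrices.\<close>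

definition matrix_algebra_family :: "(nat \<times> complex mat set) set \<Rightarrow> bool" where
  "matrix_algebra_family F \<longleftrightarrow> (\<forall>(n, B)\<in>F. 0 < n \<and> subalgebra_of (matrix_algebra n) B)"

definition stable_family :: "(nat \<times> complex mat set) set \<Rightarrow> bool" where
  "stable_family F \<longleftrightarrow> matrix_algebra_family F \<and>
     (\<forall>\<epsilon>>0. \<forall>(n\<^sub>1, A\<^sub>1)\<in>F. \<exists>\<delta>>0. \<forall>(n\<^sub>2, A\<^sub>2)\<in>F. \<forall>n>0. \<forall>\<phi>\<^sub>1 \<phi>\<^sub>2.
        star_extendible_embedding (matrix_algebra n\<^sub>1) A\<^sub>1 (matrix_algebra n) (carrier_mat n n) \<phi>\<^sub>1 \<and>
        star_extendible_embedding (matrix_algebra n\<^sub>2) A\<^sub>2 (matrix_algebra n) (carrier_mat n n) \<phi>\<^sub>2 \<and>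
        approx_contained (matrix_algebra n) \<delta> (\<phi>\<^sub>1 ` A\<^sub>1) (\<phi>\<^sub>2 ` A\<^sub>2) \<longrightarrow>
        (\<exists>\<psi>. star_extendible_embedding (matrix_algebra n\<^sub>1) A\<^sub>1
                (matrix_algebra n) (carrier_mat n n) \<psi> \<and>
             map_dist (matrix_algebra n\<^sub>1) A\<^sub>1 (matrix_algebra n) \<phi>\<^sub>1 \<psi> < \<epsilon> \<and>
             \<psi> ` A\<^sub>1 \<subseteq> \<phi>\<^sub>2 ` A\<^sub>2))"

end

theory Submission
  imports Defs
begin

text \<open>
  A chain as in the first condition gives the second one at once: a finite set is close to some member
  of the chain, and the inverse of the isomorphism of that member with an algebra \<open>B\<close> of the family is
  a star extendible embedding of \<open>B\<close>.

  For the converse, let \<open>X \<subseteq> A\<close> be the image of an algebra of the family. Every finite subset of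
  \<open>A\<close> is nearly contained in another such image \<open>Y\<close>; in particular \<open>Y\<close> may be taken to contain nearly a
  finite net of the unit ball of \<open>X\<close>. Stability compares two algebras inside one \<open>M\<^sub>n\<close>, whereas \<open>X\<close> and
  \<open>Y\<close> need not generate anything finite-dimensional together. But near containment passes to the
  generated C*-algebras \<open>C*(X)\<close> and \<open>C*(Y)\<close>, each of which is finite-dimensional, and a system of
  matrix units of \<open>C*(X)\<close> which is nearly contained in \<open>C*(Y)\<close> is close to an exact system in \<open>C*(Y)\<close>
  (\<open>perturb_isometry_system\<close>). This gives a *-homomorphism \<open>C*(X) \<rightarrow> C*(Y)\<close> close to the
  inclusion (\<open>nearby_star_homs\<close>). As \<open>C*(Y)\<close> sits in a matrix algebra, stability now applies and
  corrects this homomorphism to one that also maps \<open>X\<close> into \<open>Y\<close> (\<open>stable_absorption\<close>,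
  \<open>next_algebra\<close>).

  Iterating, one obtains \<open>X 0 \<rightarrow> X 1 \<rightarrow> \<dots>\<close>, where the \<open>k\<close>-th map moves points of the unit ball by at most
  \<open>2\<^sup>-\<^sup>k\<close>. The images of \<open>X k\<close> under the compositions converge to a copy of \<open>X k\<close> in \<open>A\<close>, and these copies
  increase exactly (\<open>intertwined_chain\<close>); they are dense because the \<open>X k\<close> come close to more and more
  members of a dense sequence (\<open>approximable_chain\<close>).

  Two facts about a finite-dimensional C*-algebra \<open>E\<close> are needed throughout: \<open>E\<close> has matrix units
  (\<open>finite_dim_structure\<close>), and *-homomorphisms on \<open>E\<close> are contractive, the injective ones
  isometric (\<open>star_hom_contractive\<close>, \<open>star_hom_isometric\<close>). The coordinates given by the matrix units
  also replace the equivalence of norms and the compactness of bounded sets.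
\<close>

hide_const (open) VectorSpace.subspace
hide_fact (open) VectorSpace.subspace_def

section \<open>Elementary facts about C*-algebras\<close>

lemma scaleC_zero_left [simp]: "0 *\<^sub>C (x::'a::cstar_algebra) = 0"
  using scaleC_of_real[of 0 x] by simp

lemma scaleC_one [simp]: "1 *\<^sub>C (x::'a::cstar_algebra) = x"
  using scaleC_of_real[of 1 x] by simp

lemma scaleC_minus_one [simp]: "(-1) *\<^sub>C (x::'a::cstar_algebra) = - x"
  using scaleC_of_real[of "-1" x] by simp

lemma scaleC_zero_right [simp]: "c *\<^sub>C (0::'a::cstar_algebra) = 0"
  using norm_scaleC[of c "0::'a"] by simp

lemma scaleC_minus_right: "c *\<^sub>C (- x) = - (c *\<^sub>C (x::'a::cstar_algebra))"
  using scaleC_scaleC[of c "-1" x] scaleC_scaleC[of "-1" c x] by simp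

lemma scaleC_diff_right: "c *\<^sub>C (x - y) = c *\<^sub>C x - c *\<^sub>C (y::'a::cstar_algebra)"
  using scaleC_add_right[of c x "-y"] scaleC_minus_right[of c y] by simp

lemma scaleC_diff_left: "(c - d) *\<^sub>C x = c *\<^sub>C x - d *\<^sub>C (x::'a::cstar_algebra)"
  using scaleC_add_left[of "c - d" d x] by (simp add: algebra_simps)

lemma scaleC_cancel: "c *\<^sub>C x = d *\<^sub>C x \<Longrightarrow> x \<noteq> 0 \<Longrightarrow> c = d" for x :: "'a::cstar_algebra"
  using norm_scaleC[of "c - d" x] by (simp add: scaleC_diff_left)

lemma scaleC_eq_0_iff: "c *\<^sub>C x = 0 \<longleftrightarrow> c = 0 \<or> x = 0" for x :: "'a::cstar_algebra"
  using scaleC_cancel[of c x 0] by auto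

lemma scaleC_sum_right: "c *\<^sub>C (\<Sum>i\<in>I. f i) = (\<Sum>i\<in>I. c *\<^sub>C (f i :: 'a::cstar_algebra))"
  by (induction I rule: infinite_finite_induct) (auto simp: scaleC_add_right)

lemma scaleC_sum_left: "(\<Sum>i\<in>I. f i) *\<^sub>C x = (\<Sum>i\<in>I. f i *\<^sub>C (x :: 'a::cstar_algebra))"
  by (induction I rule: infinite_finite_induct) (auto simp: scaleC_add_left)

lemma star_zero [simp]: "star (0::'a::cstar_algebra) = 0"
  using star_scaleC[of 0 "0::'a"] by simp

lemma star_minus: "star (- x) = - star (x::'a::cstar_algebra)"
  using star_scaleC[of "-1" x] by simp

lemma star_diff: "star (x - y) = star x - star (y::'a::cstar_algebra)"
  using star_add[of x "-y"] by (simp add: star_minus)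

lemma star_scaleR: "star (r *\<^sub>R x) = r *\<^sub>R star (x::'a::cstar_algebra)"
  using star_scaleC[of "complex_of_real r" x] by (simp add: scaleC_of_real)

lemma star_sum: "star (\<Sum>i\<in>I. f i) = (\<Sum>i\<in>I. star (f i :: 'a::cstar_algebra))"
  by (induction I rule: infinite_finite_induct) (auto simp: star_add)

lemma norm_star [simp]: "norm (star x) = norm (x::'a::cstar_algebra)"
proof -
  have le: "norm y \<le> norm (star y)" for y :: 'a
  proof (cases "y = 0")
    case False
    have "norm y * norm y \<le> norm (star y) * norm y"
      using cstar_identity[of y] norm_mult_ineq[of "star y" y] by (simp add: power2_eq_square)
    then show ?thesis using False by simp
  qed simp
  show ?thesis using le[of x] le[of "star x"] by (simp add: star_star)
qed

lemma star_mult_self_eq_0: "star x * x = 0 \<Longrightarrow> x = 0" for x :: "'a::cstar_algebra"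
  using cstar_identity[of x] by simp

lemma mult_star_self_eq_0: "x * star x = 0 \<Longrightarrow> x = 0" for x :: "'a::cstar_algebra"
  using star_mult_self_eq_0[of "star x"] by (metis star_star star_zero)

lemma bounded_linear_star: "bounded_linear (star :: 'a::cstar_algebra \<Rightarrow> 'a)"
  by (rule bounded_linear_intro[where K=1]) (auto simp: star_add star_scaleR)

lemmas tendsto_star [tendsto_intros] = bounded_linear.tendsto[OF bounded_linear_star]
lemmas continuous_on_star [continuous_intros] = bounded_linear.continuous_on[OF bounded_linear_star]

lemma bounded_bilinear_scaleC: "bounded_bilinear (scaleC :: complex \<Rightarrow> 'a::cstar_algebra \<Rightarrow> 'a)"
proof
  fix r :: real and c d :: complex and x y :: 'a
  show "(c + d) *\<^sub>C x = c *\<^sub>C x + d *\<^sub>C x" by (rule scaleC_add_left)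
  show "c *\<^sub>C (x + y) = c *\<^sub>C x + c *\<^sub>C y" by (rule scaleC_add_right)
  show "(r *\<^sub>R c) *\<^sub>C x = r *\<^sub>R (c *\<^sub>C x)"
    by (simp add: scaleR_conv_of_real flip: scaleC_of_real scaleC_scaleC)
  show "c *\<^sub>C (r *\<^sub>R x) = r *\<^sub>R (c *\<^sub>C x)"
    by (simp add: scaleC_scaleC mult.commute flip: scaleC_of_real)
  show "\<exists>K. \<forall>(c::complex) (x::'a). norm (c *\<^sub>C x) \<le> norm c * norm x * K"
    by (rule exI[of _ 1]) (simp add: norm_scaleC)
qed

lemmas tendsto_scaleC [tendsto_intros] = bounded_bilinear.tendsto[OF bounded_bilinear_scaleC]
lemmas continuous_on_scaleC [continuous_intros] =
  bounded_bilinear.continuous_on[OF bounded_bilinear_scaleC]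

definition is_projection :: "'a::cstar_algebra \<Rightarrow> bool" where
  "is_projection p \<longleftrightarrow> star p = p \<and> p * p = p"

lemma norm_projection:
  assumes "is_projection p" "p \<noteq> 0" shows "norm p = 1"
  using cstar_identity[of p] assms by (auto simp: is_projection_def power2_eq_square)

definition star_subalg :: "'a::cstar_algebra set \<Rightarrow> bool" where
  "star_subalg E \<longleftrightarrow> 0 \<in> E \<and> (\<forall>x\<in>E. \<forall>y\<in>E. x + y \<in> E) \<and> (\<forall>x\<in>E. \<forall>y\<in>E. x * y \<in> E) \<and>
     (\<forall>c. \<forall>x\<in>E. c *\<^sub>C x \<in> E) \<and> (\<forall>x\<in>E. star x \<in> E)"

lemma
  assumes "star_subalg E"
  shows star_subalg_zero: "0 \<in> E"
    and star_subalg_add: "x \<in> E \<Longrightarrow> y \<in> E \<Longrightarrow> x + y \<in> E"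
    and star_subalg_mult: "x \<in> E \<Longrightarrow> y \<in> E \<Longrightarrow> x * y \<in> E"
    and star_subalg_scaleC: "x \<in> E \<Longrightarrow> c *\<^sub>C x \<in> E"
    and star_subalg_star: "x \<in> E \<Longrightarrow> star x \<in> E"
  using assms by (auto simp: star_subalg_def)

lemma star_subalg_scaleR: "star_subalg E \<Longrightarrow> x \<in> E \<Longrightarrow> r *\<^sub>R x \<in> E"
  using star_subalg_scaleC[of E x "complex_of_real r"] by (simp add: scaleC_of_real)

lemma star_subalg_minus: "star_subalg E \<Longrightarrow> x \<in> E \<Longrightarrow> - x \<in> E"
  using star_subalg_scaleC[of E x "-1"] by simp

lemma star_subalg_diff: "star_subalg E \<Longrightarrow> x \<in> E \<Longrightarrow> y \<in> E \<Longrightarrow> x - y \<in> E"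
  using star_subalg_add[of E x "-y"] star_subalg_minus[of E y] by simp

lemma star_subalg_sum: "star_subalg E \<Longrightarrow> (\<And>i. i \<in> I \<Longrightarrow> f i \<in> E) \<Longrightarrow> (\<Sum>i\<in>I. f i) \<in> E"
  by (induction I rule: infinite_finite_induct) (auto simp: star_subalg_zero star_subalg_add)

lemmas star_subalg_closed = star_subalg_zero star_subalg_add star_subalg_mult star_subalg_scaleC
  star_subalg_star star_subalg_scaleR star_subalg_minus star_subalg_diff star_subalg_sum

lemma star_subalg_subspace: "star_subalg E \<Longrightarrow> subspace E"
  by (auto simp: subspace_def star_subalg_closed)

section \<open>The structure of finite-dimensional *-algebras\<close>

definition finite_dim :: "'a::real_vector set \<Rightarrow> bool" where
  "finite_dim V \<longleftrightarrow> (\<exists>B. finite B \<and> V \<subseteq> span B)"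

lemma finite_dim_subset: "finite_dim W \<Longrightarrow> V \<subseteq> W \<Longrightarrow> finite_dim V"
  by (auto simp: finite_dim_def)

lemma independent_bound_finite_dim:
  assumes "finite_dim V" obtains K where "\<And>I. I \<subseteq> V \<Longrightarrow> independent I \<Longrightarrow> finite I \<and> card I \<le> K"
  using assms unfolding finite_dim_def by (meson independent_span_bound order_trans)

lemma subspace_eq_if_dim_le:
  assumes "finite_dim W" "subspace V" "V \<subseteq> W" "dim W \<le> dim V"
  shows "V = W"
proof (rule ccontr)
  assume "V \<noteq> W"
  obtain B where B: "B \<subseteq> V" "independent B" "V \<subseteq> span B"
    using maximal_independent_subset by blast
  obtain C where C: "C \<subseteq> W" "independent C" "W \<subseteq> span C"
    using maximal_independent_subset by blast
  obtain K where K: "\<And>I. I \<subseteq> W \<Longrightarrow> independent I \<Longrightarrow> finite I \<and> card I \<le> K"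
    using independent_bound_finite_dim[OF assms(1)] by blast
  have fin: "finite B" "finite C" using K B C assms by auto
  have "span B = V" using B assms by (metis span_minimal subset_antisym)
  then obtain t where t: "t \<in> W" "t \<notin> span B" using \<open>V \<noteq> W\<close> assms(3) by blast
  then have "independent (insert t B)" using B by (simp add: independent_insertI)
  moreover have "insert t B \<subseteq> span C" using t B C assms by blast
  ultimately have "card (insert t B) \<le> card C" using independent_span_bound fin by blast
  moreover have "t \<notin> B" using t span_base by blast
  ultimately show False
    using basis_card_eq_dim[OF B(1,3,2)] basis_card_eq_dim[OF C(1,3,2)] assms(4) fin by simp
qed

lemma injective_endo_surj:
  assumes "finite_dim V" "subspace V" "linear L" "L ` V \<subseteq> V" "\<And>x. x \<in> V \<Longrightarrow> L x = 0 \<Longrightarrow> x = 0"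
  shows "L ` V = V"
proof (rule subspace_eq_if_dim_le[OF assms(1)])
  show "subspace (L ` V)" using linear_subspace_image[OF assms(3,2)] .
  show "L ` V \<subseteq> V" by fact
  obtain B where B: "B \<subseteq> V" "independent B" "V \<subseteq> span B"
    using maximal_independent_subset by blast
  have span: "span B = V" using B assms by (metis span_minimal subset_antisym)
  have inj: "inj_on L V"
  proof (rule inj_onI)
    fix x y assume xy: "x \<in> V" "y \<in> V" "L x = L y"
    have "L (x - y) = 0" using linear_diff[OF assms(3)] xy by simp
    then show "x = y" using assms(5)[of "x - y"] subspace_diff[OF assms(2) xy(1,2)] by simp
  qed
  then have ind: "independent (L ` B)"
    using linear_independent_injective_image[OF assms(3) B(2)] inj span by simp
  have "dim (L ` V) = dim (span (L ` B))" using span linear_span_image[OF assms(3), of B] by simp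
  also have "\<dots> = card (L ` B)" using ind by (simp add: dim_eq_card_independent)
  also have "\<dots> = card B" using inj B by (meson card_image inj_on_subset)
  also have "\<dots> = dim V" using basis_card_eq_dim B by blast
  finally show "dim V \<le> dim (L ` V)" by simp
qed

text \<open>
  Left multiplication by a self-adjoint \<open>a\<close> has the same kernel as its square, hence is bijective
  on \<open>aE\<close>; the preimage of \<open>a\<close> is the support projection.
\<close>

lemma support_projection:
  fixes a :: "'a::cstar_algebra"
  assumes E: "star_subalg E" "finite_dim E" and a: "a \<in> E" "star a = a"
  obtains u f where "u \<in> E" "f \<in> E" "u = a * f" "is_projection u" "a * u = a" "u * a = a"
proof -
  let ?V = "(\<lambda>x. a * x) ` E"
  have lin: "linear (\<lambda>x. a * x)"
    by (simp add: linear_iff distrib_left)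
  have sub: "?V \<subseteq> E" using E a by (auto intro: star_subalg_closed)
  have sq: "a * y = 0" if "a * (a * y) = 0" for y
  proof -
    have "star (a * y) * (a * y) = star y * (a * (a * y))"
      by (simp add: star_mult a mult.assoc)
    then show ?thesis using that star_mult_self_eq_0 by simp
  qed
  have "(\<lambda>x. a * x) ` ?V = ?V"
  proof (rule injective_endo_surj)
    show "finite_dim ?V" using E sub finite_dim_subset by blast
    show "subspace ?V" using lin E star_subalg_subspace linear_subspace_image by blast
    show "(\<lambda>x. a * x) ` ?V \<subseteq> ?V" using sub by auto
  qed (use lin sq in auto)
  moreover have "a * a \<in> ?V" using a by blast
  ultimately have "a * a \<in> (\<lambda>x. a * x) ` (\<lambda>x. a * x) ` ?V"
    by simp
  then obtain f where f: "f \<in> E" "a * a = a * (a * (a * f))" by auto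
  define u where "u = a * f"
  have "a * (a * (a - a * u)) = a * (a * a) - a * (a * (a * (a * f)))"
    by (simp add: u_def right_diff_distrib)
  also have "\<dots> = 0" using f(2) by simp
  finally have "a * (a - a * u) = 0" using sq by blast
  then have "star (a - a * u) * (a - a * u) = 0"
  proof -
    have "star (a - a * u) = (a - star u * a)" by (simp add: star_diff star_mult a)
    then have "star (a - a * u) * (a - a * u) = a * (a - a * u) - star u * (a * (a - a * u))"
      by (simp add: left_diff_distrib mult.assoc)
    then show ?thesis using \<open>a * (a - a * u) = 0\<close> by simp
  qed
  then have au: "a * u = a" using star_mult_self_eq_0 by force
  have "star u * u = star f * (a * u)" by (simp add: u_def star_mult a mult.assoc)
  also have "\<dots> = star u" using au by (simp add: u_def star_mult a)
  finally have su: "star u * u = star u" .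
  have "star (star u * u) = star u * u" by (simp add: star_mult star_star)
  then have suu: "star u = u" by (simp add: su star_star)
  have "u * a = star (a * u)" by (simp add: star_mult suu a)
  then have "u * a = a" using au a by simp
  moreover have "is_projection u" using su suu by (simp add: is_projection_def)
  moreover have "u \<in> E" using E a f u_def by (auto intro: star_subalg_closed)
  ultimately show thesis using that[of u f] f au u_def by blast
qed

definition minimal_projection :: "'a::cstar_algebra set \<Rightarrow> 'a \<Rightarrow> bool" where
  "minimal_projection E p \<longleftrightarrow> p \<in> E \<and> is_projection p \<and> p \<noteq> 0 \<and>
     (\<forall>q\<in>E. is_projection q \<and> q \<noteq> 0 \<and> p * q = q \<longrightarrow> q = p)"

text \<open>
  Among the projections below \<open>e\<close>, one with a right ideal \<open>pE\<close> of least dimension is minimal.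
\<close>

lemma minimal_projection_below:
  fixes e :: "'a::cstar_algebra"
  assumes E: "star_subalg E" "finite_dim E" and e: "e \<in> E" "is_projection e" "e \<noteq> 0"
  obtains p where "minimal_projection E p" "e * p = p"
proof -
  let ?P = "\<lambda>p. p \<in> E \<and> is_projection p \<and> p \<noteq> 0 \<and> e * p = p"
  let ?V = "\<lambda>p. {x \<in> E. p * x = x}"
  have sub: "subspace (?V p)" for p
    using E by (auto simp: subspace_def star_subalg_closed distrib_left)
  have "?P e" using e by (simp add: is_projection_def)
  then obtain p where p: "?P p" and min: "\<And>q. ?P q \<Longrightarrow> dim (?V p) \<le> dim (?V q)"
    using ex_has_least_nat[of ?P e "\<lambda>p. dim (?V p)"] by blast
  have "q = p" if q: "q \<in> E" "is_projection q" "q \<noteq> 0" "p * q = q" for q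
  proof -
    have "e * q = q" using p q by (metis mult.assoc)
    then have le: "dim (?V p) \<le> dim (?V q)" using min q by blast
    have ss: "?V q \<subseteq> ?V p"
    proof safe
      fix x assume "q * x = x"
      then show "p * x = x" using mult.assoc[of p q x] q(4) by simp
    qed
    have fd: "finite_dim (?V p)" by (rule finite_dim_subset[OF E(2)]) auto
    have "?V q = ?V p" by (rule subspace_eq_if_dim_le[OF fd sub ss le])
    then have "p \<in> ?V q" using p by (auto simp: is_projection_def)
    then have "q * p = p" by simp
    moreover have "star (p * q) = q * p" using star_mult[of p q] p q(2) by (metis is_projection_def)
    ultimately show "q = p" using q by (simp add: is_projection_def)
  qed
  then show thesis using that[of p] p by (auto simp: minimal_projection_def)
qed


text \<open>
  The powers of \<open>x\<close> are linearly dependent, so some nonzero polynomial annihilates \<open>x\<close>. Split off linear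
  factors until the remaining factor, evaluated at \<open>x\<close>, is nonzero: this value is an eigenvector.
  In the evaluation, \<open>p\<close> plays the part of the unit.
\<close>

lemma corner_eigenvector:
  fixes p x :: "'a::cstar_algebra"
  assumes E: "star_subalg E" "finite_dim E" and p: "p \<in> E" "p * p = p" "p \<noteq> 0"
    and x: "x \<in> E" "p * x = x"
  obtains c y where "y \<in> E" "y \<noteq> 0" "p * y = y" "x * y = c *\<^sub>C y"
proof -
  define ev where "ev f = fold_coeffs (\<lambda>a y. a *\<^sub>C p + x * y) f 0" for f :: "complex poly"
  have ev0: "ev 0 = 0" by (simp add: ev_def)
  have evp: "ev (pCons a f) = a *\<^sub>C p + x * ev f" for a f
    by (cases "a = 0 \<and> f = 0") (auto simp: ev_def)
  have ev_add: "ev (f + g) = ev f + ev g" for f g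
    by (induction f g rule: poly_induct2) (auto simp: ev0 evp scaleC_add_left distrib_left)
  have ev_smult: "ev (Polynomial.smult c f) = c *\<^sub>C ev f" for c f
    by (induction f) (auto simp: ev0 evp scaleC_add_right scaleC_scaleC mult_scaleC_right)
  have ev_sum: "ev (\<Sum>i\<in>I. f i) = (\<Sum>i\<in>I. ev (f i))" for f and I :: "nat set"
    by (induction I rule: infinite_finite_induct) (auto simp: ev0 ev_add)
  have evE: "ev f \<in> E" for f
    using E p x by (induction f) (auto simp: ev0 evp star_subalg_closed)
  have evl: "p * ev f = ev f" for f
    using p x by (induction f) (auto simp: ev0 evp distrib_left mult_scaleC_right simp flip: mult.assoc)
  have *: "\<exists>c y. y \<in> E \<and> y \<noteq> 0 \<and> p * y = y \<and> x * y = c *\<^sub>C y" if "f \<noteq> 0" "ev f = 0" for f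
    using that
  proof (induction "degree f" arbitrary: f rule: less_induct)
    case less
    show ?case
    proof (cases "degree f = 0")
      case True
      then obtain c where "f = [:c:]" by (rule degree_eq_zeroE)
      then show ?thesis using less.prems p by (auto simp: evp ev0 scaleC_eq_0_iff)
    next
      case False
      then have "\<not> constant (poly f)" by (simp add: constant_degree)
      then obtain z where "poly f z = 0" using fundamental_theorem_of_algebra by blast
      then obtain g where g: "f = [:-z, 1:] * g" by (metis dvdE poly_eq_0_iff_dvd)
      have fe: "f = Polynomial.smult (- z) g + pCons 0 g" by (simp add: g)
      have "ev f = (- z) *\<^sub>C ev g + x * ev g"
        by (simp only: fe ev_add ev_smult evp scaleC_zero_left add_0)
      then have eig: "x * ev g = z *\<^sub>C ev g"
        using less.prems scaleC_add_left[of "-z" z "ev g"] by (metis add.commute add_left_cancel add.right_inverse scaleC_zero_left)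
      show ?thesis
      proof (cases "ev g = 0")
        case True
        have "g \<noteq> 0" using g less.prems by auto
        then have "degree f = degree [:-z, 1:] + degree g"
          unfolding g by (intro degree_mult_eq) auto
        then have "degree g < degree f" by simp
        then show ?thesis using less.hyps \<open>g \<noteq> 0\<close> True by blast
      next
        case False
        then show ?thesis using eig evE evl by blast
      qed
    qed
  qed
  obtain K where K: "\<And>I. I \<subseteq> E \<Longrightarrow> independent I \<Longrightarrow> finite I \<and> card I \<le> K"
    using independent_bound_finite_dim[OF E(2)] by blast
  define h where "h k = ev (monom 1 k)" for k
  have "\<exists>f. f \<noteq> 0 \<and> ev f = 0"
  proof (cases "inj_on h {..K}")
    case True
    have "\<not> independent (h ` {..K})"
    proof
      assume "independent (h ` {..K})"
      moreover have "h ` {..K} \<subseteq> E" using evE by (auto simp: h_def)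
      ultimately have "card (h ` {..K}) \<le> K" using K by blast
      then show False using True by (simp add: card_image)
    qed
    then obtain u k where u: "k \<le> K" "u (h k) \<noteq> 0" "(\<Sum>v\<in>h ` {..K}. u v *\<^sub>R v) = 0"
      using dependent_finite[of "h ` {..K}"] by auto
    define f where "f = (\<Sum>k\<le>K. monom (complex_of_real (u (h k))) k)"
    have "ev (monom c k) = c *\<^sub>C h k" for c k
      unfolding h_def by (metis ev_smult mult.right_neutral smult_monom)
    then have "ev f = (\<Sum>k\<le>K. u (h k) *\<^sub>R h k)"
      by (simp add: f_def ev_sum scaleC_of_real)
    also have "\<dots> = 0" using u(3) True by (simp add: sum.reindex)
    finally have "ev f = 0" .
    moreover have "coeff f k = u (h k)"
      using u(1) by (simp add: f_def coeff_sum)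
    ultimately show ?thesis using u(2) by (metis coeff_0 of_real_eq_0_iff)
  next
    case False
    then obtain i j where ij: "i \<noteq> j" "h i = h j" by (auto simp: inj_on_def)
    define f where "f = monom 1 i + Polynomial.smult (-1) (monom (1::complex) j)"
    have "ev f = h i - h j" unfolding f_def ev_add ev_smult h_def scaleC_minus_one by simp
    then have "ev f = 0" using ij by simp
    moreover have "coeff f i \<noteq> 0" using ij by (simp add: f_def)
    ultimately show ?thesis by (metis coeff_0)
  qed
  then show thesis using * that by blast
qed

text \<open>
  If \<open>y\<close> is an eigenvector of \<open>x\<close> in the corner of \<open>p\<close>, then \<open>x\<close> acts as a scalar on the support
  projection of \<open>y * star y\<close>, and by minimality this support is \<open>p\<close>.
\<close>

lemma minimal_projection_corner:
  fixes p x :: "'a::cstar_algebra"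
  assumes E: "star_subalg E" "finite_dim E" and p: "minimal_projection E p"
    and x: "x \<in> E" "p * x = x" "x * p = x"
  obtains c where "x = c *\<^sub>C p"
proof -
  obtain c y where y: "y \<in> E" "y \<noteq> 0" "p * y = y" "x * y = c *\<^sub>C y"
    using corner_eigenvector[OF E _ _ _ x(1,2)] p
    unfolding minimal_projection_def is_projection_def by metis
  define a where "a = y * star y"
  have a: "a \<in> E" "star a = a" "a \<noteq> 0"
    using y E mult_star_self_eq_0[of y]
    by (auto simp: a_def star_mult star_star intro: star_subalg_closed)
  obtain u f where u: "u \<in> E" "u = a * f" "is_projection u" "a * u = a"
    using support_projection[OF E a(1,2)] by metis
  have "p * u = (p * y) * star y * f" by (simp add: u(2) a_def mult.assoc)
  then have "p * u = u" by (simp add: y(3) u(2) a_def)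
  moreover have "u \<noteq> 0" using a u by auto
  ultimately have "u = p" using p u by (auto simp: minimal_projection_def)
  have "x * u = (x * y) * star y * f" by (simp add: u(2) a_def mult.assoc)
  also have "\<dots> = c *\<^sub>C u" by (simp add: y(4) u(2) a_def mult_scaleC_left)
  finally have "x = c *\<^sub>C p" using x \<open>u = p\<close> by simp
  then show thesis by (rule that)
qed

text \<open>
  Matrix units are encoded by one column for each block: \<open>w (r i)\<close> is a minimal projection that
  represents the block of \<open>i\<close>, and \<open>w i\<close> is a partial isometry from it onto the \<open>i\<close>-th of a family of
  orthogonal minimal projections. The usual matrix units are the products \<open>w i * star (w j)\<close> with
  \<open>r i = r j\<close>. The condition \<open>r i \<le> i\<close> makes it possible to construct, and later to perturb, the \<open>w i\<close>
  one after the other. The last condition says that different blocks are not connected in \<open>E\<close>.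
\<close>

definition partial_units :: "'a::cstar_algebra set \<Rightarrow> nat \<Rightarrow> (nat \<Rightarrow> 'a) \<Rightarrow> (nat \<Rightarrow> nat) \<Rightarrow> bool" where
  "partial_units E m w r \<longleftrightarrow> (\<forall>i<m. w i \<in> E \<and> r i \<le> i \<and> r (r i) = r i) \<and>
     (\<forall>i<m. \<forall>j<m. star (w i) * w j = (if i = j then w (r i) else 0)) \<and>
     (\<forall>i<m. r i = i \<longrightarrow> minimal_projection E (w i)) \<and>
     (\<forall>i<m. \<forall>j<m. r i = i \<and> r j = j \<and> i \<noteq> j \<longrightarrow> (\<forall>x\<in>E. w i * x * w j = 0))"

text \<open>
  The purely algebraic relations; they imply that \<open>(i, j) \<mapsto> w i * star (w j)\<close> multiplies like matrix
  units wherever \<open>r i = r j\<close>.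
\<close>

locale isometry_system =
  fixes m :: nat and w :: "nat \<Rightarrow> 'a::cstar_algebra" and r :: "nat \<Rightarrow> nat"
  assumes r_le: "i < m \<Longrightarrow> r i \<le> i" and r_r: "i < m \<Longrightarrow> r (r i) = r i"
    and star_w_w: "i < m \<Longrightarrow> j < m \<Longrightarrow> star (w i) * w j = (if i = j then w (r i) else 0)"
begin

lemma r_less: "i < m \<Longrightarrow> r i < m"
  using r_le by (meson le_less_trans)

lemma rep_projection: "i < m \<Longrightarrow> is_projection (w (r i))"
proof -
  assume i: "i < m"
  have eq: "star (w (r i)) * w (r i) = w (r i)"
    using star_w_w[of "r i" "r i"] r_less[OF i] r_r[OF i] by simp
  then have "star (w (r i)) = w (r i)" by (metis star_mult star_star)
  then show ?thesis using eq by (simp add: is_projection_def)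
qed

lemma w_rep: "i < m \<Longrightarrow> w i * w (r i) = w i"
proof -
  assume i: "i < m"
  let ?p = "w (r i)"
  have p: "star ?p = ?p" "?p * ?p = ?p" using rep_projection[OF i] by (auto simp: is_projection_def)
  have e: "star (w i) * w i = ?p" using star_w_w[OF i i] by simp
  have e1: "star (w i) * (w i * ?p) = ?p" using e p by (simp flip: mult.assoc)
  have "star (w i * ?p - w i) * (w i * ?p - w i) = 0"
    using p by (simp add: star_diff star_mult right_diff_distrib left_diff_distrib mult.assoc e e1)
  then show ?thesis using star_mult_self_eq_0[of "w i * ?p - w i"] by simp
qed

lemma norm_w_le: "i < m \<Longrightarrow> norm (w i) \<le> 1"
proof -
  assume i: "i < m"
  have "(norm (w i))\<^sup>2 = norm (w (r i))" using cstar_identity[of "w i"] star_w_w[OF i i] by simp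
  also have "\<dots> \<le> 1" using norm_projection[OF rep_projection[OF i]] by (cases "w (r i) = 0") auto
  finally show ?thesis by (simp add: power_le_one_iff)
qed

definition P :: 'a where "P = (\<Sum>i<m. w i * star (w i))"

lemma P_w: "j < m \<Longrightarrow> P * w j = w j"
proof -
  assume j: "j < m"
  have "P * w j = (\<Sum>i<m. if i = j then w j else 0)"
    unfolding P_def sum_distrib_right
    by (rule sum.cong) (use j w_rep star_w_w in \<open>auto simp: mult.assoc\<close>)
  then show ?thesis using j by simp
qed

lemma P_projection: "is_projection P"
proof -
  have "star P = P" by (simp add: P_def star_sum star_mult star_star)
  moreover have "P * P = (\<Sum>i<m. (P * w i) * star (w i))"
    by (subst (2) P_def) (simp add: sum_distrib_left mult.assoc)
  then have "P * P = P" using P_w by (simp add: P_def)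
  ultimately show ?thesis by (simp add: is_projection_def)
qed

lemma star_w_P: "j < m \<Longrightarrow> star (w j) * P = star (w j)"
  using P_w[of j] P_projection by (metis is_projection_def star_mult)

end

lemma partial_units_system: "partial_units E m w r \<Longrightarrow> isometry_system m w r"
  by (auto simp: partial_units_def isometry_system_def)

text \<open>
  Let \<open>P = (\<Sum>i<m. w i * star (w i))\<close>. Below the left support projection of \<open>x - P * x\<close> there is a
  minimal projection \<open>q\<close> orthogonal to \<open>P\<close>. Either some \<open>q * y * w k\<close> is nonzero, and then it is a multiple
  of a partial isometry which joins \<open>q\<close> to the block of \<open>k\<close>, or \<open>q\<close> starts a new block.
\<close>

lemma partial_units_extend:
  fixes x :: "'a::cstar_algebra"
  assumes E: "star_subalg E" "finite_dim E" and pu: "partial_units E m w r"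
    and x: "x \<in> E" "(\<Sum>i<m. w i * star (w i)) * x \<noteq> x"
  obtains w' r' where "partial_units E (Suc m) w' r'"
proof -
  interpret isometry_system m w r using pu by (rule partial_units_system)
  have wE: "w i \<in> E" if "i < m" for i using pu that by (auto simp: partial_units_def)
  have PE: "P \<in> E" using E wE by (auto simp: P_def intro!: star_subalg_closed)
  have PP: "star P = P" "P * P = P" using P_projection by (auto simp: is_projection_def)
  define x' where "x' = x - P * x"
  define a where "a = x' * star x'"
  have x': "x' \<in> E" "x' \<noteq> 0" "P * x' = 0"
    using E PE x PP by (auto simp: x'_def P_def[symmetric] right_diff_distrib simp flip: mult.assoc intro: star_subalg_closed)
  have a: "a \<in> E" "star a = a" "a \<noteq> 0"
    using x' E mult_star_self_eq_0[of x'] by (auto simp: a_def star_mult star_star intro: star_subalg_closed)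
  obtain u f where u: "u \<in> E" "u = a * f" "is_projection u" "a * u = a"
    using support_projection[OF E a(1,2)] by metis
  have "u \<noteq> 0" using a u by auto
  then obtain q where q: "minimal_projection E q" "u * q = q"
    using minimal_projection_below[OF E u(1,3)] by metis
  have qp: "q \<in> E" "star q = q" "q * q = q" "q \<noteq> 0"
    using q by (auto simp: minimal_projection_def is_projection_def)
  have "P * u = (P * x') * star x' * f" by (simp add: u(2) a_def mult.assoc)
  then have "P * u = 0" by (simp add: x')
  then have Pq: "P * q = 0" using q(2) by (metis mult.assoc mult_zero_left)
  have wq: "star (w j) * q = 0" if "j < m" for j
  proof -
    have "star (w j) * q = star (w j) * (P * q)" using star_w_P[OF that] by (simp flip: mult.assoc)
    then show ?thesis using Pq by simp
  qed
  have qw: "q * w j = 0" if "j < m" for j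
    using wq[OF that] by (metis qp(2) star_mult star_star star_zero)
  show thesis
  proof (cases "\<exists>k<m. r k = k \<and> (\<exists>y\<in>E. q * y * w k \<noteq> 0)")
    case True
    then obtain k y where k: "k < m" "r k = k" and y: "y \<in> E" "q * y * w k \<noteq> 0" by blast
    define v where "v = q * y * w k"
    have wk: "star (w k) = w k" "w k * w k = w k" "w k \<noteq> 0" "minimal_projection E (w k)"
      using k pu rep_projection[OF k(1)] by (auto simp: is_projection_def partial_units_def minimal_projection_def)
    have v: "v \<in> E" "v \<noteq> 0" "q * v = v" "v * w k = v" "w k * star v = star v" "star v * q = star v"
      using y qp wE[OF k(1)] E wk
      by (auto simp: v_def star_mult mult.assoc intro: star_subalg_closed)
        (auto simp flip: mult.assoc)
    have "w k * q = 0" using wq[OF k(1)] wk by simp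
    then have "v * w k * (q * v) = 0" using mult.assoc[of "v * w k" q v] mult.assoc[of v "w k" q] by simp
    then have vv0: "v * v = 0" by (simp only: v(3,4))
    obtain c where c: "star v * v = c *\<^sub>C w k"
    proof (rule minimal_projection_corner[OF E wk(4)])
      show "w k * (star v * v) = star v * v" using v by (simp flip: mult.assoc)
    qed (use v E in \<open>auto simp: mult.assoc star_subalg_closed\<close>)
    obtain c' where c': "v * star v = c' *\<^sub>C q"
    proof (rule minimal_projection_corner[OF E q(1)])
      show "q * (v * star v) = v * star v" using v by (simp flip: mult.assoc)
    qed (use v E in \<open>auto simp: mult.assoc star_subalg_closed\<close>)
    have "c' *\<^sub>C v = v * star v * v" by (simp add: c' mult_scaleC_left v)
    also have "\<dots> = c *\<^sub>C v" by (simp add: mult.assoc c mult_scaleC_right v)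
    finally have "c' = c" using scaleC_cancel v by blast
    have "cnj c *\<^sub>C w k = star (star v * v)" by (simp add: c star_scaleC wk)
    also have "\<dots> = star v * v" by (simp add: star_mult star_star)
    also have "\<dots> = c *\<^sub>C w k" by (rule c)
    finally have "cnj c = c" using scaleC_cancel wk by blast
    then obtain t where t: "c = complex_of_real t" by (metis Reals_cases Reals_cnj_iff)
    have "c \<noteq> 0" using c star_mult_self_eq_0[of v] v by auto
    have "t > 0"
    \<comment> \<open>If \<open>t < 0\<close>, the self-adjoint \<open>s = v + star v\<close> would have the negative square
      \<open>t (q + w k)\<close>, so that \<open>star (s + \<i> \<surd>(-t) (q + w k)) * (\<dots>)\<close> would vanish.\<close>
    proof (rule ccontr)
      assume "\<not> t > 0"
      then have neg: "t < 0" using \<open>c \<noteq> 0\<close> t by (cases "t = 0") auto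
      define d where "d = sqrt (- t)"
      have d: "d * d = - t" "d > 0" using neg by (auto simp: d_def)
      define e where "e = q + w k"
      define s where "s = v + star v"
      have qwk: "q * w k = 0" "w k * q = 0" using qw[OF k(1)] \<open>w k * q = 0\<close> by auto
      have "star v * star v = 0" using vv0 by (metis star_mult star_zero)
      then have ss: "s * s = t *\<^sub>R e"
        using c c' \<open>c' = c\<close> vv0 t by (simp add: s_def e_def algebra_simps scaleC_of_real)
      have ee: "e * e = e" "star e = e" using qp wk qwk by (auto simp: e_def algebra_simps star_add)
      have ze: "w k * v = 0" "star v * w k = 0" "v * q = 0" "q * star v = 0"
        using mult.assoc[of "w k" q v] mult.assoc[of "star v" q "w k"] mult.assoc[of v "w k" q]
          mult.assoc[of q "w k" "star v"] v qwk by simp_all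
      have se: "s * e = s" "e * s = s" using v ze by (auto simp: s_def e_def algebra_simps)
      define z where "z = s + (\<i> * d) *\<^sub>C e"
      have sz: "star z = s - (\<i> * d) *\<^sub>C e"
        using ee scaleC_minus_one[of "(\<i> * d) *\<^sub>C e"]
        by (simp add: z_def star_add star_scaleC s_def star_star scaleC_scaleC)
      have "(\<i> * d) * (\<i> * d) = complex_of_real t"
        using d(1) by (simp add: algebra_simps flip: of_real_mult)
      then have "star z * z = s * s - t *\<^sub>R e"
        unfolding sz by (simp add: z_def distrib_left left_diff_distrib mult_scaleC_left mult_scaleC_right
            scaleC_scaleC scaleC_diff_right se ee scaleC_of_real)
      then have "z = 0" using ss star_mult_self_eq_0 by simp
      then have "z + star z = 0" by simp
      then have "s + s = 0" unfolding sz by (simp add: z_def)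
      then have "s = 0" by (simp flip: scaleR_2)
      then have "star v = - v" by (simp add: s_def add_eq_0_iff)
      then have "v * star v * v = 0" using vv0 by (simp add: mult.assoc)
      then have "c *\<^sub>C v = 0" by (simp add: mult.assoc c mult_scaleC_right v)
      then show False using \<open>c \<noteq> 0\<close> v by (simp add: scaleC_eq_0_iff)
    qed
    define v' where "v' = (1 / sqrt t) *\<^sub>R v"
    have v'E: "v' \<in> E" using v E by (auto simp: v'_def star_subalg_closed)
    have v'v': "star v' * v' = w k"
      using \<open>t > 0\<close> c t by (simp add: v'_def star_scaleR scaleC_of_real flip: real_sqrt_mult)
    have wv': "star (w j) * v' = 0" if "j < m" for j
    proof -
      have "star (w j) * v = star (w j) * q * v" by (simp add: mult.assoc v)
      then show ?thesis using wq[OF that] by (simp add: v'_def)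
    qed
    then have "star v' * w j = 0" if "j < m" for j
      using that by (metis star_mult star_star star_zero)
    then have "partial_units E (Suc m) (w(m := v')) (r(m := k))"
      using pu k v'E v'v' wv' r_less r_le by (auto simp: partial_units_def less_Suc_eq) 
    then show thesis by (rule that)
  next
    case False
    then have 1: "q * y * w k = 0" if "k < m" "r k = k" "y \<in> E" for k y using that by blast
    have 2: "w k * y * q = 0" if "k < m" "r k = k" "y \<in> E" for k y
    proof -
      have "star (w k * y * q) = q * star y * w k"
        using rep_projection[OF that(1)] that(2) qp by (simp add: star_mult is_projection_def mult.assoc)
      then show ?thesis using 1[OF that(1,2)] that(3) E by (metis star_star star_subalg_star star_zero)
    qed
    have "r i \<noteq> m" if "i < m" for i using r_less[OF that] by simp
    then have "partial_units E (Suc m) (w(m := q)) (r(m := m))"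
      using pu q qp wq qw 1 2 r_less r_le by (auto simp: partial_units_def less_Suc_eq)
    then show thesis by (rule that)
  qed
qed

text \<open>
  The \<open>w i\<close> are linearly independent.
\<close>

lemma partial_units_bound:
  assumes "finite_dim E" obtains K where "\<And>m w r. partial_units E m w r \<Longrightarrow> m \<le> K"
proof -
  obtain K where K: "\<And>I. I \<subseteq> E \<Longrightarrow> independent I \<Longrightarrow> finite I \<and> card I \<le> K"
    using independent_bound_finite_dim[OF assms] by blast
  have "m \<le> K" if pu: "partial_units E m w r" for m w r
  proof -
    interpret isometry_system m w r using pu by (rule partial_units_system)
    have nz: "w (r i) \<noteq> 0" if "i < m" for i
      using pu r_less[OF that] r_r[OF that] by (auto simp: partial_units_def minimal_projection_def)
    have inj: "inj_on w {..<m}"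
    proof (rule inj_onI, rule ccontr)
      fix i j assume ij: "i \<in> {..<m}" "j \<in> {..<m}" "w i = w j" "i \<noteq> j"
      then have "star (w i) * w i = 0" using star_w_w[of i j] by simp
      then show False using star_w_w[of i i] nz[of i] ij by simp
    qed
    have "independent (w ` {..<m})"
    proof (rule independent_if_scalars_zero)
      fix f x assume s: "(\<Sum>x\<in>w ` {..<m}. f x *\<^sub>R x) = 0" and "x \<in> w ` {..<m}"
      then obtain j where j: "j < m" "x = w j" by auto
      have "0 = star (w j) * (\<Sum>i<m. f (w i) *\<^sub>R w i)" using s inj by (simp add: sum.reindex)
      also have "\<dots> = (\<Sum>i<m. if i = j then f (w j) *\<^sub>R w (r j) else 0)"
        unfolding sum_distrib_left by (rule sum.cong) (use star_w_w j in auto)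
      finally show "f x = 0" using j nz by simp
    qed simp
    then show ?thesis using K[of "w ` {..<m}"] pu inj by (auto simp: card_image partial_units_def)
  qed
  then show thesis using that by blast
qed

theorem finite_dim_structure:
  fixes E :: "'a::cstar_algebra set"
  assumes E: "star_subalg E" "finite_dim E"
  obtains m w r where "partial_units E m w r" "\<And>x. x \<in> E \<Longrightarrow> (\<Sum>i<m. w i * star (w i)) * x = x"
proof -
  obtain K where K: "\<And>m w r. partial_units E m w r \<Longrightarrow> m \<le> K"
    using partial_units_bound[OF E(2)] by blast
  let ?Q = "\<lambda>m. \<exists>w r. partial_units E m w r"
  define m where "m = (GREATEST m. ?Q m)"
  have "partial_units E 0 (\<lambda>_. 0) id" by (simp add: partial_units_def)
  then have Q0: "?Q 0" by blast
  have bound: "n \<le> K" if "?Q n" for n using K that by blast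
  have m: "?Q m" "?Q n \<Longrightarrow> n \<le> m" for n
    unfolding m_def using GreatestI_nat[of ?Q, OF Q0 bound] Greatest_le_nat[of ?Q, OF _ bound] by blast+
  from m(1) obtain w r where w: "partial_units E m w r" by blast
  have "(\<Sum>i<m. w i * star (w i)) * x = x" if x: "x \<in> E" for x
  proof (rule ccontr)
    assume "(\<Sum>i<m. w i * star (w i)) * x \<noteq> x"
    then obtain w' r' where "partial_units E (Suc m) w' r'" using partial_units_extend[OF E w x] by metis
    then show False using m(2)[of "Suc m"] by auto
  qed
  then show thesis using that w by blast
qed

section \<open>Coordinates with respect to matrix units\<close>

text \<open>
  A complete system of matrix units. The number \<open>coef i j x\<close> below is the entry of \<open>x\<close> at position
  \<open>(i, j)\<close>.
\<close>

locale matrix_units = isometry_system m w r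
  for m :: nat and w :: "nat \<Rightarrow> 'a::cstar_algebra" and r +
  fixes E :: "'a set"
  assumes subalg: "star_subalg E" and w_in: "i < m \<Longrightarrow> w i \<in> E" and rep_nonzero: "i < m \<Longrightarrow> w (r i) \<noteq> 0"
    and corner: "i < m \<Longrightarrow> j < m \<Longrightarrow> x \<in> E \<Longrightarrow>
      \<exists>c. star (w i) * x * w j = c *\<^sub>C w (r i) \<and> (r i \<noteq> r j \<longrightarrow> c = 0)"
    and P_unit: "x \<in> E \<Longrightarrow> P * x = x"
begin

definition coef :: "nat \<Rightarrow> nat \<Rightarrow> 'a \<Rightarrow> complex" where
  "coef i j x = (SOME c. star (w i) * x * w j = c *\<^sub>C w (r i) \<and> (r i \<noteq> r j \<longrightarrow> c = 0))"

lemma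
  assumes "i < m" "j < m" "x \<in> E"
  shows coef_eq: "star (w i) * x * w j = coef i j x *\<^sub>C w (r i)"
    and coef_zero: "r i \<noteq> r j \<Longrightarrow> coef i j x = 0"
  using someI_ex[OF corner[OF assms]] by (auto simp: coef_def)

lemma coef_unique:
  assumes "i < m" "j < m" "x \<in> E" "star (w i) * x * w j = c *\<^sub>C w (r i)"
  shows "coef i j x = c"
  using assms coef_eq[OF assms(1-3)] rep_nonzero scaleC_cancel by metis

lemma rep: "i < m \<Longrightarrow> star (w (r i)) = w (r i)" "i < m \<Longrightarrow> w (r i) * w (r i) = w (r i)"
  using rep_projection by (auto simp: is_projection_def)

lemma norm_rep: "i < m \<Longrightarrow> norm (w (r i)) = 1"
  using norm_projection rep_projection rep_nonzero by blast

lemma unit_P: "x \<in> E \<Longrightarrow> x * P = x"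
  using P_unit[of "star x"] P_projection subalg star_subalg_star[of E x]
  by (metis is_projection_def star_mult star_star)

lemma expand: "x \<in> E \<Longrightarrow> x = (\<Sum>i<m. \<Sum>j<m. coef i j x *\<^sub>C (w i * star (w j)))"
proof -
  assume x: "x \<in> E"
  have "x = P * (x * P)" using x P_unit unit_P by simp
  also have "\<dots> = (\<Sum>i<m. \<Sum>j<m. w i * (star (w i) * x * w j) * star (w j))"
    by (subst sum.swap) (simp add: P_def sum_distrib_left sum_distrib_right mult.assoc)
  also have "\<dots> = (\<Sum>i<m. \<Sum>j<m. coef i j x *\<^sub>C (w i * star (w j)))"
    using x by (intro sum.cong refl) (simp add: coef_eq mult_scaleC_left mult_scaleC_right w_rep)
  finally show ?thesis .
qed

lemma coef_bound: "i < m \<Longrightarrow> j < m \<Longrightarrow> x \<in> E \<Longrightarrow> cmod (coef i j x) \<le> norm x"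
proof -
  assume ij: "i < m" "j < m" "x \<in> E"
  have "cmod (coef i j x) = norm (star (w i) * x * w j)"
    using ij by (simp add: coef_eq norm_scaleC norm_rep)
  also have "\<dots> \<le> norm (star (w i)) * norm x * norm (w j)"
    by (meson mult_right_mono norm_ge_zero norm_mult_ineq order_trans)
  also have "\<dots> \<le> 1 * norm x * 1"
    using norm_w_le ij by (intro mult_mono) auto
  finally show ?thesis by simp
qed

lemma coef_add: "i < m \<Longrightarrow> j < m \<Longrightarrow> x \<in> E \<Longrightarrow> y \<in> E \<Longrightarrow> coef i j (x + y) = coef i j x + coef i j y"
  using subalg by (intro coef_unique)
    (auto simp: star_subalg_closed distrib_left distrib_right coef_eq scaleC_add_left)

lemma coef_scaleC: "i < m \<Longrightarrow> j < m \<Longrightarrow> x \<in> E \<Longrightarrow> coef i j (c *\<^sub>C x) = c * coef i j x"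
  using subalg by (intro coef_unique)
    (auto simp: star_subalg_closed mult_scaleC_left mult_scaleC_right coef_eq scaleC_scaleC)

lemma coef_star: "i < m \<Longrightarrow> j < m \<Longrightarrow> x \<in> E \<Longrightarrow> coef i j (star x) = cnj (coef j i x)"
proof -
  assume ij: "i < m" "j < m" "x \<in> E"
  have sx: "star x \<in> E" using subalg ij by (auto simp: star_subalg_closed)
  have "star (w i) * star x * w j = star (star (w j) * x * w i)"
    by (simp add: star_mult star_star mult.assoc)
  also have "\<dots> = cnj (coef j i x) *\<^sub>C w (r j)" using ij by (simp add: coef_eq star_scaleC rep)
  finally have *: "star (w i) * star x * w j = cnj (coef j i x) *\<^sub>C w (r j)" .
  show ?thesis
  proof (cases "r i = r j")
    case True
    then show ?thesis using * ij sx coef_unique by simp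
  next
    case False
    then show ?thesis using ij sx by (simp add: coef_zero)
  qed
qed

lemma coef_mult:
  "i < m \<Longrightarrow> j < m \<Longrightarrow> x \<in> E \<Longrightarrow> y \<in> E \<Longrightarrow> coef i j (x * y) = (\<Sum>k<m. coef i k x * coef k j y)"
proof (rule coef_unique)
  assume ij: "i < m" "j < m" "x \<in> E" "y \<in> E"
  show "x * y \<in> E" using subalg ij by (auto simp: star_subalg_closed)
  have "star (w i) * (x * y) * w j = star (w i) * (x * (P * y)) * w j" using P_unit ij by simp
  also have "\<dots> = (\<Sum>k<m. (star (w i) * x * w k) * (star (w k) * y * w j))"
    by (simp add: P_def sum_distrib_left sum_distrib_right mult.assoc)
  also have "\<dots> = (\<Sum>k<m. (coef i k x * coef k j y) *\<^sub>C w (r i))"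
  proof (rule sum.cong)
    fix k assume "k \<in> {..<m}"
    then have k: "k < m" by simp
    show "(star (w i) * x * w k) * (star (w k) * y * w j) = (coef i k x * coef k j y) *\<^sub>C w (r i)"
    proof (cases "r i = r k")
      case True
      then show ?thesis using ij k rep[OF ij(1)]
        by (simp add: coef_eq mult_scaleC_left mult_scaleC_right scaleC_scaleC mult.commute)
    next
      case False
      then show ?thesis using ij k by (simp add: coef_eq coef_zero)
    qed
  qed simp
  finally show "star (w i) * (x * y) * w j = (\<Sum>k<m. coef i k x * coef k j y) *\<^sub>C w (r i)"
    by (simp add: scaleC_sum_left)
qed auto

text \<open>
  Every seminorm on \<open>E\<close> is bounded by coordinates. With \<open>coef_bound\<close> this takes the place of
  the equivalence of norms on a finite-dimensional space.
\<close>

lemma norm_sum_coef_le: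
  assumes "x \<in> E" "\<And>y z. y \<in> E \<Longrightarrow> z \<in> E \<Longrightarrow> N (y + z) \<le> N y + (N z :: real)"
    "\<And>c y. y \<in> E \<Longrightarrow> N (c *\<^sub>C y) = cmod c * N y"
  shows "N x \<le> (\<Sum>i<m. \<Sum>j<m. cmod (coef i j x) * N (w i * star (w j)))"
proof -
  have N0: "N 0 = 0" using assms(3)[of 0 0] subalg by (simp add: star_subalg_zero)
  have sum: "N (\<Sum>i\<in>I. f i) \<le> (\<Sum>i\<in>I. N (f i))" if "\<And>i. i \<in> I \<Longrightarrow> f i \<in> E" for I :: "nat set" and f
    using that
  proof (induction I rule: infinite_finite_induct)
    case (insert k I)
    have "N (f k + sum f I) \<le> N (f k) + N (sum f I)"
      using insert.prems subalg by (intro assms(2) star_subalg_sum) auto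
    then show ?case using insert by fastforce
  qed (auto simp: N0)
  have wE: "w i * star (w j) \<in> E" if "i < m" "j < m" for i j
    using subalg w_in that by (auto intro!: star_subalg_closed)
  have "N x \<le> (\<Sum>i<m. N (\<Sum>j<m. coef i j x *\<^sub>C (w i * star (w j))))"
    using subalg wE by (subst expand[OF assms(1)], intro sum star_subalg_sum star_subalg_scaleC) auto
  also have "\<dots> \<le> (\<Sum>i<m. \<Sum>j<m. N (coef i j x *\<^sub>C (w i * star (w j))))"
    using subalg wE by (intro sum_mono sum star_subalg_scaleC) auto
  also have "\<dots> = (\<Sum>i<m. \<Sum>j<m. cmod (coef i j x) * N (w i * star (w j)))"
    using wE by (intro sum.cong refl assms(3)) auto
  finally show ?thesis .
qed

lemma closed_E: "closed E"
  unfolding closed_sequential_limits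
proof (intro allI impI)
  fix x l assume xl: "(\<forall>n. x n \<in> E) \<and> x \<longlonglongrightarrow> l"
  have c: "star (w i) * l * w j \<in> E" if ij: "i < m" "j < m" for i j
  proof -
    have lim: "(\<lambda>n. star (w i) * x n * w j) \<longlonglongrightarrow> star (w i) * l * w j"
      using xl by (intro tendsto_intros) auto
    have eq: "star (w i) * x n * w j = coef i j (x n) *\<^sub>C w (r i)" for n
      using xl ij by (simp add: coef_eq)
    have "Cauchy (\<lambda>n. coef i j (x n) *\<^sub>C w (r i))"
      using LIMSEQ_imp_Cauchy[OF lim] by (simp add: eq)
    moreover have "dist (coef i j (x n) *\<^sub>C w (r i)) (coef i j (x k) *\<^sub>C w (r i)) = dist (coef i j (x n)) (coef i j (x k))" for n k
      using norm_rep ij by (simp add: dist_norm norm_scaleC flip: scaleC_diff_left)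
    ultimately have "Cauchy (\<lambda>n. coef i j (x n))" by (simp add: Cauchy_def)
    then obtain c where "(\<lambda>n. coef i j (x n)) \<longlonglongrightarrow> c"
      using Cauchy_convergent convergentD by blast
    then have "(\<lambda>n. coef i j (x n) *\<^sub>C w (r i)) \<longlonglongrightarrow> c *\<^sub>C w (r i)" by (intro tendsto_intros)
    then have "star (w i) * l * w j = c *\<^sub>C w (r i)"
      using lim LIMSEQ_unique by (simp add: eq)
    then show ?thesis using subalg w_in[OF r_less[OF ij(1)]] by (simp add: star_subalg_closed)
  qed
  have "(\<lambda>n. P * (x n * P)) \<longlonglongrightarrow> P * (l * P)" using xl by (intro tendsto_intros) auto
  moreover have "P * (x n * P) = x n" for n using xl P_unit unit_P by simp
  ultimately have "l = P * (l * P)" using xl LIMSEQ_unique by fastforce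
  also have "\<dots> = (\<Sum>i<m. \<Sum>j<m. w i * (star (w i) * l * w j) * star (w j))"
    by (subst sum.swap) (simp add: P_def sum_distrib_left sum_distrib_right mult.assoc)
  also have "\<dots> \<in> E"
  proof (intro star_subalg_sum[OF subalg])
    fix i j assume "i \<in> {..<m}" "j \<in> {..<m}"
    then show "w i * (star (w i) * l * w j) * star (w j) \<in> E"
      using star_subalg_mult[OF subalg star_subalg_mult[OF subalg w_in c]] star_subalg_star[OF subalg w_in]
      by auto
  qed
  finally show "l \<in> E" .
qed

lemma unit_ball_in_compact: obtains K where "compact K" "{x \<in> E. norm x \<le> 1} \<subseteq> K"
proof -
  have *: "\<exists>K. compact K \<and> (\<forall>c. (\<forall>i\<in>I. cmod (c i) \<le> 1) \<longrightarrow> (\<Sum>i\<in>I. c i *\<^sub>C f i) \<in> K)"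
    if "finite I" for I :: "(nat \<times> nat) set" and f :: "nat \<times> nat \<Rightarrow> 'a"
    using that
  proof induction
    case empty
    show ?case by (rule exI[of _ "{0}"]) simp
  next
    case (insert k I)
    obtain K where K: "compact K" "\<And>c. (\<forall>i\<in>I. cmod (c i) \<le> 1) \<Longrightarrow> (\<Sum>i\<in>I. c i *\<^sub>C f i) \<in> K"
      using insert.IH by blast
    let ?L = "(\<lambda>c. c *\<^sub>C f k) ` cball 0 1"
    have "compact ?L" by (intro compact_continuous_image continuous_intros compact_cball)
    then have "compact {x + y |x y. x \<in> ?L \<and> y \<in> K}" using K(1) by (rule compact_sums)
    moreover have "(\<Sum>i\<in>insert k I. c i *\<^sub>C f i) \<in> {x + y |x y. x \<in> ?L \<and> y \<in> K}"
      if "\<forall>i\<in>insert k I. cmod (c i) \<le> 1" for c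
    proof -
      have "c k *\<^sub>C f k \<in> ?L" "(\<Sum>i\<in>I. c i *\<^sub>C f i) \<in> K" using that K(2) by auto
      then show ?thesis using insert.hyps by auto
    qed
    ultimately show ?case by blast
  qed
  obtain K where K: "compact K" "\<And>c. (\<forall>i\<in>{..<m} \<times> {..<m}. cmod (c i) \<le> 1) \<Longrightarrow>
     (\<Sum>i\<in>{..<m} \<times> {..<m}. c i *\<^sub>C (w (fst i) * star (w (snd i)))) \<in> K"
    using *[of "{..<m} \<times> {..<m}" "\<lambda>i. w (fst i) * star (w (snd i))"] by auto
  have "x \<in> K" if "x \<in> E" "norm x \<le> 1" for x
  proof -
    have "(\<Sum>i\<in>{..<m} \<times> {..<m}. coef (fst i) (snd i) x *\<^sub>C (w (fst i) * star (w (snd i)))) \<in> K"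
      using coef_bound[OF _ _ that(1)] that(2) by (intro K(2)) force
    then show ?thesis using expand[OF that(1)] by (simp add: sum.cartesian_product case_prod_unfold)
  qed
  then show thesis using K(1) that by blast
qed

text \<open>
  Another solution \<open>v\<close> of the relations defines a *-homomorphism on \<open>E\<close>, which is close to the inclusion
  if \<open>v\<close> is close to \<open>w\<close>.
\<close>

definition transfer :: "(nat \<Rightarrow> 'a) \<Rightarrow> 'a \<Rightarrow> 'a" where
  "transfer v x = (\<Sum>i<m. \<Sum>j<m. coef i j x *\<^sub>C (v i * star (v j)))"

lemma transfer_add: "x \<in> E \<Longrightarrow> y \<in> E \<Longrightarrow> transfer v (x + y) = transfer v x + transfer v y"
  by (simp add: transfer_def coef_add scaleC_add_left sum.distrib)

lemma transfer_scaleC: "x \<in> E \<Longrightarrow> transfer v (c *\<^sub>C x) = c *\<^sub>C transfer v x"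
  by (simp add: transfer_def coef_scaleC scaleC_scaleC scaleC_sum_right)

lemma transfer_star: "x \<in> E \<Longrightarrow> transfer v (star x) = star (transfer v x)"
  unfolding transfer_def star_sum
  by (subst sum.swap) (simp add: coef_star star_scaleC star_mult star_star)

lemma transfer_mult:
  assumes v: "isometry_system m v r" and x: "x \<in> E" "y \<in> E"
  shows "transfer v (x * y) = transfer v x * transfer v y"
proof -
  interpret v: isometry_system m v r by fact
  have tv: "transfer v x * v k = (\<Sum>i<m. coef i k x *\<^sub>C v i)" if k: "k < m" for k
  proof -
    have "coef i j x *\<^sub>C (v i * star (v j) * v k) = (if j = k then coef i k x *\<^sub>C v i else 0)"
      if "i < m" "j < m" for i j
      using that k x v.star_w_w[of j k] v.w_rep[of i] coef_zero[of i k x]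
      by (cases "r i = r k") (auto simp: mult.assoc)
    then show ?thesis using k
      by (simp add: transfer_def sum_distrib_right mult_scaleC_left)
  qed
  have "transfer v x * transfer v y = (\<Sum>k<m. (transfer v x * v k) * (\<Sum>l<m. coef k l y *\<^sub>C star (v l)))"
    by (subst (2) transfer_def) (simp add: sum_distrib_left mult_scaleC_right mult.assoc)
  also have "\<dots> = (\<Sum>k<m. \<Sum>i<m. \<Sum>l<m. (coef i k x * coef k l y) *\<^sub>C (v i * star (v l)))"
    by (simp add: tv sum_product mult_scaleC_right mult_scaleC_left scaleC_scaleC mult.commute)
  also have "\<dots> = (\<Sum>i<m. \<Sum>l<m. \<Sum>k<m. (coef i k x * coef k l y) *\<^sub>C (v i * star (v l)))"
    by (subst sum.swap, rule sum.cong[OF refl], subst sum.swap) simp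
  also have "\<dots> = transfer v (x * y)" using x by (simp add: transfer_def coef_mult scaleC_sum_left)
  finally show ?thesis by simp
qed

lemma transfer_near:
  assumes "x \<in> E"
  shows "norm (transfer v x - x) \<le> (\<Sum>i<m. \<Sum>j<m. norm (v i * star (v j) - w i * star (w j))) * norm x"
proof -
  have "transfer v x - x = (\<Sum>i<m. \<Sum>j<m. coef i j x *\<^sub>C (v i * star (v j) - w i * star (w j)))"
    by (subst (2) expand[OF assms]) (simp add: transfer_def scaleC_diff_right sum_subtractf)
  also have "norm \<dots> \<le> (\<Sum>i<m. \<Sum>j<m. norm x * norm (v i * star (v j) - w i * star (w j)))"
    using coef_bound[OF _ _ assms]
    by (intro sum_norm_le) (simp add: norm_scaleC mult_right_mono)
  finally show ?thesis by (simp add: sum_distrib_left sum_distrib_right mult.commute)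
qed

lemma transfer_in:
  "star_subalg D \<Longrightarrow> (\<And>i. i < m \<Longrightarrow> v i \<in> D) \<Longrightarrow> transfer v x \<in> D"
  unfolding transfer_def by (intro star_subalg_closed) auto

end

lemma finite_dim_matrix_units:
  fixes E :: "'a::cstar_algebra set"
  assumes E: "star_subalg E" "finite_dim E"
  obtains m w r where "matrix_units m w r E"
proof -
  obtain m w r where pu: "partial_units E m w r"
    and unit: "\<And>x. x \<in> E \<Longrightarrow> (\<Sum>i<m. w i * star (w i)) * x = x"
    using finite_dim_structure[OF E] by blast
  interpret isometry_system m w r using pu by (rule partial_units_system)
  have wE: "w i \<in> E" if "i < m" for i using pu that by (auto simp: partial_units_def)
  have min: "minimal_projection E (w (r i))" if "i < m" for i
    using pu r_less[OF that] r_r[OF that] by (auto simp: partial_units_def)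
  show thesis
  proof (rule that, unfold_locales)
    fix i j x assume ij: "i < m" "j < m" and x: "x \<in> E"
    let ?y = "star (w i) * x * w j"
    have rep: "star (w (r k)) = w (r k)" "w (r k) * w (r k) = w (r k)" if "k < m" for k
      using rep_projection[OF that] by (auto simp: is_projection_def)
    have "star (w i * w (r i)) = star (w i)" using w_rep ij by simp
    then have l: "w (r i) * star (w i) = star (w i)" using rep ij by (simp add: star_mult)
    have y: "?y \<in> E" "w (r i) * ?y = ?y" "?y * w (r j) = ?y"
      using E wE ij x w_rep l by (auto simp: star_subalg_closed mult.assoc simp flip: mult.assoc[of "w (r i)"])
    show "\<exists>c. ?y = c *\<^sub>C w (r i) \<and> (r i \<noteq> r j \<longrightarrow> c = 0)"
    proof (cases "r i = r j")
      case True
      then obtain c where "?y = c *\<^sub>C w (r i)"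
        using minimal_projection_corner[OF E min[OF ij(1)] y(1,2)] y(3) by metis
      then show ?thesis using True by blast
    next
      case False
      have "w (r i) * ?y * w (r j) = 0"
        using pu r_less r_r ij False y(1) by (auto simp: partial_units_def)
      then have "?y = 0" using y by simp
      then show ?thesis by (intro exI[of _ 0]) simp
    qed
  qed (use E wE min unit in \<open>auto simp: minimal_projection_def P_def\<close>)
qed

section \<open>Perturbation of matrix units\<close>

lemma geometric_steps_limit:
  fixes X :: "nat \<Rightarrow> 'a::banach"
  assumes d: "\<And>n. norm (X (Suc n) - X n) \<le> C * (1/2) ^ n"
  obtains z where "X \<longlonglongrightarrow> z" "norm (z - X 0) \<le> 2 * C"
proof -
  let ?d = "\<lambda>n. X (Suc n) - X n"
  have sg: "summable (\<lambda>n. C * (1/2::real) ^ n)" by (intro summable_mult summable_geometric) simp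
  have sn: "summable (\<lambda>n. norm (?d n))" using d by (intro summable_comparison_test'[OF sg]) auto
  have "(\<lambda>n. X 0 + (\<Sum>k<n. ?d k)) \<longlonglongrightarrow> X 0 + (\<Sum>n. ?d n)"
    by (intro tendsto_intros summable_LIMSEQ summable_norm_cancel[OF sn])
  moreover have "X 0 + (\<Sum>k<n. ?d k) = X n" for n
    using sum_lessThan_telescope[of X n] by simp
  ultimately have "X \<longlonglongrightarrow> X 0 + (\<Sum>n. ?d n)" by simp
  moreover have "norm (X 0 + (\<Sum>n. ?d n) - X 0) \<le> 2 * C"
  proof -
    have "norm (X 0 + (\<Sum>n. ?d n) - X 0) \<le> (\<Sum>n. norm (?d n))" using summable_norm[OF sn] by simp
    also have "\<dots> \<le> (\<Sum>n. C * (1/2) ^ n)" by (intro suminf_le d sn sg)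
    also have "\<dots> = 2 * C" by (subst suminf_mult) (auto simp: suminf_geometric intro: summable_geometric)
    finally show ?thesis .
  qed
  ultimately show thesis by (rule that)
qed

text \<open>
  The limit of an iteration stays in the closed set in which the iteration takes place, so no
  functional calculus is needed to round an approximate solution of an equation to an exact one.
\<close>

lemma contracting_iteration:
  fixes G :: "'a::banach \<Rightarrow> 'a" and err :: "'a \<Rightarrow> real"
  assumes S: "closed S" and x: "x \<in> S" "err x \<le> e" and C: "C \<ge> 0"
    and err: "\<And>y. err y \<ge> 0" "continuous_on UNIV err"
    and step: "\<And>y. y \<in> S \<Longrightarrow> err y \<le> e \<Longrightarrow> G y \<in> S \<and> err (G y) \<le> err y / 2 \<and> norm (G y - y) \<le> C * err y"
  obtains z where "z \<in> S" "err z = 0" "norm (z - x) \<le> 2 * C * err x"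
proof -
  define X where "X n = (G ^^ n) x" for n
  have X: "X n \<in> S \<and> err (X n) \<le> err x * (1/2) ^ n \<and> err (X n) \<le> e" for n
  proof (induction n)
    case (Suc n)
    have "X (Suc n) = G (X n)" by (simp add: X_def)
    then show ?case using step[of "X n"] Suc err(1)[of "X n"] by auto
  qed (use x in \<open>auto simp: X_def\<close>)
  have d: "norm (X (Suc n) - X n) \<le> (C * err x) * (1/2) ^ n" for n
  proof -
    have "norm (X (Suc n) - X n) \<le> C * err (X n)" using step[of "X n"] X[of n] by (simp add: X_def)
    also have "\<dots> \<le> C * (err x * (1/2) ^ n)" using X C by (intro mult_left_mono) auto
    finally show ?thesis by simp
  qed
  obtain z where lim: "X \<longlonglongrightarrow> z" and z: "norm (z - X 0) \<le> 2 * (C * err x)"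
    using geometric_steps_limit[of X "C * err x", OF d] by blast
  have "z \<in> S" using closed_sequentially[OF S _ lim] X by blast
  moreover have "err z = 0"
  proof -
    have "(\<lambda>n. err (X n)) \<longlonglongrightarrow> err z"
      using continuous_on_tendsto_compose[OF err(2) lim] by simp
    moreover have "(\<lambda>n. err (X n)) \<longlonglongrightarrow> 0"
    proof (rule tendsto_sandwich[where f="\<lambda>_. 0"])
      show "(\<lambda>n. err x * (1/2::real) ^ n) \<longlonglongrightarrow> 0"
        using tendsto_mult_right_zero[OF LIMSEQ_realpow_zero[of "1/2"]] by simp
    qed (use X err(1) in auto)
    ultimately show ?thesis using LIMSEQ_unique by blast
  qed
  moreover have "norm (z - x) \<le> 2 * C * err x" using z by (simp add: X_def mult.assoc)
  ultimately show thesis by (rule that)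
qed

text \<open>
  The iteration is that of Newton and Schulz for the polar decomposition. As \<open>star y * y\<close> is close to
  the unit \<open>p\<close> of its corner, there are no small singular values to spoil the convergence. Right
  multiplication by elements of \<open>D\<close> preserves the annihilation by \<open>star u\<close>.
\<close>

lemma round_to_isometry:
  fixes y p :: "'a::cstar_algebra"
  assumes D: "star_subalg D" "closed D" and y: "y \<in> D" "y * p = y" "\<And>u. u \<in> U \<Longrightarrow> star u * y = 0"
    and p: "is_projection p" and e: "norm (p - star y * y) \<le> 1/4"
  obtains v where "v \<in> D" "star v * v = p" "\<And>u. u \<in> U \<Longrightarrow> star u * v = 0"
    "norm (v - y) \<le> 2 * norm (p - star y * y)"
proof -
  let ?S = "{y \<in> D. y * p = y \<and> (\<forall>u\<in>U. star u * y = 0)}"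
  let ?err = "\<lambda>y. norm (p - star y * y)"
  let ?G = "\<lambda>y. y + (1/2) *\<^sub>R (y * (p - star y * y))"
  have pp: "star p = p" "p * p = p" using p by (auto simp: is_projection_def)
  have "closed {y. star u * y = 0}" for u :: 'a
    by (intro closed_Collect_eq continuous_intros)
  moreover have "closed {y. y * p = y}" by (intro closed_Collect_eq continuous_intros)
  ultimately have "closed (D \<inter> {y. y * p = y} \<inter> (\<Inter>u\<in>U. {y. star u * y = 0}))" using D by blast
  also have "D \<inter> {y. y * p = y} \<inter> (\<Inter>u\<in>U. {y. star u * y = 0}) = ?S" by auto
  finally have S: "closed ?S" .
  have step: "?G y \<in> ?S \<and> ?err (?G y) \<le> ?err y / 2 \<and> norm (?G y - y) \<le> 1 * ?err y"
    if y: "y \<in> ?S" and e: "?err y \<le> 1/4" for y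
  proof -
    define b where "b = p - star y * y"
    have yp: "y * p = y" using y by simp
    have py: "p * star y = star y" using yp pp by (metis star_mult)
    have b: "star b = b" "p * b = b" "b * p = b"
      using pp yp py by (auto simp: b_def star_diff star_mult star_star right_diff_distrib left_diff_distrib mult.assoc)
        (simp flip: mult.assoc)
    have a: "star y * y = p - b" by (simp add: b_def)
    have 1: "p - star (?G y) * ?G y = (3/4) *\<^sub>R (b * b) + (1/4) *\<^sub>R (b * b * b)"
    proof -
      have "star (?G y) * ?G y = star y * y + (1/2) *\<^sub>R (star y * y * b) + (1/2) *\<^sub>R (b * (star y * y))
         + (1/4) *\<^sub>R (b * (star y * y) * b)"
        by (simp add: b(1) star_add star_scaleR star_mult distrib_left distrib_right
              scaleR_add_right mult.assoc flip: b_def)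
      also have "\<dots> = p - b + ((1/2) *\<^sub>R (b - b * b) + (1/2) *\<^sub>R (b - b * b))
         + (1/4) *\<^sub>R (b * b - b * b * b)"
        unfolding a by (simp add: b right_diff_distrib left_diff_distrib mult.assoc)
      also have "(1/2) *\<^sub>R (b - b * b) + (1/2) *\<^sub>R (b - b * b) = b - b * b"
        by (simp flip: scaleR_add_left)
      also have "p - b + (b - b * b) + (1/4) *\<^sub>R (b * b - b * b * b)
         = p - (b * b) + (1/4) *\<^sub>R (b * b - b * b * b)" by simp
      finally show ?thesis
        using scaleR_left_diff_distrib[of 1 "1/4" "b * b"] by (simp add: scaleR_diff_right)
    qed
    have nb: "norm b \<le> 1/4" using e by (simp add: b_def)
    have bb: "norm (b * b) \<le> norm b * (1/4)"
      using norm_mult_ineq[of b b] mult_left_mono[OF nb, of "norm b"] by simp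
    have bbb: "norm (b * b * b) \<le> norm b * (1/4)"
    proof -
      have "norm (b * b) * norm b \<le> norm b * (1/4) * (1/4)"
        using mult_mono[OF bb nb] by simp
      then show ?thesis using norm_mult_ineq[of "b * b" b] norm_ge_zero[of b] by linarith
    qed
    have err: "?err (?G y) \<le> ?err y / 2"
    proof -
      have "norm ((3/4) *\<^sub>R (b * b) + (1/4) *\<^sub>R (b * b * b)) \<le> (3/4) * norm (b * b) + (1/4) * norm (b * b * b)"
        using norm_triangle_ineq[of "(3/4) *\<^sub>R (b * b)" "(1/4) *\<^sub>R (b * b * b)"] by simp
      also have "\<dots> \<le> norm b / 2" using bb bbb norm_ge_zero[of b] by linarith
      finally show ?thesis unfolding 1 by (simp flip: b_def)
    qed
    have "(norm y)\<^sup>2 = norm (p - b)" using cstar_identity[of y] a by simp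
    also have "\<dots> \<le> norm p + norm b" by (rule norm_triangle_ineq4)
    also have "\<dots> \<le> 2\<^sup>2" using norm_projection[OF p] nb by (cases "p = 0") auto
    finally have ny: "norm y \<le> 2" by (rule power2_le_imp_le) simp
    have "norm (?G y - y) \<le> (1/2) * (norm y * norm b)"
      using norm_mult_ineq[of y b] by (simp add: b_def)
    also have "\<dots> \<le> (1/2) * (2 * norm b)" using ny by (intro mult_left_mono mult_right_mono) auto
    finally have 3: "norm (?G y - y) \<le> 1 * ?err y" by (simp add: b_def)
    have "?G y = y + (1/2) *\<^sub>R (y - y * star y * y)" by (simp add: right_diff_distrib yp mult.assoc)
    moreover have "y + (1/2) *\<^sub>R (y - y * star y * y) \<in> D" using y D by (auto intro!: star_subalg_closed)
    ultimately have "?G y \<in> D" by simp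
    moreover have "?G y * p = ?G y" using yp b by (simp add: distrib_right mult.assoc flip: b_def)
    moreover have "star u * ?G y = 0" if "u \<in> U" for u
      using y that by (simp add: distrib_left flip: mult.assoc)
    ultimately show ?thesis using err 3 by blast
  qed
  have "continuous_on UNIV ?err" by (intro continuous_intros)
  moreover have "y \<in> ?S" using y by blast
  ultimately obtain v where "v \<in> ?S" "?err v = 0" "norm (v - y) \<le> 2 * 1 * ?err y"
    using contracting_iteration[of ?S y ?err "1/4" 1 ?G] S step e by auto
  then show thesis using that[of v] by auto
qed

lemma round_to_projection:
  fixes x :: "'a::cstar_algebra"
  assumes D: "star_subalg D" "closed D" and x: "x \<in> D" "star x = x" "\<And>u. u \<in> U \<Longrightarrow> star u * x = 0"
    and e: "norm (x * x - x) \<le> 1/8"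
  obtains q where "q \<in> D" "is_projection q" "\<And>u. u \<in> U \<Longrightarrow> star u * q = 0"
    "norm (q - x) \<le> 10 * norm (x * x - x)"
proof -
  let ?S = "{x \<in> D. star x = x \<and> (\<forall>u\<in>U. star u * x = 0)}"
  let ?err = "\<lambda>x::'a. norm (x * x - x)"
  \<comment> \<open>\<open>3 x\<^sup>2 - 2 x\<^sup>3\<close>, whose fixed points 0 and 1 attract quadratically\<close>
  let ?G = "\<lambda>x::'a. x + (x * x - x) - (x * (x * x - x) + x * (x * x - x))"
  have "closed {y. star u * y = 0}" for u :: 'a
    by (intro closed_Collect_eq continuous_intros)
  moreover have "closed {y::'a. star y = y}" by (intro closed_Collect_eq continuous_intros)
  ultimately have "closed (D \<inter> {y. star y = y} \<inter> (\<Inter>u\<in>U. {y. star u * y = 0}))" using D by blast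
  also have "D \<inter> {y. star y = y} \<inter> (\<Inter>u\<in>U. {y. star u * y = 0}) = ?S" by auto
  finally have S: "closed ?S" .
  have step: "?G x \<in> ?S \<and> ?err (?G x) \<le> ?err x / 2 \<and> norm (?G x - x) \<le> 5 * ?err x"
    if x: "x \<in> ?S" and e: "?err x \<le> 1/8" for x
  proof -
    define d where "d = x * x - x"
    have xx: "x * x = x + d" by (simp add: d_def)
    define t where "t = x * d"
    have dx: "d * x = t" by (simp add: t_def d_def right_diff_distrib left_diff_distrib mult.assoc)
    have xt: "x * t = t + d * d" by (simp add: t_def xx distrib_right flip: mult.assoc)
    have tx: "t * x = t + d * d" by (metis dx mult.assoc t_def xt)
    have dt: "d * t = t * d" by (metis dx mult.assoc t_def)
    have tt: "t * t = t * d + d * d * d"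
      by (metis dx mult.assoc t_def xt distrib_right)
    have Gx: "?G x = x + d - (t + t)" by (simp add: t_def d_def)
    have 1: "?G x * ?G x - ?G x = 4 *\<^sub>R (d * d * d) - 3 *\<^sub>R (d * d)"
    proof -
      have "?G x * ?G x - ?G x = (d * d * d + d * d * d + d * d * d + d * d * d) - (d * d + d * d + d * d)"
        unfolding Gx by (simp add: algebra_simps xx dx xt tx dt tt flip: t_def)
      also have "\<dots> = 4 *\<^sub>R (d * d * d) - 3 *\<^sub>R (d * d)"
        using scaleR_left_distrib[of 2 2 "d * d * d"] scaleR_left_distrib[of 2 1 "d * d"]
        by (simp add: scaleR_2)
      finally show ?thesis .
    qed
    have nd: "norm d \<le> 1/8" using e by (simp add: d_def)
    have dd: "norm (d * d) \<le> norm d * (1/8)"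
      using norm_mult_ineq[of d d] mult_left_mono[OF nd, of "norm d"] by simp
    have ddd: "norm (d * d * d) \<le> norm d * (1/64)"
      using norm_mult_ineq[of "d * d" d] mult_mono[OF dd nd] by simp
    have err: "?err (?G x) \<le> ?err x / 2"
    proof -
      have "norm (4 *\<^sub>R (d * d * d) - 3 *\<^sub>R (d * d)) \<le> 4 * norm (d * d * d) + 3 * norm (d * d)"
        using norm_triangle_ineq4[of "4 *\<^sub>R (d * d * d)" "3 *\<^sub>R (d * d)"] by simp
      also have "\<dots> \<le> norm d / 2" using dd ddd norm_ge_zero[of d] by linarith
      finally show ?thesis unfolding 1 by (simp flip: d_def)
    qed
    have sx: "star x = x" using x by simp
    have "norm x * norm x = norm (x + d)" using cstar_identity[of x] sx xx by (simp add: power2_eq_square)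
    also have "\<dots> \<le> norm x + 1/8" using norm_triangle_ineq[of x d] nd by simp
    finally have nx: "norm x \<le> 2"
      using mult_right_mono[of 2 "norm x" "norm x"] by (cases "norm x \<le> 2") auto
    have Gxx: "?G x - x = d - (x * d + x * d)" unfolding Gx t_def by simp
    have "norm (?G x - x) \<le> norm d + (norm x * norm d + norm x * norm d)"
      unfolding Gxx using norm_triangle_ineq4[of d "x * d + x * d"] norm_triangle_ineq[of "x * d" "x * d"]
        norm_mult_ineq[of x d] by linarith
    also have "\<dots> \<le> norm d + (2 * norm d + 2 * norm d)"
      using mult_right_mono[OF nx, of "norm d"] norm_ge_zero[of d] by linarith
    finally have 3: "norm (?G x - x) \<le> 5 * ?err x" by (simp add: d_def)
    have "?G x \<in> D" using x D by (auto intro!: star_subalg_closed)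
    moreover have "star (?G x) = ?G x"
      using sx by (simp add: star_add star_diff star_mult right_diff_distrib left_diff_distrib mult.assoc)
    moreover have "star u * ?G x = 0" if "u \<in> U" for u
      using x that by (simp add: distrib_left right_diff_distrib flip: mult.assoc)
    ultimately show ?thesis using err 3 by blast
  qed
  have "continuous_on UNIV ?err" by (intro continuous_intros)
  moreover have "x \<in> ?S" using x by blast
  ultimately obtain q where "q \<in> ?S" "?err q = 0" "norm (q - x) \<le> 2 * 5 * ?err x"
    using contracting_iteration[of ?S x ?err "1/8" 5 ?G] S step e by auto
  then show thesis using that[of q] by (auto simp: is_projection_def)
qed

text \<open>
  Adding one partial isometry to a system requires relations with the earlier ones on one side only.
\<close>

lemma isometry_system_Suc:
  assumes "isometry_system m v r" "r m \<le> m" "r (r m) = r m"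
    "\<And>i. i < m \<Longrightarrow> star (v i) * v m = 0" "star (v m) * v m = v (r m)"
  shows "isometry_system (Suc m) v r"
proof -
  have "star (v m) * v i = 0" if "i < m" for i
    using assms(4)[OF that] by (metis star_mult star_star star_zero)
  then show ?thesis using assms by (auto simp: isometry_system_def less_Suc_eq)
qed

text \<open>
  The perturbation result is stated for a sequence of algebras in place of a fixed algebra and a small
  distance: estimates are then replaced by limits of algebraic expressions. In the step, an approximant of
  \<open>w m\<close> is first compressed to the complement of the range projection \<open>Q\<close> of the earlier \<open>v i\<close>, on the
  left and, if it is to become a projection, also on the right; multiplication by \<open>v (r m)\<close> on the
  right gives it the correct domain otherwise. Rounding preserves these properties.
\<close>

lemma perturb_isometry_system_step:
  fixes w :: "nat \<Rightarrow> 'a::cstar_algebra" and D :: "nat \<Rightarrow> 'a set"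
  assumes D: "\<And>n. star_subalg (D n)" "\<And>n. closed (D n)"
    and w: "isometry_system (Suc m) w r"
    and v: "\<And>i n. i < m \<Longrightarrow> v i n \<in> D n" "\<And>i. i < m \<Longrightarrow> v i \<longlonglongrightarrow> w i"
      "\<forall>\<^sub>F n in sequentially. isometry_system m (\<lambda>i. v i n) r"
    and x: "\<And>n. x n \<in> D n" "x \<longlonglongrightarrow> w m"
  obtains u where "\<And>n. u n \<in> D n" "u \<longlonglongrightarrow> w m"
    "\<forall>\<^sub>F n in sequentially. (\<forall>i<m. star (v i n) * u n = 0) \<and>
       star (u n) * u n = (if r m = m then u n else v (r m) n)"
proof -
  interpret w: isometry_system "Suc m" w r by fact
  define Q where "Q n = (\<Sum>i<m. v i n * star (v i n))" for n
  define Q0 where "Q0 = (\<Sum>i<m. w i * star (w i))"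
  have Qlim: "Q \<longlonglongrightarrow> Q0" unfolding Q_def Q0_def using v(2) by (intro tendsto_intros) auto
  have QD: "Q n \<in> D n" for n unfolding Q_def using D(1)[of n] v(1) by (intro star_subalg_closed) auto
  have Q0: "Q0 * w m = 0" unfolding Q0_def sum_distrib_right
    by (rule sum.neutral) (auto simp: mult.assoc w.star_w_w)
  have vQ: "\<forall>\<^sub>F n in sequentially. \<forall>i<m. star (v i n) * Q n = star (v i n)"
    using v(3)
  proof eventually_elim
    case (elim n)
    then interpret isometry_system m "\<lambda>i. v i n" r .
    show ?case using star_w_P by (simp add: P_def Q_def)
  qed
  \<comment> \<open>It suffices to find \<open>y n \<in> D n\<close> which tends to \<open>w m\<close> and can be rounded with controlled error.\<close>
  note result = that
  have choose: thesis
    if y: "y \<longlonglongrightarrow> w m" and e: "e \<longlonglongrightarrow> 0"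
      and ev: "\<forall>\<^sub>F n in sequentially. \<exists>u\<in>D n. norm (u - y n) \<le> e n \<and> (\<forall>i<m. star (v i n) * u = 0) \<and>
       star u * u = (if r m = m then u else v (r m) n)" for y :: "nat \<Rightarrow> 'a" and e :: "nat \<Rightarrow> real"
  proof -
    let ?R = "\<lambda>n u. norm (u - y n) \<le> e n \<and> (\<forall>i<m. star (v i n) * u = 0) \<and>
       star u * u = (if r m = m then u else v (r m) n)"
    have "\<exists>u. u \<in> D n \<and> ((\<exists>u\<in>D n. ?R n u) \<longrightarrow> ?R n u)" for n
      using star_subalg_zero[OF D(1)[of n]] by blast
    then obtain u where u: "\<And>n. u n \<in> D n" "\<And>n. (\<exists>u\<in>D n. ?R n u) \<Longrightarrow> ?R n (u n)" by metis
    have ev': "\<forall>\<^sub>F n in sequentially. ?R n (u n)" using ev by eventually_elim (rule u(2))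
    have "(\<lambda>n. u n - y n) \<longlonglongrightarrow> 0"
      by (rule Lim_null_comparison[OF _ e]) (use ev' in eventually_elim, blast)
    then have "(\<lambda>n. u n - y n + y n) \<longlonglongrightarrow> 0 + w m" using y by (rule tendsto_add)
    then have "u \<longlonglongrightarrow> w m" by simp
    moreover have "\<forall>\<^sub>F n in sequentially. (\<forall>i<m. star (v i n) * u n = 0) \<and>
       star (u n) * u n = (if r m = m then u n else v (r m) n)" using ev' by eventually_elim blast
    ultimately show thesis using u(1) result by blast
  qed
  show thesis
  proof (cases "r m = m")
    case True
    have wm: "star (w m) = w m" "w m * w m = w m"
      using w.rep_projection[of m] True by (auto simp: is_projection_def)
    define h where "h n = (1/2) *\<^sub>R (x n + star (x n))" for n
    define y where "y n = h n - Q n * h n - (h n * Q n - Q n * h n * Q n)" for n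
    have hD: "h n \<in> D n" for n using D(1)[of n] x(1) by (auto simp: h_def intro!: star_subalg_closed)
    have yD: "y n \<in> D n" for n using D(1)[of n] hD QD by (auto simp: y_def intro!: star_subalg_closed)
    have sQ: "star (Q n) = Q n" for n by (simp add: Q_def star_sum star_mult star_star)
    have sh: "star (h n) = h n" for n by (simp add: h_def star_scaleR star_add star_star add.commute)
    have sy: "star (y n) = y n" for n
      by (simp add: y_def star_diff star_mult sQ sh mult.assoc)
    have "star (Q0 * w m) = w m * Q0" using wm by (simp add: star_mult Q0_def star_sum star_star)
    then have Q0': "w m * Q0 = 0" using Q0 by simp
    have "h \<longlonglongrightarrow> (1/2) *\<^sub>R (w m + star (w m))" unfolding h_def using x by (intro tendsto_intros)
    then have hl: "h \<longlonglongrightarrow> w m" using wm by (simp flip: scaleR_2)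
    have "y \<longlonglongrightarrow> w m - Q0 * w m - (w m * Q0 - Q0 * w m * Q0)"
      unfolding y_def by (intro tendsto_intros hl Qlim)
    then have yl: "y \<longlonglongrightarrow> w m" by (simp add: Q0 Q0')
    have "(\<lambda>n. norm (y n * y n - y n)) \<longlonglongrightarrow> norm (w m * w m - w m)" by (intro tendsto_intros yl)
    then have el: "(\<lambda>n. norm (y n * y n - y n)) \<longlonglongrightarrow> 0" by (simp add: wm)
    then have "\<forall>\<^sub>F n in sequentially. norm (y n * y n - y n) < 1/8" by (rule order_tendstoD) simp
    then have "\<forall>\<^sub>F n in sequentially. \<exists>u\<in>D n. norm (u - y n) \<le> 10 * norm (y n * y n - y n) \<and>
        (\<forall>i<m. star (v i n) * u = 0) \<and> star u * u = (if r m = m then u else v (r m) n)"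
      using vQ
    proof eventually_elim
      case (elim n)
      have vy: "star (v i n) * y n = 0" if "i < m" for i
        using elim(2) that by (simp add: y_def right_diff_distrib flip: mult.assoc)
      obtain q where "q \<in> D n" "is_projection q" "\<And>u. u \<in> (\<lambda>i. v i n) ` {..<m} \<Longrightarrow> star u * q = 0"
        "norm (q - y n) \<le> 10 * norm (y n * y n - y n)"
        by (rule round_to_projection[OF D[of n] yD[of n] sy, where U = "(\<lambda>i. v i n) ` {..<m}"])
          (use vy elim(1) in auto)
      then show ?case using True by (intro bexI[of _ q]) (auto simp: is_projection_def)
    qed
    then show thesis by (rule choose[OF yl tendsto_mult_right_zero[OF el]])
  next
    case False
    define k where "k = r m"
    have k: "k < m" "r k = k" using False w.r_le[of m] w.r_r[of m] by (auto simp: k_def)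
    define y where "y n = x n * v k n - Q n * x n * v k n" for n
    have yD: "y n \<in> D n" for n
      using D(1)[of n] x(1) QD v(1)[OF k(1)] by (auto simp: y_def intro!: star_subalg_closed)
    have wk: "w m * w k = w m" "star (w m) * w m = w k"
      using w.w_rep[of m] w.star_w_w[of m m] by (auto simp: k_def)
    have "y \<longlonglongrightarrow> w m * w k - Q0 * w m * w k"
      unfolding y_def using v(2) k x by (intro tendsto_intros Qlim) auto
    then have yl: "y \<longlonglongrightarrow> w m" by (simp add: Q0 wk)
    have "(\<lambda>n. norm (v k n - star (y n) * y n)) \<longlonglongrightarrow> norm (w k - star (w m) * w m)"
      using v(2) k by (intro tendsto_intros yl) auto
    then have el: "(\<lambda>n. norm (v k n - star (y n) * y n)) \<longlonglongrightarrow> 0" by (simp add: wk)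
    then have "\<forall>\<^sub>F n in sequentially. norm (v k n - star (y n) * y n) < 1/4" by (rule order_tendstoD) simp
    then have "\<forall>\<^sub>F n in sequentially. \<exists>u\<in>D n. norm (u - y n) \<le> 2 * norm (v k n - star (y n) * y n) \<and>
        (\<forall>i<m. star (v i n) * u = 0) \<and> star u * u = (if r m = m then u else v (r m) n)"
      using vQ v(3)
    proof eventually_elim
      case (elim n)
      interpret v: isometry_system m "\<lambda>i. v i n" r using elim by blast
      have pk: "is_projection (v k n)" using v.rep_projection[OF k(1)] k by simp
      have vy: "star (v i n) * y n = 0" if "i < m" for i
        using elim(2) that by (simp add: y_def right_diff_distrib flip: mult.assoc)
      have yk: "y n * v k n = y n"
        using pk by (simp add: y_def left_diff_distrib mult.assoc is_projection_def)
      obtain u where "u \<in> D n" "star u * u = v k n" "\<And>z. z \<in> (\<lambda>i. v i n) ` {..<m} \<Longrightarrow> star z * u = 0"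
        "norm (u - y n) \<le> 2 * norm (v k n - star (y n) * y n)"
        by (rule round_to_isometry[OF D[of n] yD[of n] yk, where U = "(\<lambda>i. v i n) ` {..<m}"])
          (use vy pk elim(1) in auto)
      then show ?case using False by (intro bexI[of _ u]) (auto simp: k_def)
    qed
    then show thesis by (rule choose[OF yl tendsto_mult_right_zero[OF el]])
  qed
qed

lemma perturb_isometry_system:
  fixes w :: "nat \<Rightarrow> 'a::cstar_algebra" and D :: "nat \<Rightarrow> 'a set"
  assumes D: "\<And>n. star_subalg (D n)" "\<And>n. closed (D n)"
    and w: "isometry_system m w r"
    and x: "\<And>i n. i < m \<Longrightarrow> x i n \<in> D n" "\<And>i. i < m \<Longrightarrow> x i \<longlonglongrightarrow> w i"
  obtains v where "\<And>i n. i < m \<Longrightarrow> v i n \<in> D n" "\<And>i. i < m \<Longrightarrow> v i \<longlonglongrightarrow> w i"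
      "\<forall>\<^sub>F n in sequentially. isometry_system m (\<lambda>i. v i n) r"
proof -
  have "\<exists>v. (\<forall>i<m. (\<forall>n. v i n \<in> D n) \<and> v i \<longlonglongrightarrow> w i) \<and>
      (\<forall>\<^sub>F n in sequentially. isometry_system m (\<lambda>i. v i n) r)"
    using w x
  proof (induction m)
    case 0
    show ?case by (simp add: isometry_system_def)
  next
    case (Suc m)
    have wm: "isometry_system m w r" using Suc.prems(1) by (simp add: isometry_system_def)
    obtain v where v: "\<And>i n. i < m \<Longrightarrow> v i n \<in> D n" "\<And>i. i < m \<Longrightarrow> v i \<longlonglongrightarrow> w i"
      "\<forall>\<^sub>F n in sequentially. isometry_system m (\<lambda>i. v i n) r"
      using Suc.IH[OF wm Suc.prems(2,3)] by (metis less_SucI)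
    obtain u where u: "\<And>n. u n \<in> D n" "u \<longlonglongrightarrow> w m"
      "\<forall>\<^sub>F n in sequentially. (\<forall>i<m. star (v i n) * u n = 0) \<and>
       star (u n) * u n = (if r m = m then u n else v (r m) n)"
      using perturb_isometry_system_step[OF D Suc.prems(1) v, of "x m"] Suc.prems(2,3) by auto
    interpret w: isometry_system "Suc m" w r by (rule Suc.prems)
    let ?v = "v(m := u)"
    have "\<forall>\<^sub>F n in sequentially. isometry_system (Suc m) (\<lambda>i. ?v i n) r"
      using u(3) v(3)
    proof eventually_elim
      case (elim n)
      have "isometry_system m (\<lambda>i. ?v i n) r"
        using elim(2) by (auto simp: isometry_system_def intro: le_less_trans)
      then show ?case
        by (rule isometry_system_Suc) (use elim(1) w.r_le[of m] w.r_r[of m] in auto)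
    qed
    moreover have "\<forall>i<Suc m. (\<forall>n. ?v i n \<in> D n) \<and> ?v i \<longlonglongrightarrow> w i"
      using v u by (auto simp: less_Suc_eq)
    ultimately show ?case by blast
  qed
  then show thesis using that by blast
qed

section \<open>The operator norm on matrices\<close>

lemma mat_adjoint_carrier: "A \<in> carrier_mat n n \<Longrightarrow> mat_adjoint A \<in> carrier_mat n n"
  by (auto simp: mat_adjoint_def mat_of_rows_def)

lemma mat_adjoint_index:
  "A \<in> carrier_mat n n \<Longrightarrow> i < n \<Longrightarrow> j < n \<Longrightarrow> mat_adjoint A $$ (i, j) = cnj (A $$ (j, i))"
  by (auto simp: mat_adjoint_def mat_of_rows_def)

lemma mat_adjoint_adjoint: "A \<in> carrier_mat n n \<Longrightarrow> mat_adjoint (mat_adjoint A) = (A :: complex mat)"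
  using mat_adjoint_carrier[of A n] mat_adjoint_carrier[of "mat_adjoint A" n]
  by (intro eq_matI) (auto simp: mat_adjoint_index[where n=n])

lemma l2_norm_nonneg: "0 \<le> l2_norm v"
  by (simp add: l2_norm_def L2_set_nonneg)

lemma l2_norm_zero: "l2_norm (0\<^sub>v n) = 0"
  by (simp add: l2_norm_def L2_set_def)

lemma l2_norm_add:
  assumes "u \<in> carrier_vec n" "v \<in> carrier_vec n"
  shows "l2_norm (u + v) \<le> l2_norm u + l2_norm v"
proof -
  have "l2_norm (u + v) \<le> L2_set (\<lambda>i. cmod (vec_index u i) + cmod (vec_index v i)) {..<n}"
    unfolding l2_norm_def using assms by (auto intro!: L2_set_mono norm_triangle_ineq)
  also have "\<dots> \<le> l2_norm u + l2_norm v"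
    unfolding l2_norm_def using assms L2_set_triangle_ineq by auto
  finally show ?thesis .
qed

lemma l2_norm_smult: "l2_norm (c \<cdot>\<^sub>v v) = cmod c * l2_norm v"
  unfolding l2_norm_def by (subst L2_set_right_distrib) (auto simp: norm_mult intro!: L2_set_cong)

lemma l2_norm_mult_bound:
  assumes "A \<in> carrier_mat n n" "v \<in> carrier_vec n"
  shows "l2_norm (A *\<^sub>v v) \<le> (\<Sum>i<n. \<Sum>j<n. cmod (A $$ (i, j))) * l2_norm v"
proof -
  have "l2_norm (A *\<^sub>v v) \<le> (\<Sum>i<n. cmod (vec_index (A *\<^sub>v v) i))"
    unfolding l2_norm_def
    using assms L2_set_le_sum[of "{..<n}" "\<lambda>i. cmod (vec_index (A *\<^sub>v v) i)"] by simp
  also have "\<dots> \<le> (\<Sum>i<n. \<Sum>j<n. cmod (A $$ (i, j)) * l2_norm v)"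
  proof (rule sum_mono)
    fix i assume "i \<in> {..<n}"
    then have "vec_index (A *\<^sub>v v) i = (\<Sum>j<n. A $$ (i, j) * vec_index v j)"
      using assms by (auto simp: scalar_prod_def atLeast0LessThan intro!: sum.cong)
    also have "cmod \<dots> \<le> (\<Sum>j<n. cmod (A $$ (i, j)) * l2_norm v)"
      using assms by (intro sum_norm_le) (auto simp: norm_mult l2_norm_def intro!: mult_left_mono member_le_L2_set)
    finally show "cmod (vec_index (A *\<^sub>v v) i) \<le> (\<Sum>j<n. cmod (A $$ (i, j)) * l2_norm v)" .
  qed
  also have "\<dots> = (\<Sum>i<n. \<Sum>j<n. cmod (A $$ (i, j))) * l2_norm v" by (simp add: sum_distrib_right)
  finally show ?thesis .
qed

lemma operator_norm_upper:
  assumes A: "A \<in> carrier_mat n n" and v: "v \<in> carrier_vec n" "l2_norm v \<le> 1"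
  shows "l2_norm (A *\<^sub>v v) \<le> operator_norm n A"
  unfolding operator_norm_def
proof (rule cSUP_upper)
  let ?K = "\<Sum>i<n. \<Sum>j<n. cmod (A $$ (i, j))"
  have "l2_norm (A *\<^sub>v u) \<le> ?K" if "u \<in> carrier_vec n" "l2_norm u \<le> 1" for u
  proof -
    have "?K * l2_norm u \<le> ?K * 1" using that by (intro mult_left_mono) (auto intro!: sum_nonneg)
    then show ?thesis using l2_norm_mult_bound[OF A that(1)] by simp
  qed
  then show "bdd_above ((\<lambda>v. l2_norm (A *\<^sub>v v)) ` {v \<in> carrier_vec n. l2_norm v \<le> 1})"
    by (auto intro!: bdd_aboveI2)
qed (use v in auto)

lemma operator_norm_least:
  assumes "\<And>v. v \<in> carrier_vec n \<Longrightarrow> l2_norm v \<le> 1 \<Longrightarrow> l2_norm (A *\<^sub>v v) \<le> K"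
  shows "operator_norm n A \<le> K"
  unfolding operator_norm_def
proof (rule cSUP_least)
  have "0\<^sub>v n \<in> {v \<in> carrier_vec n. l2_norm v \<le> 1}" by (simp add: l2_norm_zero)
  then show "{v \<in> carrier_vec n. l2_norm v \<le> 1} \<noteq> {}" by blast
qed (use assms in auto)

lemma operator_norm_nonneg: "A \<in> carrier_mat n n \<Longrightarrow> 0 \<le> operator_norm n A"
  using operator_norm_upper[of A n "0\<^sub>v n"] l2_norm_nonneg[of "A *\<^sub>v 0\<^sub>v n"] by (simp add: l2_norm_zero)

lemma operator_norm_bound:
  assumes A: "A \<in> carrier_mat n n" and v: "v \<in> carrier_vec n"
  shows "l2_norm (A *\<^sub>v v) \<le> operator_norm n A * l2_norm v"
proof (cases "l2_norm v = 0")
  case True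
  then show ?thesis using l2_norm_mult_bound[OF A v] by simp
next
  case False
  define t where "t = l2_norm v"
  have t: "t > 0" using False l2_norm_nonneg[of v] by (simp add: t_def)
  have u: "complex_of_real (1/t) \<cdot>\<^sub>v v \<in> carrier_vec n" "l2_norm (complex_of_real (1/t) \<cdot>\<^sub>v v) \<le> 1"
    using v t by (auto simp: l2_norm_smult t_def norm_divide)
  have "A *\<^sub>v (complex_of_real (1/t) \<cdot>\<^sub>v v) = complex_of_real (1/t) \<cdot>\<^sub>v (A *\<^sub>v v)"
    using A v by (rule mult_mat_vec)
  then have "l2_norm (A *\<^sub>v (complex_of_real (1/t) \<cdot>\<^sub>v v)) = l2_norm (A *\<^sub>v v) / t"
    using t by (simp add: l2_norm_smult norm_divide)
  then show ?thesis using operator_norm_upper[OF A u] t by (simp add: field_simps t_def)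
qed

lemma operator_norm_add:
  assumes "A \<in> carrier_mat n n" "B \<in> carrier_mat n n"
  shows "operator_norm n (A + B) \<le> operator_norm n A + operator_norm n B"
proof (rule operator_norm_least)
  fix v :: "complex vec" assume v: "v \<in> carrier_vec n" "l2_norm v \<le> 1"
  have "(A + B) *\<^sub>v v = A *\<^sub>v v + B *\<^sub>v v" using assms v by (intro add_mult_distrib_mat_vec)
  then show "l2_norm ((A + B) *\<^sub>v v) \<le> operator_norm n A + operator_norm n B"
    using l2_norm_add[of "A *\<^sub>v v" n "B *\<^sub>v v"] operator_norm_upper[OF assms(1) v]
      operator_norm_upper[OF assms(2) v] assms v by auto
qed

lemma smult_mat_mult_vec:
  "A \<in> carrier_mat n n \<Longrightarrow> v \<in> carrier_vec n \<Longrightarrow> (c \<cdot>\<^sub>m A) *\<^sub>v v = c \<cdot>\<^sub>v (A *\<^sub>v (v :: complex vec))"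
  by (intro eq_vecI) auto

lemma operator_norm_smult:
  assumes A: "A \<in> carrier_mat n n"
  shows "operator_norm n (c \<cdot>\<^sub>m A) = cmod c * operator_norm n A"
proof -
  have le: "operator_norm n (c \<cdot>\<^sub>m B) \<le> cmod c * operator_norm n B" if B: "B \<in> carrier_mat n n" for c B
    by (rule operator_norm_least)
      (auto simp: smult_mat_mult_vec[OF B] l2_norm_smult intro!: mult_left_mono operator_norm_upper[OF B])
  show ?thesis
  proof (cases "c = 0")
    case True
    have "operator_norm n (c \<cdot>\<^sub>m A) \<ge> 0" using A by (intro operator_norm_nonneg) simp
    then show ?thesis using le[OF A, of c] True by simp
  next
    case False
    have "A = (1/c) \<cdot>\<^sub>m (c \<cdot>\<^sub>m A)" using A False by (intro eq_matI) auto
    then have "operator_norm n A \<le> cmod (1/c) * operator_norm n (c \<cdot>\<^sub>m A)"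
      using le[of "c \<cdot>\<^sub>m A" "1/c"] A by simp
    then have "cmod c * operator_norm n A \<le> operator_norm n (c \<cdot>\<^sub>m A)"
      using False by (simp add: norm_divide field_simps)
    then show ?thesis using le[OF A, of c] by simp
  qed
qed

lemma operator_norm_mult:
  assumes A: "A \<in> carrier_mat n n" and B: "B \<in> carrier_mat n n"
  shows "operator_norm n (A * B) \<le> operator_norm n A * operator_norm n B"
proof (rule operator_norm_least)
  fix v :: "complex vec" assume v: "v \<in> carrier_vec n" "l2_norm v \<le> 1"
  have "l2_norm (A * B *\<^sub>v v) = l2_norm (A *\<^sub>v (B *\<^sub>v v))" using A B v by simp
  also have "\<dots> \<le> operator_norm n A * l2_norm (B *\<^sub>v v)" using A B v by (intro operator_norm_bound) auto
  also have "\<dots> \<le> operator_norm n A * operator_norm n B"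
    using A B v by (intro mult_left_mono operator_norm_upper operator_norm_nonneg)
  finally show "l2_norm (A * B *\<^sub>v v) \<le> operator_norm n A * operator_norm n B" .
qed

lemma mat_index_le_operator_norm:
  assumes A: "A \<in> carrier_mat n n" and ij: "i < n" "j < n"
  shows "cmod (A $$ (i, j)) \<le> operator_norm n A"
proof -
  have u: "l2_norm (unit_vec n j) \<le> 1"
  proof -
    have "(\<Sum>i<n. (cmod (vec_index (unit_vec n j) i))\<^sup>2) = (\<Sum>i<n. if i = j then 1 else 0)"
      using ij by (intro sum.cong) auto
    then show ?thesis using ij by (simp add: l2_norm_def L2_set_def)
  qed
  have "Matrix.row A i \<bullet> unit_vec n j = A $$ (i, j)" using A ij by (subst scalar_prod_right_unit) auto
  then have "cmod (A $$ (i, j)) = cmod (vec_index (A *\<^sub>v unit_vec n j) i)" using A ij by simp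
  also have "\<dots> \<le> l2_norm (A *\<^sub>v unit_vec n j)"
    unfolding l2_norm_def using A ij by (intro member_le_L2_set) auto
  also have "\<dots> \<le> operator_norm n A" using A u by (intro operator_norm_upper) auto
  finally show ?thesis .
qed

lemma operator_norm_eq_0: "A \<in> carrier_mat n n \<Longrightarrow> operator_norm n A = 0 \<Longrightarrow> A = 0\<^sub>m n n"
  using mat_index_le_operator_norm[of A n] by (intro eq_matI) auto

lemma l2_norm_mult_square_le:
  assumes A: "A \<in> carrier_mat n n" and v: "v \<in> carrier_vec n"
  shows "(l2_norm (A *\<^sub>v v))\<^sup>2 \<le> l2_norm (mat_adjoint A *\<^sub>v (A *\<^sub>v v)) * l2_norm v"
proof -
  define u where "u = A *\<^sub>v v"
  have u: "u \<in> carrier_vec n" using A v by (simp add: u_def)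
  have ui: "vec_index u i = (\<Sum>j<n. A $$ (i, j) * vec_index v j)" if "i < n" for i
    using that A v by (auto simp: u_def scalar_prod_def atLeast0LessThan intro!: sum.cong)
  have au: "vec_index (mat_adjoint A *\<^sub>v u) j = (\<Sum>i<n. cnj (A $$ (i, j)) * vec_index u i)" if "j < n" for j
    using that u mat_adjoint_carrier[OF A]
    by (auto simp: scalar_prod_def atLeast0LessThan mat_adjoint_index[OF A] intro!: sum.cong)
  have "(l2_norm u)\<^sup>2 = (\<Sum>i<n. (cmod (vec_index u i))\<^sup>2)"
    using u by (simp add: l2_norm_def L2_set_def sum_nonneg)
  then have "complex_of_real ((l2_norm u)\<^sup>2) = (\<Sum>i<n. vec_index u i * cnj (vec_index u i))"
    by (simp only: of_real_sum complex_norm_square)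
  also have "\<dots> = (\<Sum>i<n. \<Sum>j<n. vec_index u i * (cnj (A $$ (i, j)) * cnj (vec_index v j)))"
    by (intro sum.cong refl) (simp add: ui[symmetric] sum_distrib_left[symmetric], simp add: ui)
  also have "\<dots> = (\<Sum>j<n. vec_index (mat_adjoint A *\<^sub>v u) j * cnj (vec_index v j))"
    by (subst sum.swap) (auto simp: au sum_distrib_left sum_distrib_right mult_ac intro!: sum.cong)
  finally have "(l2_norm u)\<^sup>2 = cmod (\<Sum>j<n. vec_index (mat_adjoint A *\<^sub>v u) j * cnj (vec_index v j))"
    by (metis norm_of_real abs_of_nonneg zero_le_power2)
  also have "\<dots> \<le> (\<Sum>j<n. \<bar>cmod (vec_index (mat_adjoint A *\<^sub>v u) j)\<bar> * \<bar>cmod (vec_index v j)\<bar>)"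
    by (intro sum_norm_le) (simp add: norm_mult)
  also have "\<dots> \<le> l2_norm (mat_adjoint A *\<^sub>v u) * l2_norm v"
  proof -
    have dims: "dim_vec (mat_adjoint A *\<^sub>v u) = n" "dim_vec v = n"
      using v mat_adjoint_carrier[OF A] by auto
    show ?thesis unfolding l2_norm_def dims by (rule L2_set_mult_ineq)
  qed
  finally show ?thesis by (simp add: u_def)
qed

lemma operator_norm_cstar:
  assumes A: "A \<in> carrier_mat n n"
  shows "operator_norm n (mat_adjoint A * A) = (operator_norm n A)\<^sup>2"
proof -
  have sq: "(operator_norm n B)\<^sup>2 \<le> operator_norm n (mat_adjoint B * B)" if B: "B \<in> carrier_mat n n" for B
  proof -
    have BB: "mat_adjoint B * B \<in> carrier_mat n n" by (rule mult_carrier_mat[OF mat_adjoint_carrier[OF B] B])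
    have "operator_norm n B \<le> sqrt (operator_norm n (mat_adjoint B * B))"
    proof (rule operator_norm_least)
      fix v :: "complex vec" assume v: "v \<in> carrier_vec n" "l2_norm v \<le> 1"
      have "(l2_norm (B *\<^sub>v v))\<^sup>2 \<le> l2_norm (mat_adjoint B * B *\<^sub>v v) * l2_norm v"
        using l2_norm_mult_square_le[OF B v(1)] B v mat_adjoint_carrier[OF B] by simp
      also have "\<dots> \<le> operator_norm n (mat_adjoint B * B) * 1"
        using v operator_norm_upper[OF BB v] operator_norm_nonneg[OF BB]
        by (intro mult_mono) (auto simp: l2_norm_nonneg)
      finally show "l2_norm (B *\<^sub>v v) \<le> sqrt (operator_norm n (mat_adjoint B * B))"
        by (simp add: real_le_rsqrt)
    qed
    then have "(operator_norm n B)\<^sup>2 \<le> (sqrt (operator_norm n (mat_adjoint B * B)))\<^sup>2"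
      using operator_norm_nonneg[OF B] by (intro power_mono)
    then show ?thesis using operator_norm_nonneg[OF BB] by simp
  qed
  have le: "operator_norm n B \<le> operator_norm n (mat_adjoint B)" if B: "B \<in> carrier_mat n n" for B
  proof (cases "operator_norm n B = 0")
    case False
    then have pos: "operator_norm n B > 0" using operator_norm_nonneg[OF B] by simp
    have "operator_norm n B * operator_norm n B \<le> operator_norm n (mat_adjoint B) * operator_norm n B"
      using sq[OF B] operator_norm_mult[OF mat_adjoint_carrier[OF B] B] by (simp add: power2_eq_square)
    then show ?thesis using pos by simp
  qed (use operator_norm_nonneg[OF mat_adjoint_carrier[OF B]] in simp)
  have "operator_norm n (mat_adjoint A) = operator_norm n A"
    using le[OF A] le[OF mat_adjoint_carrier[OF A]] mat_adjoint_adjoint[OF A] by simp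
  then have "operator_norm n (mat_adjoint A * A) \<le> (operator_norm n A)\<^sup>2"
    using operator_norm_mult[OF mat_adjoint_carrier[OF A] A] by (simp add: power2_eq_square)
  then show ?thesis using sq[OF A] by simp
qed

section \<open>Generated C*-algebras\<close>

text \<open>The properties shared by a type of class \<^class>\<open>cstar_algebra\<close> and by the algebra of matrices.\<close>

locale cstar_record =
  fixes D :: "'d normed_star_algebra"
  assumes carrier: "cstar_subalgebra D (Carrier D)"
    and Norm_nonneg: "a \<in> Carrier D \<Longrightarrow> 0 \<le> Norm D a"
    and Norm_Plus: "a \<in> Carrier D \<Longrightarrow> b \<in> Carrier D \<Longrightarrow> Norm D (Plus D a b) \<le> Norm D a + Norm D b"
    and Norm_Scale: "a \<in> Carrier D \<Longrightarrow> Norm D (Scale D c a) = cmod c * Norm D a"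
    and Norm_Times: "a \<in> Carrier D \<Longrightarrow> b \<in> Carrier D \<Longrightarrow> Norm D (Times D a b) \<le> Norm D a * Norm D b"
    and Norm_cstar: "a \<in> Carrier D \<Longrightarrow> Norm D (Times D (Star D a) a) = (Norm D a)\<^sup>2"
    and Norm_eq_0: "a \<in> Carrier D \<Longrightarrow> Norm D a = 0 \<Longrightarrow> a = Zero D"
begin

lemma generated_cstar_cstar: "B \<subseteq> Carrier D \<Longrightarrow> cstar_subalgebra D (generated_cstar D B)"
proof -
  assume B: "B \<subseteq> Carrier D"
  have sub: "generated_cstar D B \<subseteq> Carrier D" using B carrier by (auto simp: generated_cstar_def)
  have cl: "x \<in> generated_cstar D B" if x: "x \<in> Carrier D" "\<forall>\<epsilon>>0. \<exists>y\<in>generated_cstar D B. Dist D x y < \<epsilon>" for x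
    unfolding generated_cstar_def
  proof (rule InterI, clarify)
    fix C assume C: "cstar_subalgebra D C" "B \<subseteq> C"
    then have "generated_cstar D B \<subseteq> C" by (auto simp: generated_cstar_def)
    then have "\<forall>\<epsilon>>0. \<exists>y\<in>C. Dist D x y < \<epsilon>" using x(2) by (meson subsetD)
    then show "x \<in> C" using C(1) x(1) by (auto simp: cstar_subalgebra_def norm_closed_def)
  qed
  moreover have "subalgebra_of D (generated_cstar D B)" "\<forall>x\<in>generated_cstar D B. Star D x \<in> generated_cstar D B"
    using sub by (auto simp: subalgebra_of_def) (auto simp: generated_cstar_def cstar_subalgebra_def subalgebra_of_def)
  ultimately show ?thesis
    unfolding cstar_subalgebra_def norm_closed_def by blast
qed

lemma cstar_subalgebra_sub: "cstar_subalgebra D C \<Longrightarrow> C \<subseteq> Carrier D"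
  by (simp add: cstar_subalgebra_def subalgebra_of_def)

end

lemma generated_cstar_base: "B \<subseteq> generated_cstar D B"
  by (auto simp: generated_cstar_def)

lemma generated_cstar_minimal: "cstar_subalgebra D C \<Longrightarrow> B \<subseteq> C \<Longrightarrow> generated_cstar D B \<subseteq> C"
  by (auto simp: generated_cstar_def)

lemma generated_cstar_eq: "cstar_subalgebra D C \<Longrightarrow> generated_cstar D C = C"
  using generated_cstar_minimal[of D C C] generated_cstar_base[of C D] by blast

lemma type_algebra_sel [simp]:
  "Carrier type_algebra = UNIV" "Zero type_algebra = 0" "Plus type_algebra = (+)" "Times type_algebra = (*)"
  "Scale type_algebra = scaleC" "Star type_algebra = star" "Norm type_algebra = norm"
  by (simp_all add: type_algebra_def)

lemma matrix_algebra_sel [simp]: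
  "Carrier (matrix_algebra n) = carrier_mat n n" "Zero (matrix_algebra n) = 0\<^sub>m n n"
  "Plus (matrix_algebra n) = (+)" "Times (matrix_algebra n) = (*)" "Scale (matrix_algebra n) = (\<cdot>\<^sub>m)"
  "Star (matrix_algebra n) = mat_adjoint" "Norm (matrix_algebra n) = operator_norm n"
  by (simp_all add: matrix_algebra_def)

lemma Dist_type_algebra [simp]: "Dist type_algebra x y = dist x y"
  by (simp add: Dist_def dist_norm)

lemma norm_closed_type_algebra: "norm_closed type_algebra X \<longleftrightarrow> closed X"
proof -
  have "(\<forall>\<epsilon>>0. \<exists>y\<in>X. dist x y < \<epsilon>) \<longleftrightarrow> x \<in> closure X" for x
    by (simp add: closure_approachable dist_commute)
  then show ?thesis unfolding norm_closed_def using closure_subset_eq by auto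
qed

lemma cstar_subalgebra_type_algebra:
  "cstar_subalgebra type_algebra E \<longleftrightarrow> star_subalg E \<and> closed E"
  by (auto simp: cstar_subalgebra_def subalgebra_of_def star_subalg_def norm_closed_type_algebra)

interpretation type_algebra: cstar_record type_algebra
  by unfold_locales (auto simp: cstar_subalgebra_type_algebra star_subalg_def norm_triangle_ineq
      norm_scaleC norm_mult_ineq cstar_identity)

interpretation matrix_algebra: cstar_record "matrix_algebra n" for n
proof
  show "cstar_subalgebra (matrix_algebra n) (Carrier (matrix_algebra n))"
    by (auto simp: cstar_subalgebra_def subalgebra_of_def norm_closed_def mat_adjoint_carrier)
qed (auto simp: operator_norm_nonneg operator_norm_add operator_norm_smult operator_norm_mult
    operator_norm_cstar operator_norm_eq_0)

lemma subalgebra_of_Carrier: "subalgebra_of D X \<Longrightarrow> X \<subseteq> Carrier D"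
  by (simp add: subalgebra_of_def)

section \<open>*-homomorphisms of finite-dimensional *-algebras are contractive\<close>

lemma star_homD:
  assumes "star_hom D X E Y f"
  shows "x \<in> X \<Longrightarrow> f x \<in> Y"
    and "x \<in> X \<Longrightarrow> y \<in> X \<Longrightarrow> f (Plus D x y) = Plus E (f x) (f y)"
    and "x \<in> X \<Longrightarrow> y \<in> X \<Longrightarrow> f (Times D x y) = Times E (f x) (f y)"
    and "x \<in> X \<Longrightarrow> f (Scale D c x) = Scale E c (f x)"
    and "x \<in> X \<Longrightarrow> f (Star D x) = Star E (f x)"
  using assms by (auto simp: star_hom_def algebra_hom_def)

lemma star_hom_codomain: "star_hom D X E Y f \<Longrightarrow> f ` X \<subseteq> Z \<Longrightarrow> star_hom D X E Z f"
  by (auto simp: star_hom_def algebra_hom_def)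

lemma star_hom_comp: "star_hom D X E Y f \<Longrightarrow> star_hom E Y G Z g \<Longrightarrow> star_hom D X G Z (g \<circ> f)"
  by (auto simp: star_hom_def algebra_hom_def image_subset_iff)

lemma star_hom_inverse:
  assumes f: "star_hom D X E Y f" "inj_on f X" and X: "cstar_subalgebra D X"
  shows "star_hom E (f ` X) D X (inv_into X f)"
proof -
  have inv: "inv_into X f (f x) = x" if "x \<in> X" for x using f(2) that by simp
  have cl: "Plus D x y \<in> X" "Times D x y \<in> X" "Scale D c x \<in> X" "Star D x \<in> X"
    if "x \<in> X" "y \<in> X" for x y c using X that by (auto simp: cstar_subalgebra_def subalgebra_of_def)
  have
    "inv_into X f (Plus E (f x) (f y)) = Plus D x y" "inv_into X f (Times E (f x) (f y)) = Times D x y"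
    "inv_into X f (Scale E c (f x)) = Scale D c x" "inv_into X f (Star E (f x)) = Star D x"
    if "x \<in> X" "y \<in> X" for x y c
    using that cl inv star_homD[OF f(1)] by metis+
  then show ?thesis
    unfolding star_hom_def algebra_hom_def by (auto simp: inv)
qed

text \<open>
  Iterating \<open>x \<mapsto> star x * x\<close> squares both norms each time, so that a constant comparing two
  C*-norms disappears in the limit.
\<close>

lemma cstar_norm_le:
  fixes s :: "'x \<Rightarrow> 'x" and N1 N2 :: "'x \<Rightarrow> real"
  assumes X: "\<And>x. x \<in> X \<Longrightarrow> s x \<in> X"
    and N: "\<And>x. x \<in> X \<Longrightarrow> N1 (s x) = (N1 x)\<^sup>2" "\<And>x. x \<in> X \<Longrightarrow> N2 (s x) = (N2 x)\<^sup>2"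
    and nonneg: "\<And>x. x \<in> X \<Longrightarrow> 0 \<le> N1 x"
    and bound: "\<And>x. x \<in> X \<Longrightarrow> N2 x \<le> C * N1 x" and x: "x \<in> X"
  shows "N2 x \<le> N1 x"
proof (rule ccontr)
  assume "\<not> N2 x \<le> N1 x"
  then have lt: "N1 x < N2 x" by simp
  have it: "(s ^^ k) x \<in> X \<and> N1 ((s ^^ k) x) = N1 x ^ (2 ^ k) \<and> N2 ((s ^^ k) x) = N2 x ^ (2 ^ k)" for k
    by (induction k) (use x X N in \<open>auto simp: power_mult[symmetric] mult.commute\<close>)
  have le: "N2 x ^ (2 ^ k) \<le> C * N1 x ^ (2 ^ k)" for k using it[of k] bound[of "(s ^^ k) x"] by auto
  show False
  proof (cases "N1 x = 0")
    case True
    then show False using le[of 0] lt by simp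
  next
    case False
    then have pos: "N1 x > 0" using nonneg[OF x] by simp
    define q where "q = N2 x / N1 x"
    have q: "q > 1" using lt pos by (simp add: q_def)
    then obtain k where k: "C < q ^ k" using real_arch_pow by blast
    also have "q ^ k \<le> q ^ (2 ^ k)" using q by (intro power_increasing) auto
    also have "\<dots> \<le> C" using le[of k] pos by (simp add: q_def power_divide field_simps)
    finally show False by simp
  qed
qed

text \<open>
  By \<open>cstar_norm_le\<close> it is enough to bound \<open>Norm D (g x)\<close> by a multiple of \<open>norm x\<close>, which the coordinates
  do, and for injective \<open>g\<close> conversely. In the converse the entries of \<open>x\<close> are bounded by
  \<open>Norm D (g x)\<close>, since \<open>g\<close> respects the equation \<open>star (w i) * x * w j = coef i j x *\<^sub>C w (r i)\<close>.
\<close>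

context matrix_units
begin

lemma star_hom_contractive:
  assumes D: "cstar_record D" and g: "star_hom type_algebra E D (Carrier D) g" and x: "x \<in> E"
  shows "Norm D (g x) \<le> norm x"
proof -
  interpret D: cstar_record D by fact
  note gD = star_homD[OF g, simplified]
  let ?N = "\<lambda>x. Norm D (g x)"
  define C where "C = (\<Sum>i<m. \<Sum>j<m. ?N (w i * star (w j)))"
  have wE: "w i * star (w j) \<in> E" if "i < m" "j < m" for i j
    using subalg w_in that by (auto intro!: star_subalg_closed)
  have "?N y \<le> C * norm y" if y: "y \<in> E" for y
  proof -
    have "?N y \<le> (\<Sum>i<m. \<Sum>j<m. cmod (coef i j y) * ?N (w i * star (w j)))"
      by (rule norm_sum_coef_le[OF y]) (auto simp: gD D.Norm_Plus D.Norm_Scale)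
    also have "\<dots> \<le> (\<Sum>i<m. \<Sum>j<m. norm y * ?N (w i * star (w j)))"
      using coef_bound[OF _ _ y] wE gD(1) D.Norm_nonneg by (intro sum_mono mult_right_mono) auto
    also have "\<dots> = C * norm y" by (simp add: C_def sum_distrib_left sum_distrib_right mult.commute)
    finally show ?thesis .
  qed
  then show ?thesis
    using cstar_norm_le[of E "\<lambda>x. star x * x" norm ?N C x] x subalg
    by (simp add: star_subalg_closed cstar_identity gD D.Norm_cstar)
qed

lemma star_hom_isometric:
  assumes D: "cstar_record D" and g: "star_hom type_algebra E D (Carrier D) g" "inj_on g E" and x: "x \<in> E"
  shows "Norm D (g x) = norm x"
proof (rule antisym)
  show "Norm D (g x) \<le> norm x" by (rule star_hom_contractive[OF D g(1) x])
  interpret D: cstar_record D by fact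
  note gD = star_homD[OF g(1), simplified]
  let ?N = "\<lambda>x. Norm D (g x)"
  have z: "0 \<in> E" using subalg by (rule star_subalg_zero)
  have "?N 0 = 0" using gD(4)[OF z, of 0] D.Norm_Scale[OF gD(1)[OF z], of 0] by simp
  then have g0: "g 0 = Zero D" using D.Norm_eq_0 gD(1)[OF z] by blast
  have nz: "?N (w (r i)) > 0" if i: "i < m" for i
  proof -
    have e: "w (r i) \<in> E" using w_in r_less[OF i] by blast
    have "?N (w (r i)) \<noteq> 0"
      using D.Norm_eq_0[OF gD(1)[OF e]] g0 rep_nonzero[OF i] inj_onD[OF g(2) _ e z] by metis
    then show ?thesis using D.Norm_nonneg[OF gD(1)[OF e]] by simp
  qed
  define L where "L i j = ?N (star (w i)) * ?N (w j) / ?N (w (r i))" for i j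
  define C where "C = (\<Sum>i<m. \<Sum>j<m. L i j * norm (w i * star (w j)))"
  have cb: "cmod (coef i j y) \<le> L i j * ?N y" if ij: "i < m" "j < m" and y: "y \<in> E" for i j y
  proof -
    have E: "w (r i) \<in> E" "w j \<in> E" "star (w i) \<in> E" "star (w i) * y \<in> E"
      using w_in r_less ij y subalg by (auto simp: star_subalg_closed)
    have "cmod (coef i j y) * ?N (w (r i)) = ?N (star (w i) * y * w j)"
      using E by (simp add: coef_eq[OF ij y] gD D.Norm_Scale)
    also have "\<dots> \<le> ?N (star (w i) * y) * ?N (w j)"
      unfolding gD(3)[OF E(4,2)] using E by (intro D.Norm_Times gD)
    also have "\<dots> \<le> ?N (star (w i)) * ?N y * ?N (w j)"
      unfolding gD(3)[OF E(3) y] using E y by (intro mult_right_mono D.Norm_Times gD D.Norm_nonneg)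
    finally show ?thesis using nz[OF ij(1)] by (simp add: L_def field_simps)
  qed
  have "norm y \<le> C * ?N y" if y: "y \<in> E" for y
  proof -
    have "norm y \<le> (\<Sum>i<m. \<Sum>j<m. cmod (coef i j y) * norm (w i * star (w j)))"
      by (rule norm_sum_coef_le[OF y]) (auto simp: norm_triangle_ineq norm_scaleC)
    also have "\<dots> \<le> (\<Sum>i<m. \<Sum>j<m. (L i j * ?N y) * norm (w i * star (w j)))"
      using cb y by (intro sum_mono mult_right_mono) auto
    also have "\<dots> = C * ?N y" by (simp add: C_def sum_distrib_left sum_distrib_right mult_ac)
    finally show ?thesis .
  qed
  then show "norm x \<le> Norm D (g x)"
    using cstar_norm_le[of E "\<lambda>x. star x * x" ?N norm C x] x subalg D.Norm_nonneg gD(1)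
    by (simp add: star_subalg_closed cstar_identity gD D.Norm_cstar)
qed

end

section \<open>*-algebras of matrices are finite-dimensional\<close>

text \<open>
  Gaussian elimination of one unknown for each equation.
\<close>

lemma underdetermined_system:
  fixes v :: "'k \<Rightarrow> 'j \<Rightarrow> real"
  assumes "finite J" "finite K" "card J < card K"
  obtains c where "\<exists>k\<in>K. c k \<noteq> 0" "\<And>j. j \<in> J \<Longrightarrow> (\<Sum>k\<in>K. c k * v k j) = 0"
proof -
  have "\<exists>c. (\<exists>k\<in>K. c k \<noteq> 0) \<and> (\<forall>j\<in>J. (\<Sum>k\<in>K. c k * v k j) = 0)"
    using assms
  proof (induction J arbitrary: K v rule: finite_induct)
    case empty
    then have "K \<noteq> {}" by auto
    then show ?case by (intro exI[of _ "\<lambda>_. 1"]) auto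
  next
    case (insert j J)
    show ?case
    proof (cases "\<forall>k\<in>K. v k j = 0")
      case True
      obtain c where "\<exists>k\<in>K. c k \<noteq> 0" "\<forall>j\<in>J. (\<Sum>k\<in>K. c k * v k j) = 0"
        using insert.IH[of K v] insert.prems insert.hyps by auto
      then show ?thesis using True by (intro exI[of _ c]) auto
    next
      case False
      then obtain k0 where k0: "k0 \<in> K" "v k0 j \<noteq> 0" by blast
      let ?K = "K - {k0}"
      have "finite ?K" "card J < card ?K" using insert.prems insert.hyps k0 by auto
      then obtain c where c: "\<exists>k\<in>?K. c k \<noteq> 0"
        "\<forall>i\<in>J. (\<Sum>k\<in>?K. c k * (v k i - v k j / v k0 j * v k0 i)) = 0"
        using insert.IH[of ?K "\<lambda>k i. v k i - v k j / v k0 j * v k0 i"] by blast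
      define t where "t = - (\<Sum>k\<in>?K. c k * v k j / v k0 j)"
      define c' where "c' = c(k0 := t)"
      have sum: "(\<Sum>k\<in>K. c' k * v k i) = t * v k0 i + (\<Sum>k\<in>?K. c k * v k i)" for i
        using insert.prems(1) k0(1) by (simp add: sum.remove[of K k0] c'_def)
      have "(\<Sum>k\<in>K. c' k * v k i) = 0" if "i \<in> J" for i
      proof -
        have "0 = (\<Sum>k\<in>?K. c k * v k i) - (\<Sum>k\<in>?K. c k * v k j / v k0 j) * v k0 i"
          using c(2)[rule_format, OF that] by (simp add: right_diff_distrib sum_subtractf sum_distrib_right mult.assoc)
        then show ?thesis by (simp add: sum t_def)
      qed
      moreover have "(\<Sum>k\<in>K. c' k * v k j) = 0"
        using k0(2) by (simp add: sum t_def sum_divide_distrib[symmetric])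
      ultimately show ?thesis using c(1) by (intro exI[of _ c']) (auto simp: c'_def)
    qed
  qed
  then show thesis using that by blast
qed

text \<open>
  The real and imaginary parts of the entries give \<open>2 n\<^sup>2\<close> real coordinates, hence more than \<open>2 n\<^sup>2\<close>
  elements are linearly dependent.
\<close>

lemma finite_dim_matrix_image:
  assumes E: "star_subalg E" and g: "star_hom type_algebra E (matrix_algebra n) (carrier_mat n n) g" "inj_on g E"
  shows "finite_dim E"
proof -
  note gD = star_homD[OF g(1), simplified]
  let ?J = "{..<n} \<times> {..<n} \<times> (UNIV :: bool set)"
  let ?v = "\<lambda>x (i, j, b). (if b then Re else Im) (g x $$ (i, j))"
  have e: "g 0 = 0 \<cdot>\<^sub>m g 0" using gD(4)[OF star_subalg_zero[OF E], of 0] by simp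
  have g0: "g 0 = 0\<^sub>m n n"
    using gD(1)[OF star_subalg_zero[OF E]] by (subst e, intro eq_matI) auto
  have gs: "g (\<Sum>x\<in>I. c x *\<^sub>R x) $$ (i, j) = (\<Sum>x\<in>I. complex_of_real (c x) * g x $$ (i, j))"
    if ij: "i < n" "j < n" and I: "finite I" "I \<subseteq> E" for c I i j
    using I
  proof induction
    case empty
    then show ?case using ij by (simp add: g0)
  next
    case (insert x I)
    have xI: "x \<in> E" "I \<subseteq> E" "(\<Sum>x\<in>I. c x *\<^sub>R x) \<in> E" "c x *\<^sub>R x \<in> E"
      using insert.prems E by (auto intro!: star_subalg_closed)
    have "g (c x *\<^sub>R x) = complex_of_real (c x) \<cdot>\<^sub>m g x"
      using gD(4)[OF xI(1), of "complex_of_real (c x)"] by (simp add: scaleC_of_real)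
    then show ?case
      using insert xI ij gD(1)[OF xI(1)] gD(1)[OF xI(3)] gD(2)[OF xI(4,3)] by simp
  qed
  have small: "card I \<le> card ?J" if I: "finite I" "I \<subseteq> E" "independent I" for I
  proof (rule ccontr)
    assume "\<not> card I \<le> card ?J"
    then obtain c where c: "\<exists>x\<in>I. c x \<noteq> 0" "\<And>q. q \<in> ?J \<Longrightarrow> (\<Sum>x\<in>I. c x * ?v x q) = 0"
      using underdetermined_system[of ?J I ?v] I(1) by (auto simp: not_le)
    let ?y = "\<Sum>x\<in>I. c x *\<^sub>R x"
    have yE: "?y \<in> E" using I E by (auto intro!: star_subalg_closed)
    have "g ?y = 0\<^sub>m n n"
    proof (rule eq_matI)
      fix i j assume "i < dim_row (0\<^sub>m n n :: complex mat)" "j < dim_col (0\<^sub>m n n :: complex mat)"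
      then have ij: "i < n" "j < n" by auto
      have "(\<Sum>x\<in>I. complex_of_real (c x) * g x $$ (i, j)) = 0"
        using c(2)[of "(i, j, True)"] c(2)[of "(i, j, False)"] ij by (simp add: complex_eq_iff)
      then show "g ?y $$ (i, j) = 0\<^sub>m n n $$ (i, j)" using gs[OF ij I(1,2)] ij by simp
    qed (use gD(1)[OF yE] in auto)
    then have "?y = 0" using g0 inj_onD[OF g(2) _ yE star_subalg_zero[OF E]] by simp
    then show False using I(1,3) c(1) by (auto simp: dependent_finite)
  qed
  obtain B where B: "B \<subseteq> E" "independent B" "E \<subseteq> span B"
    using maximal_independent_subset by blast
  have "finite B"
  proof (rule ccontr)
    assume "infinite B"
    then obtain I where I: "I \<subseteq> B" "finite I" "card I = Suc (card ?J)" by (meson infinite_arbitrarily_large)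
    then have "independent I" using B(2) independent_mono by blast
    then show False using small[of I] I B(1) by auto
  qed
  then show ?thesis using B by (auto simp: finite_dim_def)
qed

section \<open>Generated C*-algebras of star extendible images\<close>

abbreviation cstar_gen :: "'a::cstar_algebra set \<Rightarrow> 'a set" where
  "cstar_gen \<equiv> generated_cstar type_algebra"

abbreviation type_star_hom :: "'a::cstar_algebra set \<Rightarrow> 'b::cstar_algebra set \<Rightarrow> ('a \<Rightarrow> 'b) \<Rightarrow> bool" where
  "type_star_hom X \<equiv> star_hom type_algebra X type_algebra"

context cstar_record
begin

lemma Scale_0: "a \<in> Carrier D \<Longrightarrow> Scale D 0 a = Zero D"
  using carrier Norm_Scale[of a 0] by (intro Norm_eq_0) (auto simp: cstar_subalgebra_def subalgebra_of_def)

lemma Zero_Carrier: "Zero D \<in> Carrier D"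
  using carrier by (simp add: cstar_subalgebra_def subalgebra_of_def)

end

lemma star_hom_zero:
  assumes "cstar_record D" "cstar_record E" "star_hom D X E (Carrier E) f" "X \<subseteq> Carrier D" "Zero D \<in> X"
  shows "f (Zero D) = Zero E"
proof -
  interpret D: cstar_record D by fact
  interpret E: cstar_record E by fact
  have "f (Zero D) = f (Scale D 0 (Zero D))" using D.Scale_0 D.Zero_Carrier by simp
  also have "\<dots> = Zero E" using star_homD(1,4)[OF assms(3)] assms(5) E.Scale_0 by simp
  finally show ?thesis .
qed

text \<open>
  This is the tool for comparing generated C*-algebras: to see that \<open>f\<close> maps the C*-algebra generated
  by \<open>B\<close> into \<open>Y\<close>, it suffices to look at \<open>B\<close>. Contractivity makes the preimage closed.
\<close>

lemma cstar_subalgebra_vimage: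
  assumes D: "cstar_record D" and E: "cstar_record E"
    and f: "star_hom D X E (Carrier E) f" and X: "cstar_subalgebra D X" and Y: "cstar_subalgebra E Y"
    and contr: "\<And>x. x \<in> X \<Longrightarrow> Norm E (f x) \<le> Norm D x"
  shows "cstar_subalgebra D {x \<in> X. f x \<in> Y}"
proof -
  interpret D: cstar_record D by fact
  interpret E: cstar_record E by fact
  note fh = star_homD[OF f]
  have XC: "X \<subseteq> Carrier D" using X by (simp add: cstar_subalgebra_def subalgebra_of_def)
  have X': "Zero D \<in> X" "\<And>x y. x \<in> X \<Longrightarrow> y \<in> X \<Longrightarrow> Plus D x y \<in> X"
    "\<And>x y. x \<in> X \<Longrightarrow> y \<in> X \<Longrightarrow> Times D x y \<in> X" "\<And>c x. x \<in> X \<Longrightarrow> Scale D c x \<in> X"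
    "\<And>x. x \<in> X \<Longrightarrow> Star D x \<in> X"
    using X by (auto simp: cstar_subalgebra_def subalgebra_of_def)
  have Y': "Zero E \<in> Y" "\<And>x y. x \<in> Y \<Longrightarrow> y \<in> Y \<Longrightarrow> Plus E x y \<in> Y"
    "\<And>x y. x \<in> Y \<Longrightarrow> y \<in> Y \<Longrightarrow> Times E x y \<in> Y" "\<And>c x. x \<in> Y \<Longrightarrow> Scale E c x \<in> Y"
    "\<And>x. x \<in> Y \<Longrightarrow> Star E x \<in> Y"
    using Y by (auto simp: cstar_subalgebra_def subalgebra_of_def)
  have z: "f (Zero D) = Zero E" by (rule star_hom_zero[OF D E f XC X'(1)])
  have cl: "x \<in> X \<and> f x \<in> Y"
    if x: "x \<in> Carrier D" "\<forall>\<epsilon>>0. \<exists>y\<in>{x \<in> X. f x \<in> Y}. Dist D x y < \<epsilon>" for x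
  proof
    have "\<forall>\<epsilon>>0. \<exists>y\<in>X. Dist D x y < \<epsilon>" using x(2) by blast
    then show xX: "x \<in> X" using X x(1) by (auto simp: cstar_subalgebra_def norm_closed_def)
    have "\<exists>y\<in>Y. Dist E (f x) y < \<epsilon>" if e: "\<epsilon> > 0" for \<epsilon>
    proof -
      obtain y where y: "y \<in> X" "f y \<in> Y" "Dist D x y < \<epsilon>" using x(2) e by blast
      have "Dist E (f x) (f y) = Norm E (f (Plus D x (Scale D (- 1) y)))"
        using xX y X' by (simp add: Dist_def fh)
      also have "\<dots> \<le> Dist D x y" unfolding Dist_def using xX y X' by (intro contr) auto
      finally show ?thesis using y by (intro bexI[of _ "f y"]) auto
    qed
    then show "f x \<in> Y" using Y fh(1)[OF xX] by (auto simp: cstar_subalgebra_def norm_closed_def)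
  qed
  show ?thesis
    unfolding cstar_subalgebra_def subalgebra_of_def norm_closed_def
  proof (intro conjI)
    show "\<forall>x\<in>Carrier D. (\<forall>\<epsilon>>0. \<exists>y\<in>{x \<in> X. f x \<in> Y}. Dist D x y < \<epsilon>) \<longrightarrow> x \<in> {x \<in> X. f x \<in> Y}"
      using cl by blast
  qed (use XC X' Y' z fh in auto)
qed

lemma star_subalg_image:
  assumes D: "cstar_record D" and f: "star_hom D C type_algebra UNIV f" and C: "cstar_subalgebra D C"
  shows "star_subalg (f ` C)"
proof -
  note fh = star_homD[OF f, simplified]
  have CC: "C \<subseteq> Carrier D" "Zero D \<in> C" using C by (auto simp: cstar_subalgebra_def subalgebra_of_def)
  have "f (Zero D) = 0"
    using star_hom_zero[OF D type_algebra.cstar_record_axioms _ CC] f by simp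
  then have "0 \<in> f ` C" using CC by (metis imageI)
  moreover have "Plus D x y \<in> C" "Times D x y \<in> C" "Scale D c x \<in> C" "Star D x \<in> C"
    if "x \<in> C" "y \<in> C" for x y c using C that by (auto simp: cstar_subalgebra_def subalgebra_of_def)
  ultimately show ?thesis
    unfolding star_subalg_def by (auto simp flip: fh)
qed

lemma gen_star_subalg:
  fixes X :: "'a::cstar_algebra set"
  shows "star_subalg (cstar_gen X)" "closed (cstar_gen X)"
  using type_algebra.generated_cstar_cstar[of X] by (auto simp: cstar_subalgebra_type_algebra)

text \<open>
  The image of the generated C*-algebra under the extension \<open>\<Phi>\<close> is finite-dimensional, hence closed,
  and \<open>\<Phi>\<close> is isometric; so this image is exactly the C*-algebra generated by \<open>\<phi> ` B\<close>, and the inverse of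
  \<open>\<Phi>\<close> is the required isomorphism.
\<close>

lemma embedding_image_iso:
  fixes A :: "'a::cstar_algebra set"
  assumes B: "subalgebra_of (matrix_algebra n) B"
    and \<phi>: "star_extendible_embedding (matrix_algebra n) B type_algebra A \<phi>"
  shows "\<phi> ` B \<subseteq> A" "subalgebra_of type_algebra (\<phi> ` B)"
    "star_extendibly_isomorphic type_algebra (\<phi> ` B) (matrix_algebra n) B"
proof -
  let ?C = "generated_cstar (matrix_algebra n) B" and ?G = "cstar_gen (\<phi> ` B)"
  have BC: "B \<subseteq> carrier_mat n n" using subalgebra_of_Carrier[OF B] by simp
  obtain \<Phi> where \<Phi>A: "star_hom (matrix_algebra n) ?C type_algebra (cstar_gen A) \<Phi>"
    and inj: "inj_on \<Phi> ?C" and ext: "\<And>b. b \<in> B \<Longrightarrow> \<phi> b = \<Phi> b" and hom: "algebra_hom (matrix_algebra n) B type_algebra A \<phi>"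
    using \<phi> by (auto simp: star_extendible_embedding_def)
  show "\<phi> ` B \<subseteq> A" using hom by (simp add: algebra_hom_def)
  have \<Phi>: "star_hom (matrix_algebra n) ?C type_algebra UNIV \<Phi>"
    using star_hom_codomain[OF \<Phi>A] by blast
  have C: "cstar_subalgebra (matrix_algebra n) ?C"
    using BC by (intro matrix_algebra.generated_cstar_cstar) simp
  have BinC: "B \<subseteq> ?C" by (rule generated_cstar_base)
  have im: "\<phi> ` B = \<Phi> ` B" using ext by auto
  show "subalgebra_of type_algebra (\<phi> ` B)"
  proof -
    have B': "0\<^sub>m n n \<in> B" "\<And>x y. x \<in> B \<Longrightarrow> y \<in> B \<Longrightarrow> x + y \<in> B"
      "\<And>x y. x \<in> B \<Longrightarrow> y \<in> B \<Longrightarrow> x * y \<in> B" "\<And>c x. x \<in> B \<Longrightarrow> c \<cdot>\<^sub>m x \<in> B"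
      using B by (auto simp: subalgebra_of_def)
    have "\<Phi> (0\<^sub>m n n) = 0"
      using star_hom_zero[OF matrix_algebra.cstar_record_axioms type_algebra.cstar_record_axioms, of n ?C \<Phi>]
        \<Phi> matrix_algebra.cstar_subalgebra_sub[OF C] B'(1) BinC by auto
    then have "0 \<in> \<Phi> ` B" using B'(1) by (metis imageI)
    then show ?thesis
      unfolding subalgebra_of_def im using B' BinC star_homD[OF \<Phi>]
      by (auto simp: subset_iff simp flip: star_homD(2-4)[OF \<Phi>, simplified])
  qed
  define E where "E = \<Phi> ` ?C"
  define g where "g = inv_into ?C \<Phi>"
  have E: "star_subalg E"
    unfolding E_def by (rule star_subalg_image[OF matrix_algebra.cstar_record_axioms \<Phi> C])
  have g: "star_hom type_algebra E (matrix_algebra n) ?C g"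
    unfolding g_def E_def by (rule star_hom_inverse[OF \<Phi> inj C])
  have gc: "star_hom type_algebra E (matrix_algebra n) (carrier_mat n n) g"
    using star_hom_codomain[OF g] star_homD(1)[OF g] matrix_algebra.cstar_subalgebra_sub[OF C] by auto
  have ginj: "inj_on g E" unfolding g_def E_def by (rule inj_on_inv_into) simp
  have "finite_dim E" by (rule finite_dim_matrix_image[OF E gc ginj])
  then obtain m w r where "matrix_units m w r E" using finite_dim_matrix_units[OF E] by blast
  then interpret matrix_units m w r E .
  have iso: "operator_norm n (g x) = norm x" if "x \<in> E" for x
    using star_hom_isometric[OF matrix_algebra.cstar_record_axioms _ ginj that, of n] gc by simp
  have "norm (\<Phi> c) = operator_norm n c" if "c \<in> ?C" for c
    using iso[of "\<Phi> c"] that inj by (simp add: E_def g_def)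
  then have "cstar_subalgebra (matrix_algebra n) {c \<in> ?C. \<Phi> c \<in> ?G}"
    using \<Phi> C type_algebra.generated_cstar_cstar[of "\<phi> ` B"]
    by (intro cstar_subalgebra_vimage[OF matrix_algebra.cstar_record_axioms type_algebra.cstar_record_axioms]) auto
  moreover have "B \<subseteq> {c \<in> ?C. \<Phi> c \<in> ?G}"
    using BinC generated_cstar_base[of "\<phi> ` B" type_algebra] ext by fastforce
  ultimately have "?C \<subseteq> {c \<in> ?C. \<Phi> c \<in> ?G}" by (rule generated_cstar_minimal)
  then have "E \<subseteq> ?G" by (auto simp: E_def)
  moreover have "?G \<subseteq> E"
  proof (rule generated_cstar_minimal)
    show "cstar_subalgebra type_algebra E" using E closed_E by (simp add: cstar_subalgebra_type_algebra)
    show "\<phi> ` B \<subseteq> E" using im BinC by (auto simp: E_def)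
  qed
  ultimately have EG: "?G = E" by simp
  have "bij_betw g E ?C" unfolding g_def E_def using inj by (simp add: bij_betw_inv_into inj_on_imp_bij_betw)
  moreover have "g ` \<phi> ` B = B"
    unfolding im g_def using inj BinC by (simp add: inv_into_image_cancel)
  ultimately show "star_extendibly_isomorphic type_algebra (\<phi> ` B) (matrix_algebra n) B"
    unfolding star_extendibly_isomorphic_def EG using g by blast
qed

lemma iso_embedding:
  fixes A X :: "'a::cstar_algebra set"
  assumes iso: "star_extendibly_isomorphic type_algebra X (matrix_algebra n) B" and XA: "X \<subseteq> A"
  obtains \<phi> where "star_extendible_embedding (matrix_algebra n) B type_algebra A \<phi>" "\<phi> ` B = X"
proof -
  let ?C = "generated_cstar (matrix_algebra n) B" and ?G = "cstar_gen X"
  obtain g where g: "star_hom type_algebra ?G (matrix_algebra n) ?C g" "bij_betw g ?G ?C" "g ` X = B"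
    using iso by (auto simp: star_extendibly_isomorphic_def)
  define \<phi> where "\<phi> = inv_into ?G g"
  have ginj: "inj_on g ?G" "g ` ?G = ?C" using g(2) by (auto simp: bij_betw_def)
  have h: "star_hom (matrix_algebra n) ?C type_algebra ?G \<phi>"
    unfolding \<phi>_def using star_hom_inverse[OF g(1) ginj(1) type_algebra.generated_cstar_cstar] ginj(2) by simp
  have X: "X \<subseteq> ?G" by (rule generated_cstar_base)
  have im: "\<phi> ` B = X" unfolding g(3)[symmetric] \<phi>_def using ginj(1) X by (simp add: inv_into_image_cancel)
  have GA: "?G \<subseteq> cstar_gen A"
    using XA by (auto simp: generated_cstar_def)
  have "algebra_hom (matrix_algebra n) B type_algebra A \<phi>"
    using h im XA generated_cstar_base[of B "matrix_algebra n"]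
    unfolding star_hom_def algebra_hom_def by (auto simp: subset_iff)
  moreover have "star_hom (matrix_algebra n) ?C type_algebra (cstar_gen A) \<phi>"
    using star_hom_codomain[OF h] star_homD(1)[OF h] GA by blast
  moreover have "inj_on \<phi> ?C" unfolding \<phi>_def using ginj by (metis inj_on_inv_into order_refl)
  ultimately have "star_extendible_embedding (matrix_algebra n) B type_algebra A \<phi>"
    unfolding star_extendible_embedding_def by blast
  then show thesis using im that by blast
qed

lemma iso_generated:
  fixes X :: "'a::cstar_algebra set"
  assumes "star_extendibly_isomorphic type_algebra X (matrix_algebra n) B"
    and B: "subalgebra_of (matrix_algebra n) B"
  obtains g m w r where "star_hom type_algebra (cstar_gen X) (matrix_algebra n)
      (generated_cstar (matrix_algebra n) B) g"
    "bij_betw g (cstar_gen X) (generated_cstar (matrix_algebra n) B)" "g ` X = B"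
    "star_hom type_algebra (cstar_gen X) (matrix_algebra n) (carrier_mat n n) g"
    "matrix_units m w r (cstar_gen X)"
    "\<And>x. x \<in> cstar_gen X \<Longrightarrow> operator_norm n (g x) = norm x"
proof -
  let ?C = "generated_cstar (matrix_algebra n) B" and ?G = "cstar_gen X"
  obtain g where g: "star_hom type_algebra ?G (matrix_algebra n) ?C g" "bij_betw g ?G ?C" "g ` X = B"
    using assms(1) by (auto simp: star_extendibly_isomorphic_def)
  have C: "cstar_subalgebra (matrix_algebra n) ?C"
    using subalgebra_of_Carrier[OF B] by (intro matrix_algebra.generated_cstar_cstar) simp
  have gc: "star_hom type_algebra ?G (matrix_algebra n) (carrier_mat n n) g"
    using star_hom_codomain[OF g(1)] star_homD(1)[OF g(1)] matrix_algebra.cstar_subalgebra_sub[OF C] by auto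
  have ginj: "inj_on g ?G" using g(2) by (rule bij_betw_imp_inj_on)
  have "finite_dim ?G" by (rule finite_dim_matrix_image[OF gen_star_subalg(1) gc ginj])
  then obtain m w r where mu: "matrix_units m w r ?G" using finite_dim_matrix_units[OF gen_star_subalg(1)] by blast
  then interpret matrix_units m w r ?G .
  have "operator_norm n (g x) = norm x" if "x \<in> ?G" for x
    using star_hom_isometric[OF matrix_algebra.cstar_record_axioms _ ginj that, of n] gc by simp
  then show thesis using that g gc mu by blast
qed

section \<open>Approximate containment is inherited by the generated C*-algebras\<close>

text \<open>
  The points that are asymptotically contained in \<open>D n\<close>. They form a C*-algebra if all \<open>D n\<close> do, so
  that asymptotic containment of an algebra implies that of the C*-algebra it generates.
\<close>

definition limit_set :: "(nat \<Rightarrow> 'a::cstar_algebra set) \<Rightarrow> 'a set" where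
  "limit_set D = {x. \<exists>y. (\<forall>n. y n \<in> D n) \<and> y \<longlonglongrightarrow> x}"

lemma limit_setI: "(\<And>n. y n \<in> D n) \<Longrightarrow> y \<longlonglongrightarrow> x \<Longrightarrow> x \<in> limit_set D"
  by (auto simp: limit_set_def)

lemma infdist_lessD:
  assumes "A \<noteq> {}" "infdist x A < e" shows "\<exists>y\<in>A. dist x y < e"
proof -
  have "bdd_below (dist x ` A)" by (intro bdd_belowI2[where m=0]) simp
  then show ?thesis using assms cINF_less_iff[of A "dist x" e] by (simp add: infdist_notempty)
qed

lemma limit_set_cstar:
  fixes D :: "nat \<Rightarrow> 'a::cstar_algebra set"
  assumes D: "\<And>n. star_subalg (D n)"
  shows "star_subalg (limit_set D)" "closed (limit_set D)"
proof -
  show "star_subalg (limit_set D)"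
    unfolding star_subalg_def
  proof (intro conjI ballI allI)
    show "0 \<in> limit_set D" using D by (intro limit_setI[of "\<lambda>_. 0"]) (auto simp: star_subalg_zero)
    fix x assume "x \<in> limit_set D"
    then obtain f where f: "\<And>n. f n \<in> D n" "f \<longlonglongrightarrow> x" by (auto simp: limit_set_def)
    show "star x \<in> limit_set D" using D f
      by (intro limit_setI[of "\<lambda>n. star (f n)"]) (auto simp: star_subalg_star intro: tendsto_intros)
    show "c *\<^sub>C x \<in> limit_set D" for c using D f
      by (intro limit_setI[of "\<lambda>n. c *\<^sub>C f n"]) (auto simp: star_subalg_scaleC intro: tendsto_intros)
    fix y assume "y \<in> limit_set D"
    then obtain g where g: "\<And>n. g n \<in> D n" "g \<longlonglongrightarrow> y" by (auto simp: limit_set_def)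
    show "x + y \<in> limit_set D" using D f g
      by (intro limit_setI[of "\<lambda>n. f n + g n"]) (auto simp: star_subalg_add intro: tendsto_intros)
    show "x * y \<in> limit_set D" using D f g
      by (intro limit_setI[of "\<lambda>n. f n * g n"]) (auto simp: star_subalg_mult intro: tendsto_intros)
  qed
  have ne: "D n \<noteq> {}" for n using D star_subalg_zero by blast
  have "closure (limit_set D) \<subseteq> limit_set D"
  proof
    fix x assume "x \<in> closure (limit_set D)"
    then have x: "\<forall>e>0. \<exists>y\<in>limit_set D. dist y x < e" by (simp add: closure_approachable)
    have lim: "(\<lambda>n. infdist x (D n)) \<longlonglongrightarrow> 0"
    proof (rule LIMSEQ_I)
      fix e :: real assume "e > 0"
      then obtain z where z: "z \<in> limit_set D" "dist z x < e/2" using x half_gt_zero by blast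
      then obtain f where f: "\<And>n. f n \<in> D n" "f \<longlonglongrightarrow> z" by (auto simp: limit_set_def)
      obtain N where N: "\<And>n. n \<ge> N \<Longrightarrow> dist (f n) z < e/2"
        using metric_LIMSEQ_D[OF f(2), of "e/2"] \<open>e > 0\<close> by auto
      have "norm (infdist x (D n) - 0) < e" if "n \<ge> N" for n
      proof -
        have "infdist x (D n) \<le> dist x (f n)" using f(1) by (rule infdist_le)
        also have "\<dots> < e" using N[OF that] z(2) dist_triangle2[of x "f n" z] by (simp add: dist_commute)
        finally show ?thesis by (simp add: infdist_nonneg)
      qed
      then show "\<exists>N. \<forall>n\<ge>N. norm (infdist x (D n) - 0) < e" by blast
    qed
    have "\<exists>y\<in>D n. dist x y < infdist x (D n) + inverse (real (Suc n))" for n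
      by (rule infdist_lessD[OF ne]) simp
    then obtain y where y: "\<And>n. y n \<in> D n" "\<And>n. dist x (y n) < infdist x (D n) + inverse (real (Suc n))"
      by metis
    have "(\<lambda>n. infdist x (D n) + inverse (real (Suc n))) \<longlonglongrightarrow> 0"
      using tendsto_add[OF lim LIMSEQ_inverse_real_of_nat] by simp
    then have "(\<lambda>n. dist (y n) x) \<longlonglongrightarrow> 0"
    proof (rule Lim_null_comparison[rotated])
      have "norm (dist (y n) x) \<le> infdist x (D n) + inverse (real (Suc n))" for n
        using y(2)[of n] by (simp add: dist_commute)
      then show "\<forall>\<^sub>F n in sequentially. norm (dist (y n) x) \<le> infdist x (D n) + inverse (real (Suc n))"
        by (rule always_eventually[OF allI])
    qed
    then have "y \<longlonglongrightarrow> x" by (rule iffD2[OF tendsto_dist_iff])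
    then show "x \<in> limit_set D" using y(1) by (intro limit_setI)
  qed
  then show "closed (limit_set D)" using closure_subset_eq by blast
qed

lemma (in matrix_units) nearby_star_homs:
  fixes D :: "nat \<Rightarrow> 'a set"
  assumes D: "\<And>n. star_subalg (D n)" "\<And>n. closed (D n)" and E: "E \<subseteq> limit_set D"
  obtains T e where "e \<longlonglongrightarrow> 0" "\<And>n. 0 \<le> (e n :: real)"
    "\<forall>\<^sub>F n in sequentially. type_star_hom E (D n) (T n) \<and>
      (\<forall>x\<in>E. norm (T n x - x) \<le> e n * norm x)"
proof -
  have "\<exists>x. (\<forall>n. x n \<in> D n) \<and> x \<longlonglongrightarrow> w i" if "i < m" for i
    using w_in[OF that] E by (auto simp: limit_set_def)
  then obtain x where x: "\<And>i n. i < m \<Longrightarrow> x i n \<in> D n" "\<And>i. i < m \<Longrightarrow> x i \<longlonglongrightarrow> w i" by metis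
  obtain v where v: "\<And>i n. i < m \<Longrightarrow> v i n \<in> D n" "\<And>i. i < m \<Longrightarrow> v i \<longlonglongrightarrow> w i"
      "\<forall>\<^sub>F n in sequentially. isometry_system m (\<lambda>i. v i n) r"
    using perturb_isometry_system[OF D isometry_system_axioms x] by blast
  define e where "e n = (\<Sum>i<m. \<Sum>j<m. norm (v i n * star (v j n) - w i * star (w j)))" for n
  have "e \<longlonglongrightarrow> (\<Sum>i<m. \<Sum>j<m. norm (w i * star (w j) - w i * star (w j)))"
    unfolding e_def using v(2) by (intro tendsto_intros) auto
  then have "e \<longlonglongrightarrow> 0" by simp
  moreover have "0 \<le> e n" for n unfolding e_def by (intro sum_nonneg norm_ge_zero)
  moreover have "\<forall>\<^sub>F n in sequentially. type_star_hom E (D n) (transfer (\<lambda>i. v i n)) \<and>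
      (\<forall>x\<in>E. norm (transfer (\<lambda>i. v i n) x - x) \<le> e n * norm x)"
    using v(3)
  proof eventually_elim
    case (elim n)
    have "transfer (\<lambda>i. v i n) x \<in> D n" for x using D(1) v(1) by (intro transfer_in) auto
    then show ?case
      using transfer_near[of _ "\<lambda>i. v i n"] transfer_mult[OF elim]
      by (auto simp: star_hom_def algebra_hom_def transfer_add transfer_scaleC transfer_star e_def)
  qed
  ultimately show thesis by (rule that)
qed

lemma finite_net:
  fixes T :: "'a::metric_space set"
  assumes "compact K" "T \<subseteq> K" "\<epsilon> > 0"
  obtains S where "finite S" "S \<subseteq> T" "\<And>x. x \<in> T \<Longrightarrow> \<exists>s\<in>S. dist x s < \<epsilon>"
proof -
  have "closure T \<subseteq> K" using assms by (simp add: closure_minimal compact_imp_closed)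
  then have c: "compact (closure T)"
    using compact_Int_closed[OF assms(1) closed_closure[of T]] by (simp add: Int_absorb1)
  have sub: "closure T \<subseteq> \<Union>((\<lambda>t. ball t \<epsilon>) ` T)"
    using assms(3) by (auto simp: closure_approachable)
  obtain S where S: "S \<subseteq> T" "finite S" "closure T \<subseteq> \<Union>((\<lambda>t. ball t \<epsilon>) ` S)"
    by (rule compactE_image[OF c _ sub]) auto
  have "\<exists>s\<in>S. dist x s < \<epsilon>" if "x \<in> T" for x
  proof -
    have "x \<in> \<Union>((\<lambda>t. ball t \<epsilon>) ` S)" using S(3) closure_subset[of T] \<open>x \<in> T\<close> by blast
    then obtain s where "s \<in> S" "dist s x < \<epsilon>" by auto
    then show ?thesis by (metis dist_commute)
  qed
  then show thesis using that S by blast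
qed

section \<open>One step of the construction\<close>

definition model :: "(nat \<times> complex mat set) set \<Rightarrow> 'a::cstar_algebra set \<Rightarrow> bool" where
  "model F X \<longleftrightarrow> subalgebra_of type_algebra X \<and>
     (\<exists>(n, B)\<in>F. star_extendibly_isomorphic type_algebra X (matrix_algebra n) B)"

text \<open>
  The local condition, in terms of subalgebras of \<open>A\<close> in place of embeddings.
\<close>

definition approximable :: "(nat \<times> complex mat set) set \<Rightarrow> 'a::cstar_algebra set \<Rightarrow> bool" where
  "approximable F A \<longleftrightarrow> (\<forall>\<epsilon>>0. \<forall>S. finite S \<and> S \<subseteq> A \<longrightarrow>
     (\<exists>X\<subseteq>A. model F X \<and> (\<forall>s\<in>S. infdist s X < \<epsilon>)))"

definition stability_bound ::
  "nat \<Rightarrow> complex mat set \<Rightarrow> nat \<Rightarrow> complex mat set \<Rightarrow> real \<Rightarrow> real \<Rightarrow> bool" where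
  "stability_bound n1 B1 n2 B2 \<epsilon> \<delta> \<longleftrightarrow> (\<forall>n>0. \<forall>\<phi>1 \<phi>2.
     star_extendible_embedding (matrix_algebra n1) B1 (matrix_algebra n) (carrier_mat n n) \<phi>1 \<and>
     star_extendible_embedding (matrix_algebra n2) B2 (matrix_algebra n) (carrier_mat n n) \<phi>2 \<and>
     approx_contained (matrix_algebra n) \<delta> (\<phi>1 ` B1) (\<phi>2 ` B2) \<longrightarrow>
     (\<exists>\<psi>. star_extendible_embedding (matrix_algebra n1) B1 (matrix_algebra n) (carrier_mat n n) \<psi> \<and>
        map_dist (matrix_algebra n1) B1 (matrix_algebra n) \<phi>1 \<psi> < \<epsilon> \<and> \<psi> ` B1 \<subseteq> \<phi>2 ` B2))"

lemma norm_normalize_le: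
  fixes x y :: "'a::real_normed_vector"
  assumes "norm x \<le> 1" "dist x y \<le> \<eta>" "0 \<le> \<eta>"
  shows "norm ((1 / (1 + \<eta>)) *\<^sub>R y) \<le> 1" "dist x ((1 / (1 + \<eta>)) *\<^sub>R y) \<le> 2 * \<eta>"
proof -
  have ny: "norm y \<le> 1 + \<eta>"
    using norm_triangle_sub[of y x] assms by (simp add: dist_norm norm_minus_commute)
  then show "norm ((1 / (1 + \<eta>)) *\<^sub>R y) \<le> 1" using assms by simp
  have "y - (1 / (1 + \<eta>)) *\<^sub>R y = (\<eta> / (1 + \<eta>)) *\<^sub>R y"
    using assms scaleR_left_diff_distrib[of 1 "1 / (1 + \<eta>)" y] by (simp add: field_simps)
  then have "dist y ((1 / (1 + \<eta>)) *\<^sub>R y) = \<eta> / (1 + \<eta>) * norm y"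
    using assms by (simp add: dist_norm)
  also have "\<dots> \<le> \<eta> / (1 + \<eta>) * (1 + \<eta>)" using ny assms by (intro mult_left_mono) auto
  also have "\<dots> = \<eta>" using assms by simp
  finally show "dist x ((1 / (1 + \<eta>)) *\<^sub>R y) \<le> 2 * \<eta>"
    using dist_triangle[of x "(1 / (1 + \<eta>)) *\<^sub>R y" y] assms(2) by simp
qed

text \<open>
  \<open>T\<close> is a *-homomorphism between the generated algebras near the inclusion, but need not map \<open>X\<close> into
  \<open>Y\<close>. Carried over to the matrix algebra that contains a copy of the algebra generated by \<open>Y\<close>, it
  provides the two embeddings to which stability applies. The resulting \<open>\<psi>\<close> takes values in the copy of
  \<open>Y\<close>, hence its extension takes values in the copy of the algebra generated by \<open>Y\<close> and can be
  carried back.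
\<close>

lemma stable_absorption:
  fixes X Y :: "'a::cstar_algebra set"
  assumes F: "matrix_algebra_family F" and B1: "(n1, B1) \<in> F" and B2: "(n2, B2) \<in> F"
    and X: "subalgebra_of type_algebra X" "star_extendibly_isomorphic type_algebra X (matrix_algebra n1) B1"
    and Y: "subalgebra_of type_algebra Y" "star_extendibly_isomorphic type_algebra Y (matrix_algebra n2) B2"
    and T: "type_star_hom (cstar_gen X) (cstar_gen Y) T"
      "\<And>x. x \<in> cstar_gen X \<Longrightarrow> norm (T x - x) \<le> t * norm x" "0 \<le> t" "t < 1" "t + 2 * \<eta> \<le> \<delta>"
    and near: "\<And>x. x \<in> X \<Longrightarrow> norm x \<le> 1 \<Longrightarrow> \<exists>y\<in>Y. dist x y \<le> \<eta>" and \<eta>: "0 \<le> \<eta>"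
    and stable: "stability_bound n1 B1 n2 B2 \<epsilon> \<delta>"
  obtains \<beta> where "type_star_hom (cstar_gen X) (cstar_gen Y) \<beta>"
    "inj_on \<beta> (cstar_gen X)" "\<beta> ` X \<subseteq> Y"
    "\<And>x. x \<in> X \<Longrightarrow> norm (\<beta> x - x) \<le> (\<epsilon> + t) * norm x"
proof -
  let ?E1 = "cstar_gen X" and ?E2 = "cstar_gen Y"
  let ?C1 = "generated_cstar (matrix_algebra n1) B1" and ?C2 = "generated_cstar (matrix_algebra n2) B2"
  have sB: "subalgebra_of (matrix_algebra n1) B1" "subalgebra_of (matrix_algebra n2) B2" "0 < n2"
    using F B1 B2 by (auto simp: matrix_algebra_family_def)
  obtain g1 m1 w1 r1 where g1: "star_hom type_algebra ?E1 (matrix_algebra n1) ?C1 g1" "bij_betw g1 ?E1 ?C1" "g1 ` X = B1"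
    "star_hom type_algebra ?E1 (matrix_algebra n1) (carrier_mat n1 n1) g1"
    and mu: "matrix_units m1 w1 r1 ?E1" and iso1: "\<And>x. x \<in> ?E1 \<Longrightarrow> operator_norm n1 (g1 x) = norm x"
    using iso_generated[OF X(2) sB(1)] by metis
  obtain g2 where g2: "star_hom type_algebra ?E2 (matrix_algebra n2) ?C2 g2" "bij_betw g2 ?E2 ?C2" "g2 ` Y = B2"
    "star_hom type_algebra ?E2 (matrix_algebra n2) (carrier_mat n2 n2) g2"
    and iso2: "\<And>x. x \<in> ?E2 \<Longrightarrow> operator_norm n2 (g2 x) = norm x"
    using iso_generated[OF Y(2) sB(2)] by metis
  interpret matrix_units m1 w1 r1 ?E1 by (rule mu)
  have XE: "X \<subseteq> ?E1" and YE: "Y \<subseteq> ?E2" by (rule generated_cstar_base)+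
  have BC: "B1 \<subseteq> ?C1" "B2 \<subseteq> ?C2" by (rule generated_cstar_base)+
  have E1: "cstar_subalgebra type_algebra ?E1" and E2: "cstar_subalgebra type_algebra ?E2"
    by (simp_all add: type_algebra.generated_cstar_cstar)
  have C1: "cstar_subalgebra (matrix_algebra n1) ?C1" and C2: "cstar_subalgebra (matrix_algebra n2) ?C2"
    using subalgebra_of_Carrier[OF sB(1)] subalgebra_of_Carrier[OF sB(2)]
    by (auto intro!: matrix_algebra.generated_cstar_cstar)
  have inj1: "inj_on g1 ?E1" and im1: "g1 ` ?E1 = ?C1" and inj2: "inj_on g2 ?E2" and im2: "g2 ` ?E2 = ?C2"
    using g1(2) g2(2) by (auto simp: bij_betw_def)
  define h1 where "h1 = inv_into ?E1 g1"
  define h2 where "h2 = inv_into ?E2 g2"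
  have h1: "star_hom (matrix_algebra n1) ?C1 type_algebra ?E1 h1"
    unfolding h1_def using star_hom_inverse[OF g1(1) inj1 E1] im1 by simp
  have h2: "star_hom (matrix_algebra n2) ?C2 type_algebra ?E2 h2"
    unfolding h2_def using star_hom_inverse[OF g2(1) inj2 E2] im2 by simp
  have hinj: "inj_on h1 ?C1" "inj_on h2 ?C2"
    unfolding h1_def h2_def using im1 im2 by (auto intro!: inj_on_inv_into)
  have h1g1: "h1 (g1 x) = x" if "x \<in> ?E1" for x using that inj1 by (simp add: h1_def)
  have g1h1: "g1 (h1 c) = c" if "c \<in> ?C1" for c using that im1 by (simp add: h1_def f_inv_into_f)
  have h2g2: "h2 (g2 x) = x" if "x \<in> ?E2" for x using that inj2 by (simp add: h2_def)
  have g2h2: "g2 (h2 c) = c" if "c \<in> ?C2" for c using that im2 by (simp add: h2_def f_inv_into_f)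
  note TE = star_homD[OF T(1), simplified]
  note g1E = star_homD[OF g1(4), simplified] and g2E = star_homD[OF g2(4), simplified]
  have E1s: "star_subalg ?E1" and E2s: "star_subalg ?E2" by (rule gen_star_subalg)+
  have Tinj: "inj_on T ?E1"
  proof (rule inj_onI)
    fix x y assume xy: "x \<in> ?E1" "y \<in> ?E1" "T x = T y"
    have d: "x - y \<in> ?E1" "- y \<in> ?E1" using xy E1s by (auto simp: star_subalg_closed)
    have "T (- y) = - T y" using TE(4)[OF xy(2), of "-1"] by simp
    then have "T (x - y) = 0" using TE(2)[OF xy(1) d(2)] xy(3) by simp
    then have "norm (x - y) \<le> t * norm (x - y)" using T(2)[OF d(1)] by (simp add: norm_minus_commute)
    then have "(1 - t) * norm (x - y) \<le> 0" by (simp add: left_diff_distrib)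
    then have "norm (x - y) \<le> 0" using T(4) by (simp add: mult_le_0_iff)
    then show "x = y" by simp
  qed
  have Tiso: "norm (T x) = norm x" if "x \<in> ?E1" for x
    using star_hom_isometric[OF type_algebra.cstar_record_axioms _ Tinj that] star_hom_codomain[OF T(1)] by simp
  define \<theta> where "\<theta> = (\<lambda>c. g2 (T (h1 c)))"
  have \<theta>: "star_hom (matrix_algebra n1) ?C1 (matrix_algebra n2) (carrier_mat n2 n2) \<theta>"
    using star_hom_comp[OF star_hom_comp[OF h1 T(1)] g2(4)] by (simp add: \<theta>_def comp_def)
  have genC: "generated_cstar (matrix_algebra n2) (carrier_mat n2 n2) = carrier_mat n2 n2"
    using generated_cstar_eq[OF matrix_algebra.carrier[of n2]] by simp
  have emb1: "star_extendible_embedding (matrix_algebra n1) B1 (matrix_algebra n2) (carrier_mat n2 n2) \<theta>"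
    unfolding star_extendible_embedding_def genC
  proof (intro conjI exI[of _ \<theta>])
    show "algebra_hom (matrix_algebra n1) B1 (matrix_algebra n2) (carrier_mat n2 n2) \<theta>"
      using \<theta> BC(1) unfolding star_hom_def algebra_hom_def by (auto simp: subset_iff)
    have "inj_on (g2 \<circ> T \<circ> h1) ?C1"
      using star_homD(1)[OF h1] TE(1)
      by (intro comp_inj_on hinj inj_on_subset[OF Tinj] inj_on_subset[OF inj2]) auto
    then show "inj_on \<theta> ?C1" by (simp add: \<theta>_def comp_def)
  qed (use \<theta> in auto)
  have emb2: "star_extendible_embedding (matrix_algebra n2) B2 (matrix_algebra n2) (carrier_mat n2 n2) (\<lambda>b. b)"
    unfolding star_extendible_embedding_def genC
    using subalgebra_of_Carrier[OF sB(2)] matrix_algebra.cstar_subalgebra_sub[OF C2]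
    by (intro conjI exI[of _ "\<lambda>b. b"]) (auto simp: star_hom_def algebra_hom_def)
  have dist2: "Dist (matrix_algebra n2) (g2 x) (g2 y) = norm (x - y)" if xy: "x \<in> ?E2" "y \<in> ?E2" for x y
  proof -
    have d: "x - y \<in> ?E2" "- y \<in> ?E2" using xy E2s by (auto simp: star_subalg_closed)
    have "g2 (x - y) = g2 x + (- 1) \<cdot>\<^sub>m g2 y"
      using g2E(2)[OF xy(1) d(2)] g2E(4)[OF xy(2), of "-1"] by simp
    then show ?thesis using iso2[OF d(1)] by (simp add: Dist_def)
  qed
  have "approx_contained (matrix_algebra n2) \<delta> (\<theta> ` B1) ((\<lambda>b. b) ` B2)"
    unfolding approx_contained_def
  proof (intro ballI impI)
    fix z assume "z \<in> \<theta> ` B1" and nz: "Norm (matrix_algebra n2) z \<le> 1"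
    then obtain x where x: "x \<in> X" "z = g2 (T x)" using g1(3) h1g1 XE by (auto simp: \<theta>_def)
    have xE: "x \<in> ?E1" "T x \<in> ?E2" using x XE TE(1) by auto
    have nx: "norm x \<le> 1" using nz x(2) iso2[OF xE(2)] Tiso[OF xE(1)] by simp
    obtain y where y: "y \<in> Y" "dist x y \<le> \<eta>" using near[OF x(1) nx] by blast
    define y' where "y' = (1 / (1 + \<eta>)) *\<^sub>R y"
    have y': "norm y' \<le> 1" "dist x y' \<le> 2 * \<eta>"
      using norm_normalize_le[OF nx y(2) \<eta>] by (simp_all add: y'_def)
    have "y' = complex_of_real (1 / (1 + \<eta>)) *\<^sub>C y" unfolding y'_def scaleC_of_real ..
    then have y'Y: "y' \<in> Y" using Y(1) y(1) by (simp add: subalgebra_of_def)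
    have "norm (T x - y') \<le> norm (T x - x) + norm (x - y')"
      using norm_triangle_ineq[of "T x - x" "x - y'"] by simp
    also have "norm (T x - x) \<le> t"
      using T(2)[OF xE(1)] mult_left_mono[OF nx T(3)] by simp
    also have "norm (x - y') \<le> 2 * \<eta>" using y'(2) by (simp add: dist_norm)
    finally have "norm (T x - y') \<le> \<delta>" using T(5) by simp
    then show "\<exists>y\<in>(\<lambda>b. b) ` B2. Norm (matrix_algebra n2) y \<le> 1 \<and> Dist (matrix_algebra n2) z y \<le> \<delta>"
      using y'Y YE xE x(2) y'(1) g2(3) iso2[of y'] dist2[of "T x" y']
      by (intro bexI[of _ "g2 y'"]) auto
  qed
  from stable[unfolded stability_bound_def, rule_format, OF sB(3) conjI[OF emb1 conjI[OF emb2 this]]] obtain \<psi> where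
    \<psi>: "star_extendible_embedding (matrix_algebra n1) B1 (matrix_algebra n2) (carrier_mat n2 n2) \<psi>"
    and dist: "map_dist (matrix_algebra n1) B1 (matrix_algebra n2) \<theta> \<psi> < \<epsilon>" and \<psi>B: "\<psi> ` B1 \<subseteq> B2"
    by auto
  obtain \<Psi> where \<Psi>: "star_hom (matrix_algebra n1) ?C1 (matrix_algebra n2) (carrier_mat n2 n2) \<Psi>"
    and \<Psi>inj: "inj_on \<Psi> ?C1" and ext: "\<And>b. b \<in> B1 \<Longrightarrow> \<psi> b = \<Psi> b"
    using \<psi> unfolding star_extendible_embedding_def genC by auto
  have \<Psi>contr: "operator_norm n2 (\<Psi> c) \<le> operator_norm n1 c" if c: "c \<in> ?C1" for c
  proof -
    have h: "h1 c \<in> ?E1" using star_homD(1)[OF h1 c] .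
    have "star_hom type_algebra ?E1 (matrix_algebra n2) (Carrier (matrix_algebra n2)) (\<Psi> \<circ> g1)"
      using star_hom_comp[OF g1(1) \<Psi>] by simp
    from star_hom_contractive[OF matrix_algebra.cstar_record_axioms this h]
    show ?thesis using iso1[OF h] g1h1[OF c] by simp
  qed
  have "cstar_subalgebra (matrix_algebra n1) {c \<in> ?C1. \<Psi> c \<in> ?C2}"
    using \<Psi> C1 C2 \<Psi>contr
    by (intro cstar_subalgebra_vimage[OF matrix_algebra.cstar_record_axioms matrix_algebra.cstar_record_axioms]) auto
  moreover have "B1 \<subseteq> {c \<in> ?C1. \<Psi> c \<in> ?C2}" using BC ext \<psi>B by fastforce
  ultimately have "?C1 \<subseteq> {c \<in> ?C1. \<Psi> c \<in> ?C2}" by (rule generated_cstar_minimal)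
  then have \<Psi>C: "star_hom (matrix_algebra n1) ?C1 (matrix_algebra n2) ?C2 \<Psi>"
    using star_hom_codomain[OF \<Psi>] by blast
  define \<beta> where "\<beta> = (\<lambda>x. h2 (\<Psi> (g1 x)))"
  have \<beta>: "type_star_hom ?E1 ?E2 \<beta>"
    using star_hom_comp[OF star_hom_comp[OF g1(1) \<Psi>C] h2] by (simp add: \<beta>_def comp_def)
  note \<beta>E = star_homD[OF \<beta>, simplified]
  have \<beta>inj: "inj_on \<beta> ?E1"
  proof -
    have "inj_on (h2 \<circ> \<Psi> \<circ> g1) ?E1"
      using im1 star_homD(1)[OF \<Psi>C]
      by (intro comp_inj_on inj1 inj_on_subset[OF \<Psi>inj] inj_on_subset[OF hinj(2)]) auto
    then show ?thesis by (simp add: \<beta>_def comp_def)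
  qed
  have \<beta>X: "\<beta> x \<in> Y" "g2 (\<beta> x) = \<psi> (g1 x)" if x: "x \<in> X" for x
  proof -
    have b: "g1 x \<in> B1" using x g1(3) by blast
    then have p: "\<psi> (g1 x) \<in> B2" using \<psi>B by blast
    then obtain y where y: "y \<in> Y" "g2 y = \<psi> (g1 x)" using g2(3) by auto
    then have "\<beta> x = y" using ext[OF b] h2g2[of y] YE by (auto simp: \<beta>_def)
    then show "\<beta> x \<in> Y" "g2 (\<beta> x) = \<psi> (g1 x)" using y by auto
  qed
  have ball: "norm (T x - \<beta> x) \<le> \<epsilon>" if x: "x \<in> X" "norm x \<le> 1" for x
  proof -
    have eq: "Dist (matrix_algebra n2) (\<theta> (g1 x)) (\<psi> (g1 x)) = norm (T x - \<beta> x)" if "x \<in> X" for x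
    proof -
      have "x \<in> ?E1" using that XE by blast
      then show ?thesis using dist2[of "T x" "\<beta> x"] TE(1) \<beta>E(1) \<beta>X(2)[OF that] h1g1
        by (simp add: \<theta>_def)
    qed
    have le2: "norm (T x - \<beta> x) \<le> 2" if "x \<in> ?E1" "norm x \<le> 1" for x
    proof -
      have "norm (\<beta> x) \<le> norm x"
        using star_hom_contractive[OF type_algebra.cstar_record_axioms _ that(1), of \<beta>]
          star_hom_codomain[OF \<beta> subset_UNIV] by simp
      then show ?thesis using norm_triangle_ineq4[of "T x" "\<beta> x"] Tiso[OF that(1)] that(2) by simp
    qed
    let ?S = "{b \<in> B1. Norm (matrix_algebra n1) b \<le> 1}"
    have repr: "\<exists>y\<in>X. b = g1 y \<and> norm y \<le> 1" if "b \<in> ?S" for b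
      using that g1(3) iso1 XE by (auto simp: subset_iff)
    have "bdd_above ((\<lambda>b. Dist (matrix_algebra n2) (\<theta> b) (\<psi> b)) ` ?S)"
    proof (rule bdd_aboveI2)
      fix b assume "b \<in> ?S"
      then obtain y where "y \<in> X" "b = g1 y" "norm y \<le> 1" using repr by blast
      then show "Dist (matrix_algebra n2) (\<theta> b) (\<psi> b) \<le> 2" using eq le2 XE by auto
    qed
    moreover have "g1 x \<in> ?S" using x g1(3) iso1 XE by (auto simp: subset_iff)
    ultimately have "Dist (matrix_algebra n2) (\<theta> (g1 x)) (\<psi> (g1 x)) \<le> map_dist (matrix_algebra n1) B1 (matrix_algebra n2) \<theta> \<psi>"
      unfolding map_dist_def by (rule cSUP_upper2) auto
    then show ?thesis using dist eq[OF x(1)] by simp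
  qed
  have scale: "norm (T x - \<beta> x) \<le> \<epsilon> * norm x" if x: "x \<in> X" for x
  proof (cases "x = 0")
    case True
    have z: "0 \<in> ?E1" using E1s by (rule star_subalg_zero)
    have "T 0 = 0" "\<beta> 0 = 0" using TE(4)[OF z, of 0] \<beta>E(4)[OF z, of 0] by simp_all
    then show ?thesis using True by simp
  next
    case False
    define c where "c = complex_of_real (1 / norm x)"
    have xE: "x \<in> ?E1" using x XE by blast
    have "c *\<^sub>C x \<in> X" using X(1) x by (simp add: subalgebra_of_def)
    moreover have "norm (c *\<^sub>C x) \<le> 1" using False by (simp add: norm_scaleC c_def norm_divide)
    ultimately have "norm (T (c *\<^sub>C x) - \<beta> (c *\<^sub>C x)) \<le> \<epsilon>" by (rule ball)
    then have "norm (c *\<^sub>C (T x - \<beta> x)) \<le> \<epsilon>" by (simp add: TE(4)[OF xE] \<beta>E(4)[OF xE] scaleC_diff_right)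
    then show ?thesis using False by (simp add: norm_scaleC c_def norm_divide field_simps)
  qed
  have "norm (\<beta> x - x) \<le> (\<epsilon> + t) * norm x" if x: "x \<in> X" for x
  proof -
    have "norm (\<beta> x - x) \<le> norm (T x - \<beta> x) + norm (T x - x)"
      using norm_triangle_ineq4[of "T x - x" "T x - \<beta> x"] by (simp add: add.commute)
    then show ?thesis using scale[OF x] T(2)[of x] x XE by (auto simp: distrib_right)
  qed
  then show thesis using that \<beta> \<beta>inj \<beta>X(1) by blast
qed

text \<open>
  Choose \<open>Y k\<close> that contains up to \<open>1 / (k + 1)\<close> a finite net of the unit ball of \<open>X\<close>, which is totally
  bounded. The algebra generated by \<open>X\<close> is then asymptotically contained in those generated by \<open>Y k\<close>, and
  some \<open>k\<close> satisfies the hypotheses of \<open>stable_absorption\<close>. The members of \<open>S\<close> are added to the net.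
\<close>

lemma next_algebra:
  fixes A X :: "'a::cstar_algebra set"
  assumes F: "stable_family F" and A: "approximable F A" and X: "model F X" "X \<subseteq> A"
    and \<epsilon>: "\<epsilon> > 0" and S: "finite S" "S \<subseteq> A"
  obtains Y \<beta> where "model F Y" "Y \<subseteq> A" "\<And>s. s \<in> S \<Longrightarrow> infdist s Y < \<epsilon>"
    "type_star_hom (cstar_gen X) (cstar_gen Y) \<beta>"
    "inj_on \<beta> (cstar_gen X)" "\<beta> ` X \<subseteq> Y"
    "\<And>x. x \<in> X \<Longrightarrow> norm (\<beta> x - x) \<le> \<epsilon> * norm x"
proof -
  let ?E = "cstar_gen X"
  note result = that
  have fam: "matrix_algebra_family F" using F by (simp add: stable_family_def)
  obtain n1 B1 where B1: "(n1, B1) \<in> F" and isoX: "star_extendibly_isomorphic type_algebra X (matrix_algebra n1) B1"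
    and Xs: "subalgebra_of type_algebra X"
    using X by (auto simp: model_def)
  have sB1: "subalgebra_of (matrix_algebra n1) B1" using fam B1 by (auto simp: matrix_algebra_family_def)
  have e2: "\<epsilon>/2 > 0" using \<epsilon> by simp
  have "\<exists>\<delta>>0. \<forall>(n2, B2)\<in>F. stability_bound n1 B1 n2 B2 (\<epsilon>/2) \<delta>"
    using bspec[OF mp[OF spec[OF conjunct2[OF F[unfolded stable_family_def]], of "\<epsilon>/2"] e2] B1]
    unfolding stability_bound_def by (simp only: prod.case)
  then obtain \<delta> where \<delta>: "\<delta> > 0" "\<And>n2 B2. (n2, B2) \<in> F \<Longrightarrow> stability_bound n1 B1 n2 B2 (\<epsilon>/2) \<delta>"
    by blast
  obtain m w r where "matrix_units m w r ?E" using iso_generated[OF isoX sB1] by metis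
  then interpret matrix_units m w r ?E .
  obtain K where K: "compact K" "{x \<in> ?E. norm x \<le> 1} \<subseteq> K" using unit_ball_in_compact by blast
  define T where "T = {x \<in> X. norm x \<le> 1}"
  have XE: "X \<subseteq> ?E" by (rule generated_cstar_base)
  then have TK: "T \<subseteq> K" using K(2) by (auto simp: T_def)
  define \<rho> where "\<rho> k = inverse (real (Suc k))" for k
  have \<rho>: "\<rho> k > 0" for k by (simp add: \<rho>_def)
  have \<rho>0: "\<rho> \<longlonglongrightarrow> 0" unfolding \<rho>_def by (rule LIMSEQ_inverse_real_of_nat)
  have "\<exists>Y\<subseteq>A. model F Y \<and> (\<forall>s\<in>S. infdist s Y < \<epsilon>) \<and> (\<forall>x\<in>T. infdist x Y < 2 * \<rho> k)" for k
  proof -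
    obtain N where N: "finite N" "N \<subseteq> T" "\<And>x. x \<in> T \<Longrightarrow> \<exists>s\<in>N. dist x s < \<rho> k"
      using finite_net[OF K(1) TK \<rho>] by blast
    have "finite (S \<union> N)" "S \<union> N \<subseteq> A" using S N X(2) by (auto simp: T_def)
    moreover have "min \<epsilon> (\<rho> k) > 0" using \<epsilon> \<rho> by simp
    ultimately obtain Y where Y: "Y \<subseteq> A" "model F Y" "\<forall>s\<in>S \<union> N. infdist s Y < min \<epsilon> (\<rho> k)"
      using A unfolding approximable_def by meson
    have "infdist x Y < 2 * \<rho> k" if "x \<in> T" for x
    proof -
      obtain s where s: "s \<in> N" "dist x s < \<rho> k" using N(3) \<open>x \<in> T\<close> by blast
      moreover have "infdist s Y < \<rho> k" using Y(3) s(1) by auto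
      ultimately show ?thesis using infdist_triangle[of x Y s] by linarith
    qed
    then show ?thesis using Y by auto
  qed
  then obtain Y where Y: "\<And>k. Y k \<subseteq> A" "\<And>k. model F (Y k)" "\<And>k s. s \<in> S \<Longrightarrow> infdist s (Y k) < \<epsilon>"
    "\<And>k x. x \<in> T \<Longrightarrow> infdist x (Y k) < 2 * \<rho> k"
    by metis
  have Y0: "0 \<in> Y k" for k using Y(2)[of k] by (simp add: model_def subalgebra_of_def)
  have near: "\<exists>y\<in>Y k. dist x y \<le> 2 * \<rho> k" if x: "x \<in> X" "norm x \<le> 1" for x k
  proof -
    have "infdist x (Y k) < 2 * \<rho> k" using Y(4) x by (simp add: T_def)
    then have "\<exists>y\<in>Y k. dist x y < 2 * \<rho> k"
      using Y0[of k] by (intro infdist_lessD) auto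
    then show ?thesis by (meson less_imp_le)
  qed
  define D where "D k = cstar_gen (Y k)" for k
  have YD: "Y k \<subseteq> D k" for k unfolding D_def by (rule generated_cstar_base)
  have D: "star_subalg (D k)" "closed (D k)" for k unfolding D_def by (rule gen_star_subalg)+
  have "x \<in> limit_set D" if x: "x \<in> X" for x
  proof (cases "x = 0")
    case True
    then show ?thesis using limit_set_cstar(1)[OF D(1)] by (simp add: star_subalg_zero)
  next
    case False
    define c where "c = complex_of_real (1 / norm x)"
    have cx: "c *\<^sub>C x \<in> X" "norm (c *\<^sub>C x) \<le> 1"
      using False X(1) x by (auto simp: norm_scaleC c_def norm_divide model_def subalgebra_of_def)
    obtain y where y: "\<And>k. y k \<in> Y k" "\<And>k. dist (c *\<^sub>C x) (y k) \<le> 2 * \<rho> k"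
      using near[OF cx] by metis
    have "(\<lambda>k. dist (y k) (c *\<^sub>C x)) \<longlonglongrightarrow> 0"
    proof (rule Lim_null_comparison)
      show "(\<lambda>k. 2 * \<rho> k) \<longlonglongrightarrow> 0" by (rule tendsto_mult_right_zero[OF \<rho>0])
      have "norm (dist (y k) (c *\<^sub>C x)) \<le> 2 * \<rho> k" for k using y(2)[of k] by (simp add: dist_commute)
      then show "\<forall>\<^sub>F k in sequentially. norm (dist (y k) (c *\<^sub>C x)) \<le> 2 * \<rho> k"
        by (rule always_eventually[OF allI])
    qed
    then have "y \<longlonglongrightarrow> c *\<^sub>C x" by (rule iffD2[OF tendsto_dist_iff])
    then have "c *\<^sub>C x \<in> limit_set D" using y(1) YD by (intro limit_setI) auto
    then have "complex_of_real (norm x) *\<^sub>C c *\<^sub>C x \<in> limit_set D"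
      using limit_set_cstar(1)[OF D(1)] by (rule star_subalg_scaleC[rotated])
    then show ?thesis using False by (simp add: scaleC_scaleC c_def)
  qed
  then have EL: "?E \<subseteq> limit_set D"
    using limit_set_cstar[OF D(1)] by (intro generated_cstar_minimal) (auto simp: cstar_subalgebra_type_algebra)
  obtain h e where e: "e \<longlonglongrightarrow> 0" "\<And>k. 0 \<le> e k" and h: "\<forall>\<^sub>F k in sequentially. type_star_hom ?E (D k) (h k) \<and>
      (\<forall>x\<in>?E. norm (h k x - x) \<le> e k * norm x)"
    by (rule nearby_star_homs[OF D EL]) (rule that)
  have lim: "(\<lambda>k. e k + 2 * (2 * \<rho> k)) \<longlonglongrightarrow> 0 + 2 * (2 * 0)" by (intro tendsto_intros e(1) \<rho>0)
  have "\<forall>\<^sub>F k in sequentially. e k + 2 * (2 * \<rho> k) < \<delta>" using order_tendstoD(2)[OF lim, of \<delta>] \<delta>(1) by simp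
  moreover have "\<forall>\<^sub>F k in sequentially. e k < min 1 (\<epsilon>/2)" using order_tendstoD(2)[OF e(1), of "min 1 (\<epsilon>/2)"] \<epsilon> by simp
  ultimately have "\<forall>\<^sub>F k in sequentially. e k + 2 * (2 * \<rho> k) < \<delta> \<and> e k < min 1 (\<epsilon>/2) \<and>
      type_star_hom ?E (D k) (h k) \<and> (\<forall>x\<in>?E. norm (h k x - x) \<le> e k * norm x)"
    using h by eventually_elim auto
  then obtain k where k: "e k + 2 * (2 * \<rho> k) < \<delta>" "e k < 1" "e k < \<epsilon>/2"
    "type_star_hom ?E (D k) (h k)" "\<And>x. x \<in> ?E \<Longrightarrow> norm (h k x - x) \<le> e k * norm x"
    by (auto dest!: eventually_happens)
  obtain n2 B2 where B2: "(n2, B2) \<in> F" and isoY: "star_extendibly_isomorphic type_algebra (Y k) (matrix_algebra n2) B2"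
    and Ys: "subalgebra_of type_algebra (Y k)" using Y(2)[of k] by (auto simp: model_def)
  obtain \<beta> where \<beta>: "type_star_hom ?E (D k) \<beta>" "inj_on \<beta> ?E" "\<beta> ` X \<subseteq> Y k"
    "\<And>x. x \<in> X \<Longrightarrow> norm (\<beta> x - x) \<le> (\<epsilon>/2 + e k) * norm x"
  proof (rule stable_absorption[OF fam B1 B2 Xs isoX Ys isoY k(4)[unfolded D_def] k(5) e(2) k(2) less_imp_le[OF k(1)]])
    show "\<exists>y\<in>Y k. dist x y \<le> 2 * \<rho> k" if "x \<in> X" "norm x \<le> 1" for x using near that .
    show "0 \<le> 2 * \<rho> k" using \<rho>[of k] by simp
  qed (use \<delta>(2)[OF B2] in \<open>auto simp: D_def\<close>)
  have "norm (\<beta> x - x) \<le> \<epsilon> * norm x" if "x \<in> X" for x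
    using \<beta>(4)[OF that] mult_right_mono[of "\<epsilon>/2 + e k" \<epsilon> "norm x"] k(3) by simp
  then show thesis using result[OF Y(2,1,3)] \<beta>(1-3) unfolding D_def by blast
qed

section \<open>Limits of isometric *-homomorphisms\<close>

text \<open>
  Convergence is only assumed on \<open>X\<close>. The set of points of convergence is a C*-algebra, because the
  \<open>f j\<close> are isometric, and hence contains the C*-algebra generated by \<open>X\<close>.
\<close>

lemma pointwise_limit_star_hom:
  fixes f :: "nat \<Rightarrow> 'a::cstar_algebra \<Rightarrow> 'a"
  assumes f: "\<And>j. type_star_hom (cstar_gen X) UNIV (f j)"
    and iso: "\<And>j x. x \<in> cstar_gen X \<Longrightarrow> norm (f j x) = norm x"
    and conv: "\<And>x. x \<in> X \<Longrightarrow> convergent (\<lambda>j. f j x)"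
  obtains L where "type_star_hom (cstar_gen X) UNIV L"
    "\<And>x. x \<in> cstar_gen X \<Longrightarrow> (\<lambda>j. f j x) \<longlonglongrightarrow> L x"
    "\<And>x. x \<in> cstar_gen X \<Longrightarrow> norm (L x) = norm x"
proof -
  let ?E = "cstar_gen X"
  note result = that
  note fE = star_homD[OF f, simplified]
  have E: "star_subalg ?E" "closed ?E" by (rule gen_star_subalg)+
  have diff: "f j (x - y) = f j x - f j y" if "x \<in> ?E" "y \<in> ?E" for x y j
  proof -
    have "- y \<in> ?E" using that E(1) by (simp add: star_subalg_closed)
    then show ?thesis using fE(2)[OF that(1), of "- y"] fE(4)[OF that(2), of j "-1"] by simp
  qed
  define G where "G = {x \<in> ?E. convergent (\<lambda>j. f j x)}"
  have "star_subalg G"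
    unfolding star_subalg_def
  proof (intro conjI ballI allI)
    have z: "0 \<in> ?E" using E(1) by (rule star_subalg_zero)
    have "f j 0 = 0" for j using iso[OF z, of j] by simp
    then show "0 \<in> G" using z by (simp add: G_def convergent_const)
    fix x assume x: "x \<in> G"
    then obtain l where l: "x \<in> ?E" "(\<lambda>j. f j x) \<longlonglongrightarrow> l" by (auto simp: G_def convergent_def)
    show "star x \<in> G" using l E(1) tendsto_star[OF l(2)]
      by (auto simp: G_def star_subalg_star fE convergent_def)
    show "c *\<^sub>C x \<in> G" for c using l E(1) tendsto_scaleC[OF tendsto_const l(2)]
      by (auto simp: G_def star_subalg_scaleC fE convergent_def)
    fix y assume "y \<in> G"
    then obtain k where k: "y \<in> ?E" "(\<lambda>j. f j y) \<longlonglongrightarrow> k" by (auto simp: G_def convergent_def)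
    show "x + y \<in> G" using l k E(1) tendsto_add[OF l(2) k(2)]
      by (auto simp: G_def star_subalg_add fE convergent_def)
    show "x * y \<in> G" using l k E(1) tendsto_mult[OF l(2) k(2)]
      by (auto simp: G_def star_subalg_mult fE convergent_def)
  qed
  moreover have "closed G"
  proof -
    have "closure G \<subseteq> G"
    proof
      fix x assume x: "x \<in> closure G"
      have "closure G \<subseteq> ?E" using E(2) by (intro closure_minimal) (auto simp: G_def)
      then have xE: "x \<in> ?E" using x by blast
      have "Cauchy (\<lambda>j. f j x)"
        unfolding Cauchy_def
      proof (intro allI impI)
        fix e :: real assume e: "e > 0"
        then obtain y where y: "y \<in> G" "dist y x < e/3"
          using x unfolding closure_approachable by (meson divide_pos_pos zero_less_numeral)
        then have yE: "y \<in> ?E" and "Cauchy (\<lambda>j. f j y)"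
          by (auto simp: G_def convergent_Cauchy)
        then obtain N where N: "\<And>i j. i \<ge> N \<Longrightarrow> j \<ge> N \<Longrightarrow> dist (f i y) (f j y) < e/3"
          unfolding Cauchy_def using e by (meson divide_pos_pos zero_less_numeral)
        have close: "dist (f j x) (f j y) < e/3" for j
        proof -
          have "x - y \<in> ?E" using xE yE E(1) by (simp add: star_subalg_closed)
          then have "dist (f j x) (f j y) = norm (x - y)" using iso[of "x - y" j] by (simp add: dist_norm diff[OF xE yE])
          then show ?thesis using y(2) by (simp add: dist_norm norm_minus_commute)
        qed
        have "dist (f i x) (f j x) < e" if "i \<ge> N" "j \<ge> N" for i j
          using close[of i] close[of j] N[OF that] dist_triangle[of "f i x" "f j x" "f i y"]
            dist_triangle[of "f i y" "f j x" "f j y"] dist_commute[of "f j x" "f j y"] by linarith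
        then show "\<exists>M. \<forall>m\<ge>M. \<forall>n\<ge>M. dist (f m x) (f n x) < e" by blast
      qed
      then show "x \<in> G" using xE by (simp add: G_def Cauchy_convergent)
    qed
    then show ?thesis using closure_subset_eq by blast
  qed
  moreover have "X \<subseteq> G" using conv generated_cstar_base[of X type_algebra] by (auto simp: G_def)
  ultimately have "?E \<subseteq> G"
    by (intro generated_cstar_minimal) (simp_all add: cstar_subalgebra_type_algebra)
  then have lim: "(\<lambda>j. f j x) \<longlonglongrightarrow> lim (\<lambda>j. f j x)" if "x \<in> ?E" for x
    using that by (auto simp: G_def convergent_LIMSEQ_iff)
  define L where "L x = lim (\<lambda>j. f j x)" for x
  have L: "(\<lambda>j. f j x) \<longlonglongrightarrow> L x" if "x \<in> ?E" for x using lim[OF that] by (simp add: L_def)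
  have Leq: "L x = l" if "x \<in> ?E" "(\<lambda>j. f j x) \<longlonglongrightarrow> l" for x l
    using L[OF that(1)] that(2) LIMSEQ_unique by blast
  have "type_star_hom ?E UNIV L"
    unfolding star_hom_def algebra_hom_def
  proof (intro conjI ballI allI; simp)
    fix x assume x: "x \<in> ?E"
    show "L (star x) = star (L x)" using x E(1) tendsto_star[OF L[OF x]]
      by (intro Leq) (auto simp: fE star_subalg_star)
    show "L (c *\<^sub>C x) = c *\<^sub>C L x" for c using x E(1) tendsto_scaleC[OF tendsto_const L[OF x]]
      by (intro Leq) (auto simp: fE star_subalg_scaleC)
    fix y assume y: "y \<in> ?E"
    show "L (x + y) = L x + L y" using x y E(1) tendsto_add[OF L[OF x] L[OF y]]
      by (intro Leq) (auto simp: fE star_subalg_add)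
    show "L (x * y) = L x * L y" using x y E(1) tendsto_mult[OF L[OF x] L[OF y]]
      by (intro Leq) (auto simp: fE star_subalg_mult)
  qed
  moreover have "norm (L x) = norm x" if x: "x \<in> ?E" for x
  proof -
    have "(\<lambda>j. norm (f j x)) \<longlonglongrightarrow> norm (L x)" by (intro tendsto_norm L x)
    then show ?thesis using iso[OF x] LIMSEQ_unique[OF _ tendsto_const] by simp
  qed
  ultimately show thesis using result L by blast
qed

lemma model_image:
  fixes A X :: "'a::cstar_algebra set"
  assumes F: "matrix_algebra_family F" and X: "model F X"
    and L: "type_star_hom (cstar_gen X) (cstar_gen A) L"
    and inj: "inj_on L (cstar_gen X)" and LX: "L ` X \<subseteq> A"
  shows "model F (L ` X)"
proof -
  let ?E = "cstar_gen X"
  obtain n B where nB: "(n, B) \<in> F" and iso: "star_extendibly_isomorphic type_algebra X (matrix_algebra n) B"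
    using X by (auto simp: model_def)
  have B: "subalgebra_of (matrix_algebra n) B" using F nB by (auto simp: matrix_algebra_family_def)
  let ?C = "generated_cstar (matrix_algebra n) B"
  have XE: "X \<subseteq> ?E" by (rule generated_cstar_base)
  obtain \<phi> where \<phi>: "star_extendible_embedding (matrix_algebra n) B type_algebra X \<phi>" "\<phi> ` B = X"
    using iso_embedding[OF iso, of X] by blast
  then obtain \<Phi> where hom: "algebra_hom (matrix_algebra n) B type_algebra X \<phi>"
    and \<Phi>: "star_hom (matrix_algebra n) ?C type_algebra ?E \<Phi>" "inj_on \<Phi> ?C" "\<forall>b\<in>B. \<phi> b = \<Phi> b"
    unfolding star_extendible_embedding_def by blast
  have "star_extendible_embedding (matrix_algebra n) B type_algebra A (L \<circ> \<phi>)"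
    unfolding star_extendible_embedding_def
  proof (intro conjI exI[of _ "L \<circ> \<Phi>"])
    have b: "\<phi> b \<in> ?E" "\<phi> b \<in> X" if "b \<in> B" for b using \<phi>(2) XE that by auto
    show "algebra_hom (matrix_algebra n) B type_algebra A (L \<circ> \<phi>)"
      using hom b LX star_homD[OF L, simplified] by (auto simp: algebra_hom_def)
    show "star_hom (matrix_algebra n) ?C type_algebra (cstar_gen A) (L \<circ> \<Phi>)"
      by (rule star_hom_comp[OF \<Phi>(1) L])
    show "inj_on (L \<circ> \<Phi>) ?C"
      using star_homD(1)[OF \<Phi>(1)] by (intro comp_inj_on \<Phi>(2) inj_on_subset[OF inj]) auto
  qed (use \<Phi>(3) in auto)
  then have "subalgebra_of type_algebra ((L \<circ> \<phi>) ` B)"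
    "star_extendibly_isomorphic type_algebra ((L \<circ> \<phi>) ` B) (matrix_algebra n) B"
    using embedding_image_iso[OF B] by blast+
  moreover have "(L \<circ> \<phi>) ` B = L ` X" using \<phi>(2) by (metis image_comp)
  ultimately show ?thesis using nB by (auto simp: model_def)
qed

primrec compose_from :: "(nat \<Rightarrow> 'a \<Rightarrow> 'a) \<Rightarrow> nat \<Rightarrow> nat \<Rightarrow> 'a \<Rightarrow> 'a" where
  "compose_from \<beta> k 0 x = x"
| "compose_from \<beta> k (Suc j) x = \<beta> (k + j) (compose_from \<beta> k j x)"

lemma compose_from_shift: "compose_from \<beta> (Suc k) j (\<beta> k x) = compose_from \<beta> k (Suc j) x"
  by (induction j) simp_all

text \<open>
  A one-sided approximate intertwining: \<open>L k\<close> is the limit of \<open>\<beta> (k + j - 1) \<circ> \<dots> \<circ> \<beta> k\<close> as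
  \<open>j\<close> tends to infinity, and \<open>L k = L (Suc k) \<circ> \<beta> k\<close> makes the images increase.
\<close>

lemma intertwined_chain:
  fixes A :: "'a::cstar_algebra set" and X :: "nat \<Rightarrow> 'a set"
  assumes F: "matrix_algebra_family F" and A: "closed A"
    and X: "\<And>k. model F (X k)" "\<And>k. X k \<subseteq> A"
    and \<beta>: "\<And>k. type_star_hom (cstar_gen (X k)) (cstar_gen (X (Suc k))) (\<beta> k)"
      "\<And>k. inj_on (\<beta> k) (cstar_gen (X k))" "\<And>k. \<beta> k ` X k \<subseteq> X (Suc k)"
      "\<And>k x. x \<in> X k \<Longrightarrow> norm (\<beta> k x - x) \<le> (1/2) ^ k * norm x"
  obtains L where "\<And>k. model F (L k ` X k)" "\<And>k. L k ` X k \<subseteq> A" "\<And>k. L k ` X k \<subseteq> L (Suc k) ` X (Suc k)"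
    "\<And>k x. x \<in> X k \<Longrightarrow> norm (L k x - x) \<le> 2 * (1/2) ^ k * norm x"
proof -
  define E where "E k = cstar_gen (X k)" for k
  have XE: "X k \<subseteq> E k" for k unfolding E_def by (rule generated_cstar_base)
  have E: "star_subalg (E k)" "closed (E k)" for k unfolding E_def by (rule gen_star_subalg)+
  have EA: "E k \<subseteq> cstar_gen A" for k
    unfolding E_def using X(2)[of k] by (auto simp: generated_cstar_def)
  have \<beta>iso: "norm (\<beta> k x) = norm x" if x: "x \<in> E k" for k x
  proof -
    obtain n B where nB: "(n, B) \<in> F" and iso: "star_extendibly_isomorphic type_algebra (X k) (matrix_algebra n) B"
      using X(1)[of k] by (auto simp: model_def)
    have "subalgebra_of (matrix_algebra n) B" using F nB by (auto simp: matrix_algebra_family_def)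
    then obtain m w r where "matrix_units m w r (E k)" unfolding E_def using iso_generated[OF iso] by metis
    then interpret matrix_units m w r "E k" .
    show ?thesis
      using star_hom_isometric[OF type_algebra.cstar_record_axioms, of "\<beta> k" x] x
        star_hom_codomain[OF \<beta>(1)[of k] subset_UNIV] \<beta>(2)[of k] by (simp add: E_def)
  qed
  let ?c = "compose_from \<beta>"
  have c: "type_star_hom (E k) (E (k + j)) (?c k j)" for k j
  proof (induction j)
    case 0
    have "?c k 0 = (\<lambda>x. x)" by (rule ext) simp
    then show ?case by (simp add: star_hom_def algebra_hom_def)
  next
    case (Suc j)
    have eq: "?c k (Suc j) = \<beta> (k + j) \<circ> ?c k j" by (rule ext) simp
    show ?case unfolding eq by (rule star_hom_comp[OF Suc.IH]) (simp add: E_def \<beta>(1))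
  qed
  have cU: "type_star_hom (E k) UNIV (?c k j)" for k j
    using star_hom_codomain[OF c subset_UNIV] .
  have ciso: "norm (?c k j x) = norm x" if "x \<in> E k" for k j x
  proof (induction j)
    case (Suc j)
    then show ?case using \<beta>iso[OF star_homD(1)[OF c that, of j]] by simp
  qed simp
  have cX: "?c k j x \<in> X (k + j)" if "x \<in> X k" for k j x
    by (induction j) (use that \<beta>(3) in auto)
  have step: "norm (?c k (Suc j) x - ?c k j x) \<le> ((1/2) ^ k * norm x) * (1/2) ^ j" if x: "x \<in> X k" for k j x
    using \<beta>(4)[OF cX[OF x, of j]] ciso[of x k j] x XE[of k] by (auto simp: power_add mult_ac)
  have lim: "\<exists>z. (\<lambda>j. ?c k j x) \<longlonglongrightarrow> z \<and> norm (z - x) \<le> 2 * ((1/2) ^ k * norm x)" if x: "x \<in> X k" for k x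
    using geometric_steps_limit[of "\<lambda>j. ?c k j x", OF step[OF x]] by (metis compose_from.simps(1))
  have "\<exists>L. type_star_hom (E k) UNIV L \<and>
    (\<forall>x\<in>E k. (\<lambda>j. ?c k j x) \<longlonglongrightarrow> L x) \<and> (\<forall>x\<in>E k. norm (L x) = norm x)" for k
  proof -
    have conv: "convergent (\<lambda>j. ?c k j x)" if "x \<in> X k" for x using lim[OF that] by (auto simp: convergent_def)
    show ?thesis
      by (rule pointwise_limit_star_hom[OF cU[unfolded E_def] ciso[unfolded E_def] conv])
        (auto simp: E_def)
  qed
  then obtain L where L: "\<And>k. type_star_hom (E k) UNIV (L k)"
    "\<And>k x. x \<in> E k \<Longrightarrow> (\<lambda>j. ?c k j x) \<longlonglongrightarrow> L k x" "\<And>k x. x \<in> E k \<Longrightarrow> norm (L k x) = norm x"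
    by metis
  have LA: "L k ` X k \<subseteq> A" for k
  proof clarify
    fix x assume x: "x \<in> X k"
    have "?c k j x \<in> A" for j using cX[OF x] X(2) by blast
    moreover have "(\<lambda>j. ?c k j x) \<longlonglongrightarrow> L k x" using L(2) x XE by blast
    ultimately show "L k x \<in> A" by (rule closed_sequentially[OF A])
  qed
  have Lgen: "L k x \<in> cstar_gen A" if x: "x \<in> E k" for k x
  proof -
    have "?c k j x \<in> cstar_gen A" for j using star_homD(1)[OF c x] EA by blast
    then show ?thesis using closed_sequentially[OF gen_star_subalg(2) _ L(2)[OF x]] by blast
  qed
  have Linj: "inj_on (L k) (E k)" for k
  proof (rule inj_onI)
    fix x y assume xy: "x \<in> E k" "y \<in> E k" "L k x = L k y"
    have d: "- y \<in> E k" "x - y \<in> E k" using xy E(1)[of k] by (auto simp: star_subalg_closed)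
    have "L k (- y) = - L k y" using star_homD(4)[OF L(1)[of k], of y "-1"] xy by simp
    then have "L k (x - y) = 0" using star_homD(2)[OF L(1)[of k], of x "- y"] xy d by simp
    then show "x = y" using L(3)[OF d(2)] by simp
  qed
  have model: "model F (L k ` X k)" for k
  proof (rule model_image[OF F X(1) _ _ LA])
    show "type_star_hom (cstar_gen (X k)) (cstar_gen A) (L k)"
      using star_hom_codomain[OF L(1)[of k]] Lgen by (auto simp: E_def)
    show "inj_on (L k) (cstar_gen (X k))" using Linj by (simp add: E_def)
  qed
  have inc: "L k ` X k \<subseteq> L (Suc k) ` X (Suc k)" for k
  proof clarify
    fix x assume x: "x \<in> X k"
    then have b: "\<beta> k x \<in> X (Suc k)" using \<beta>(3) by blast
    have "(\<lambda>j. ?c (Suc k) j (\<beta> k x)) \<longlonglongrightarrow> L (Suc k) (\<beta> k x)" using L(2) b XE by blast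
    then have "(\<lambda>j. ?c k (Suc j) x) \<longlonglongrightarrow> L (Suc k) (\<beta> k x)" by (simp only: compose_from_shift)
    moreover have "(\<lambda>j. ?c k (Suc j) x) \<longlonglongrightarrow> L k x" using L(2)[of x k] x XE by (intro LIMSEQ_Suc) blast
    ultimately have "L k x = L (Suc k) (\<beta> k x)" using LIMSEQ_unique by blast
    then show "L k x \<in> L (Suc k) ` X (Suc k)" using b by blast
  qed
  have near: "norm (L k x - x) \<le> 2 * (1/2) ^ k * norm x" if x: "x \<in> X k" for k x
  proof -
    obtain z where z: "(\<lambda>j. ?c k j x) \<longlonglongrightarrow> z" "norm (z - x) \<le> 2 * ((1/2) ^ k * norm x)" using lim[OF x] by blast
    have "(\<lambda>j. ?c k j x) \<longlonglongrightarrow> L k x" using L(2) x XE by blast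
    then have "z = L k x" using z(1) LIMSEQ_unique by blast
    then show ?thesis using z(2) by simp
  qed
  show thesis by (rule that[OF model LA inc near])
qed

section \<open>Locally approximable separable algebras\<close>

text \<open>
  A dense subset of the subspace \<open>A\<close>, listed with repetitions.
\<close>

lemma dense_sequence:
  fixes A :: "'a::metric_space set"
  assumes "separable_space (top_of_set A)" "A \<noteq> {}"
  obtains s :: "nat \<Rightarrow> 'a" where "range s \<subseteq> A" "A \<subseteq> closure (range s)"
proof -
  obtain C where C: "countable C" "C \<subseteq> A" "(top_of_set A) closure_of C = A"
    using assms(1) by (auto simp: separable_space_def)
  have "A \<inter> C = C" using C(2) by blast
  then have "A \<inter> closure C = A" using C(3) by (simp add: closure_of_subtopology)
  then have AC: "A \<subseteq> closure C" by blast
  then have "C \<noteq> {}" using assms(2) by auto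
  then have "range (from_nat_into C) = C" using C(1) by (rule range_from_nat_into)
  then show thesis using that[of "from_nat_into C"] C(2) AC by simp
qed

text \<open>
  At stage \<open>k\<close> the algebra \<open>X k\<close> comes within \<open>2\<^sup>-\<^sup>k\<close> of the first \<open>k + 1\<close> members of a dense sequence, and
  passing to the limit moves a bounded part of \<open>X k\<close> by a multiple of \<open>2\<^sup>-\<^sup>k\<close> only.
\<close>

lemma approximable_chain:
  fixes A :: "'a::cstar_algebra set"
  assumes F: "stable_family F" and A: "closed A" "0 \<in> A" "separable_space (top_of_set A)"
    and approx: "approximable F A"
  obtains Y where "\<And>k. model F (Y k)" "\<And>k. Y k \<subseteq> A" "\<And>k. Y k \<subseteq> Y (Suc k)" "A = closure (\<Union>k. Y k)"
proof -
  have fam: "matrix_algebra_family F" using F by (simp add: stable_family_def)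
  obtain s :: "nat \<Rightarrow> 'a" where s: "range s \<subseteq> A" "A \<subseteq> closure (range s)"
    using dense_sequence[OF A(3)] A(2) by blast
  let ?P = "\<lambda>k X. model F X \<and> X \<subseteq> A \<and> (\<forall>i\<le>k. infdist (s i) X < (1/2) ^ k)"
  let ?Q = "\<lambda>k X Y. \<exists>\<beta>. type_star_hom (cstar_gen X) (cstar_gen Y) \<beta>
      \<and> inj_on \<beta> (cstar_gen X) \<and> \<beta> ` X \<subseteq> Y \<and> (\<forall>x\<in>X. norm (\<beta> x - x) \<le> (1/2) ^ k * norm x)"
  have S: "finite (s ` {..k})" "s ` {..k} \<subseteq> A" for k using s(1) by auto
  have half: "(1/2::real) ^ k > 0" for k by simp
  have "\<exists>X. \<forall>k. ?P k (X k) \<and> ?Q k (X k) (X (Suc k))"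
  proof (rule dependent_nat_choice)
    obtain X where "X \<subseteq> A" "model F X" "\<forall>a\<in>s ` {..0}. infdist a X < (1/2) ^ 0"
      using approx S[of 0] half[of 0] unfolding approximable_def by meson
    then show "\<exists>X. ?P 0 X" by auto
  next
    fix X k assume X: "?P k X"
    obtain Y \<beta> where Y: "model F Y" "Y \<subseteq> A" "\<And>a. a \<in> s ` {..Suc k} \<Longrightarrow> infdist a Y < (1/2) ^ Suc k"
      and \<beta>: "type_star_hom (cstar_gen X) (cstar_gen Y) \<beta>"
      "inj_on \<beta> (cstar_gen X)" "\<beta> ` X \<subseteq> Y"
      "\<And>x. x \<in> X \<Longrightarrow> norm (\<beta> x - x) \<le> (1/2) ^ Suc k * norm x"
      using next_algebra[OF F approx _ _ half[of "Suc k"] S[of "Suc k"], of X] X by blast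
    have "norm (\<beta> x - x) \<le> (1/2) ^ k * norm x" if "x \<in> X" for x
      by (rule order_trans[OF \<beta>(4)[OF that] mult_right_mono]) simp_all
    then show "\<exists>Y. ?P (Suc k) Y \<and> ?Q k X Y" using Y \<beta>(1-3) by (intro exI[of _ Y]) auto
  qed
  then obtain X \<beta> where X: "\<And>k. model F (X k)" "\<And>k. X k \<subseteq> A"
      "\<And>k i. i \<le> k \<Longrightarrow> infdist (s i) (X k) < (1/2) ^ k"
    and \<beta>: "\<And>k. type_star_hom (cstar_gen (X k)) (cstar_gen (X (Suc k))) (\<beta> k)"
      "\<And>k. inj_on (\<beta> k) (cstar_gen (X k))" "\<And>k. \<beta> k ` X k \<subseteq> X (Suc k)"
      "\<And>k x. x \<in> X k \<Longrightarrow> norm (\<beta> k x - x) \<le> (1/2) ^ k * norm x"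
    by metis
  obtain L where L: "\<And>k. model F (L k ` X k)" "\<And>k. L k ` X k \<subseteq> A" "\<And>k. L k ` X k \<subseteq> L (Suc k) ` X (Suc k)"
    and near: "\<And>k x. x \<in> X k \<Longrightarrow> norm (L k x - x) \<le> 2 * (1/2) ^ k * norm x"
    using intertwined_chain[OF fam A(1) X(1,2) \<beta>] by blast
  let ?U = "\<Union>k. L k ` X k"
  have "s i \<in> closure ?U" for i
    unfolding closure_approachable
  proof (intro allI impI)
    fix e :: real assume e: "e > 0"
    define M where "M = 1 + 2 * (norm (s i) + 1)"
    have M: "M > 0" by (simp add: M_def add_pos_nonneg)
    then obtain N where N: "(1/2::real) ^ N < e / M" using real_arch_pow_inv[of "e / M" "1/2"] e by auto
    define k where "k = max i N"
    have "(1/2::real) ^ k \<le> (1/2) ^ N" by (rule power_decreasing) (auto simp: k_def)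
    then have "(1/2) ^ k * M \<le> (1/2) ^ N * M" using M by (intro mult_right_mono) auto
    also have "(1/2) ^ N * M < e" using N by (simp only: pos_less_divide_eq[OF M])
    finally have k: "(1/2) ^ k * M < e" .
    have ne: "X k \<noteq> {}" using X(1)[of k] by (auto simp: model_def subalgebra_of_def)
    have "\<exists>x\<in>X k. dist (s i) x < (1/2) ^ k" using X(3)[of i k] by (intro infdist_lessD[OF ne]) (simp add: k_def)
    then obtain x where x: "x \<in> X k" "norm (s i - x) < (1/2) ^ k" by (auto simp: dist_norm)
    have "(1/2::real) ^ k \<le> 1" by (simp add: power_le_one)
    then have "norm x \<le> norm (s i) + 1"
      using norm_triangle_sub[of x "s i"] x(2) norm_minus_commute[of x "s i"] by linarith
    then have "2 * (1/2) ^ k * norm x \<le> 2 * (1/2) ^ k * (norm (s i) + 1)" by (intro mult_left_mono) auto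
    then have "norm (L k x - x) \<le> 2 * (1/2) ^ k * (norm (s i) + 1)" using near[OF x(1)] by linarith
    moreover have "norm (L k x - s i) \<le> norm (L k x - x) + norm (s i - x)"
      using norm_triangle_ineq[of "L k x - x" "x - s i"] by (simp add: norm_minus_commute)
    ultimately have "norm (L k x - s i) < (1/2) ^ k + 2 * (1/2) ^ k * (norm (s i) + 1)"
      using x(2) by linarith
    also have "\<dots> = (1/2) ^ k * M" by (simp add: M_def algebra_simps)
    finally have "dist (L k x) (s i) < e" using k by (simp add: dist_norm)
    then show "\<exists>y\<in>?U. dist y (s i) < e" using x(1) by blast
  qed
  then have "closure (range s) \<subseteq> closure ?U" by (intro closure_minimal) auto
  moreover have "closure ?U \<subseteq> A" using L(2) A(1) by (intro closure_minimal) auto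
  ultimately have "A = closure ?U" using s(2) by blast
  then show thesis using that[of "\<lambda>k. L k ` X k"] L by blast
qed

theorem mainTheorem2:
  fixes F :: "(nat \<times> complex mat set) set" and A :: "'a::cstar_algebra set"
  assumes stable: "stable_family F"
    and subalgebra: "subalgebra_of type_algebra A"
    and closed: "closed A"
    and separable: "separable_space (top_of_set A)"
  shows "(\<exists>\<A> :: nat \<Rightarrow> 'a set.
            (\<forall>i. subalgebra_of type_algebra (\<A> i) \<and> \<A> i \<subseteq> A \<and> \<A> i \<subseteq> \<A> (Suc i)) \<and>
            A = closure (\<Union>i. \<A> i) \<and>
            (\<forall>i. \<exists>(n, B)\<in>F. star_extendibly_isomorphic type_algebra (\<A> i) (matrix_algebra n) B))
     \<longleftrightarrow>
         (\<forall>\<epsilon>>0. \<forall>S. finite S \<and> S \<subseteq> A \<longrightarrow>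
            (\<exists>(n, B)\<in>F. \<exists>\<phi>. star_extendible_embedding (matrix_algebra n) B type_algebra A \<phi> \<and>
               (\<forall>s\<in>S. infdist s (\<phi> ` B) < \<epsilon>)))"
    (is "?chain \<longleftrightarrow> ?local")
proof
  assume ?chain
  then obtain \<A> :: "nat \<Rightarrow> 'a set" where sub: "\<And>i. \<A> i \<subseteq> A" and mono: "\<And>i. \<A> i \<subseteq> \<A> (Suc i)"
    and dense: "A = closure (\<Union>i. \<A> i)"
    and iso: "\<And>i. \<exists>(n, B)\<in>F. star_extendibly_isomorphic type_algebra (\<A> i) (matrix_algebra n) B"
    by blast
  have inc: "\<A> i \<subseteq> \<A> j" if "i \<le> j" for i j using lift_Suc_mono_le[of \<A>] mono that by blast
  show ?local
  proof (intro allI impI)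
    fix \<epsilon> :: real and S assume \<epsilon>: "\<epsilon> > 0" and S: "finite S \<and> S \<subseteq> A"
    have "\<exists>i. \<exists>x\<in>\<A> i. dist x s < \<epsilon>" if "s \<in> S" for s
    proof -
      have "s \<in> closure (\<Union>i. \<A> i)" using that S dense by blast
      then show ?thesis using \<epsilon> unfolding closure_approachable by blast
    qed
    then obtain i where i: "\<And>s. s \<in> S \<Longrightarrow> \<exists>x\<in>\<A> (i s). dist x s < \<epsilon>" by metis
    define k where "k = Max (insert 0 (i ` S))"
    have ik: "i s \<le> k" if "s \<in> S" for s unfolding k_def using S that by (intro Max_ge) auto
    have near: "infdist s (\<A> k) < \<epsilon>" if s: "s \<in> S" for s
    proof -
      obtain x where x: "x \<in> \<A> (i s)" "dist x s < \<epsilon>" using i[OF s] by blast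
      then have "x \<in> \<A> k" using inc[OF ik[OF s]] by blast
      then have "infdist s (\<A> k) \<le> dist s x" by (rule infdist_le)
      then show ?thesis using x(2) by (simp add: dist_commute)
    qed
    obtain n B where nB: "(n, B) \<in> F" and iso: "star_extendibly_isomorphic type_algebra (\<A> k) (matrix_algebra n) B"
      using iso[of k] by blast
    obtain \<phi> where "star_extendible_embedding (matrix_algebra n) B type_algebra A \<phi>" "\<phi> ` B = \<A> k"
      using iso_embedding[OF iso sub] by blast
    then show "\<exists>(n, B)\<in>F. \<exists>\<phi>. star_extendible_embedding (matrix_algebra n) B type_algebra A \<phi> \<and>
               (\<forall>s\<in>S. infdist s (\<phi> ` B) < \<epsilon>)"
      using nB near by (intro bexI[of _ "(n, B)"]) auto
  qed
next
  assume loc: ?local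
  have fam: "matrix_algebra_family F" using stable by (simp add: stable_family_def)
  have "approximable F A"
    unfolding approximable_def
  proof (intro allI impI)
    fix \<epsilon> :: real and S assume \<epsilon>: "\<epsilon> > 0" and S: "finite S \<and> S \<subseteq> A"
    obtain n B \<phi> where nB: "(n, B) \<in> F" and \<phi>: "star_extendible_embedding (matrix_algebra n) B type_algebra A \<phi>"
      and near: "\<forall>s\<in>S. infdist s (\<phi> ` B) < \<epsilon>"
      using loc[rule_format, OF \<epsilon> S] by blast
    have B: "subalgebra_of (matrix_algebra n) B" using fam nB by (auto simp: matrix_algebra_family_def)
    show "\<exists>X\<subseteq>A. model F X \<and> (\<forall>s\<in>S. infdist s X < \<epsilon>)"
      using embedding_image_iso[OF B \<phi>] nB near by (intro exI[of _ "\<phi> ` B"]) (auto simp: model_def)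
  qed
  moreover have "0 \<in> A" using subalgebra by (simp add: subalgebra_of_def)
  ultimately obtain Y where Y: "\<And>k. model F (Y k)" "\<And>k. Y k \<subseteq> A" "\<And>k. Y k \<subseteq> Y (Suc k)" "A = closure (\<Union>k. Y k)"
    using approximable_chain[OF stable closed _ separable] by blast
  show ?chain
    by (rule exI[of _ Y]) (use Y in \<open>auto simp: model_def\<close>)
qed

end
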